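(* Let $\mathcal{M}$ be a bicategory, let $\mathcal{W}$ be the class of invertible $2$-cells of $\mathcal{M}$, and let $X$ be a nonempty set. There is an equivalence (of categories, for the morphisms specified in the context) between the following data: (i) an $\overline{X}$-point of $(\mathcal{M},\mathcal{W})$; (ii) an enriched category over the bicategory $\mathcal{M}$ having $X$ as set of objects (i.e. a polyad of Bénabou).
   Context: $\overline{X}$ is the coarse category on $X$: its set of objects is $X$, and there is exactly one arrow, denoted $(A,B)$, from $A$ to $B$ for all $A,B\in X$. For a small category $\mathcal{C}$, the $2$-path-category $\mathscr{P}_{\mathcal{C}}$ is the following strict $2$-category. Its objects are those of $\mathcal{C}$. Objects of $\mathscr{P}_{\mathcal{C}}(A,B)$ are pairs $[n,s]$ with $s=(A=A_0\xrightarrow{f_0}A_1\to\cdots\xrightarrow{f_{n-1}}A_n=B)$ a chain of $n\ge1$ composable arrows of $\mathcal{C}$, and also one object $[0,A]$ if $A=B$. Writing $n=\{0,\dots,n-1\}$, a morphism $[n,s]\to[m,t]$ is a nondecreasing map $u:n\to m$ such that, for each $j<m$, the $j$-th arrow of $t$ is the composite, in order, of the arrows $f_i$ of $s$ with $u(i)=j$ (an identity if there are none). Composition of $1$-cells is concatenation, $t\otimes s=[n+m,\ s\text{ followed by }t]$, on $2$-cells it is the ordinal sum $u'\otimes u=u+u'$, and the identity of $A$ is $[0,A]$. Composition of $1$-cells in a bicategory is written $\otimes$: for $f:U\to V$ and $g:V\to W$, $g\otimes f:U\to W$; horizontal composition of $2$-cells is also written $\otimes$. For a class $\mathcal{W}$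 of $2$-cells of $\mathcal{M}$ containing the invertible $2$-cells, with the vertical $3$-out-of-$2$ property and stable under horizontal composition, a $\mathcal{C}$-point of $(\mathcal{M},\mathcal{W})$ is a colax morphism of bicategories $F=(F,\varphi):\mathscr{P}_{\mathcal{C}}\to\mathcal{M}$ (an oplax functor: a map on objects, functors $F_{AB}:\mathscr{P}_{\mathcal{C}}(A,B)\to\mathcal{M}(FA,FB)$, natural $2$-cells $\varphi(A,B,C)(t,s):F_{AC}(t\otimes s)\to F_{BC}(t)\otimes F_{AB}(s)$ and $2$-cells $\varphi_A:F_{AA}([0,A])\to I_{FA}$ satisfying the usual associativity and unit coherence axioms) such that all $\varphi(A,B,C)(t,s)$ and $\varphi_A$ are in $\mathcal{W}$. An $\mathcal{M}$-category $\mathcal{A}$ consists of: for each object $U$ of $\mathcal{M}$, a set $\mathcal{A}_U$ of objects over $U$; for objects $A,B$ over $U,V$, an arrow $\mathcal{A}(A,B):U\to V$ of $\mathcal{M}$; for each $A$ over $U$, a $2$-cell $I_A:\mathrm{Id}_U\Rightarrow\mathcal{A}(A,A)$; for objects $A,B,C$ over $U,V,W$, a $2$-cell $c_{ABC}:\mathcal{A}(B,C)\otimes\mathcal{A}(A,B)\Rightarrow\mathcal{A}(A,C)$; satisfying the usual left identity, right identity and associativity axioms. Its set of objects is $X=\bigsqcup_U\mathcal{A}_U$. Morphisms in (i): from $(F,\varphi)$ to $(G,\psi)$, existing only when $FA=GA$ for all $A\in X$, families of natural transformations $\sigma:F_{AB}\to G_{AB}$ with $\psi(t,s)\circ\sigma_{t\otimes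 s}=(\sigma_t\otimes\sigma_s)\circ\varphi(t,s)$ and $\psi_A\circ\sigma_{[0,A]}=\varphi_A$ (transformations whose $1$-cell components are identities). Morphisms in (ii): $\mathcal{M}$-functors that are the identity on $X$, i.e. for $\mathcal{A},\mathcal{B}$ with each element of $X$ over the same object of $\mathcal{M}$ in both, families of $2$-cells $\mathcal{A}(A,B)\Rightarrow\mathcal{B}(A,B)$ compatible with the units and compositions. *)

theory Defs
  imports Main "HOL-Library.FuncSet" "HOL-Library.Disjoint_Sets"
begin

section \<open>Categories and equivalences of categories\<close>

record ('o, 'a) cat =
  Obj :: "'o set"
  Arr :: "'a set"
  Dom :: "'a \<Rightarrow> 'o"
  Cod :: "'a \<Rightarrow> 'o"
  Idn :: "'o \<Rightarrow> 'a"
  Comp :: "'a \<Rightarrow> 'a \<Rightarrow> 'a" (infixr "\<cdot>\<index>" 55)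

definition hom :: "('o, 'a, 'z) cat_scheme \<Rightarrow> 'o \<Rightarrow> 'o \<Rightarrow> 'a set" where
  "hom C a b = {f \<in> Arr C. Dom C f = a \<and> Cod C f = b}"

locale category =
  fixes C :: "('o, 'a, 'z) cat_scheme" (structure)
  assumes Dom_in: "f \<in> Arr C \<Longrightarrow> Dom C f \<in> Obj C"
    and Cod_in: "f \<in> Arr C \<Longrightarrow> Cod C f \<in> Obj C"
    and Idn_in: "a \<in> Obj C \<Longrightarrow> Idn C a \<in> hom C a a"
    and Comp_in: "\<lbrakk>f \<in> hom C a b; g \<in> hom C b c\<rbrakk> \<Longrightarrow> g \<cdot> f \<in> hom C a c"
    and Comp_Idn_left: "f \<in> Arr C \<Longrightarrow> Idn C (Cod C f) \<cdot> f = f"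
    and Comp_Idn_right: "f \<in> Arr C \<Longrightarrow> f \<cdot> Idn C (Dom C f) = f"
    and Comp_assoc:
      "\<lbrakk>f \<in> hom C a b; g \<in> hom C b c; h \<in> hom C c d\<rbrakk> \<Longrightarrow> (h \<cdot> g) \<cdot> f = h \<cdot> (g \<cdot> f)"

definition isos :: "('o, 'a, 'z) cat_scheme \<Rightarrow> 'a set" where
  "isos C = {f \<in> Arr C. \<exists>g \<in> hom C (Cod C f) (Dom C f).
     g \<cdot>\<^bsub>C\<^esub> f = Idn C (Dom C f) \<and> f \<cdot>\<^bsub>C\<^esub> g = Idn C (Cod C f)}"

definition is_functor ::
  "('o, 'a, 'z) cat_scheme \<Rightarrow> ('p, 'b, 'y) cat_scheme \<Rightarrow> ('o \<Rightarrow> 'p) \<Rightarrow> ('a \<Rightarrow> 'b) \<Rightarrow> bool" where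
  "is_functor C D Fo Fa \<longleftrightarrow>
     (\<forall>a \<in> Obj C. Fo a \<in> Obj D) \<and>
     (\<forall>f \<in> Arr C. Fa f \<in> hom D (Fo (Dom C f)) (Fo (Cod C f))) \<and>
     (\<forall>a \<in> Obj C. Fa (Idn C a) = Idn D (Fo a)) \<and>
     (\<forall>f \<in> Arr C. \<forall>g \<in> Arr C. Cod C f = Dom C g \<longrightarrow> Fa (g \<cdot>\<^bsub>C\<^esub> f) = Fa g \<cdot>\<^bsub>D\<^esub> Fa f)"

definition is_nat_trans ::
  "('o, 'a, 'z) cat_scheme \<Rightarrow> ('p, 'b, 'y) cat_scheme \<Rightarrow>
   ('o \<Rightarrow> 'p) \<Rightarrow> ('a \<Rightarrow> 'b) \<Rightarrow> ('o \<Rightarrow> 'p) \<Rightarrow> ('a \<Rightarrow> 'b) \<Rightarrow> ('o \<Rightarrow> 'b) \<Rightarrow> bool" where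
  "is_nat_trans C D Fo Fa Go Ga \<tau> \<longleftrightarrow>
     (\<forall>a \<in> Obj C. \<tau> a \<in> hom D (Fo a) (Go a)) \<and>
     (\<forall>f \<in> Arr C. Ga f \<cdot>\<^bsub>D\<^esub> \<tau> (Dom C f) = \<tau> (Cod C f) \<cdot>\<^bsub>D\<^esub> Fa f)"

definition is_nat_iso ::
  "('o, 'a, 'z) cat_scheme \<Rightarrow> ('p, 'b, 'y) cat_scheme \<Rightarrow>
   ('o \<Rightarrow> 'p) \<Rightarrow> ('a \<Rightarrow> 'b) \<Rightarrow> ('o \<Rightarrow> 'p) \<Rightarrow> ('a \<Rightarrow> 'b) \<Rightarrow> ('o \<Rightarrow> 'b) \<Rightarrow> bool" where
  "is_nat_iso C D Fo Fa Go Ga \<tau> \<longleftrightarrow>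
     is_nat_trans C D Fo Fa Go Ga \<tau> \<and> (\<forall>a \<in> Obj C. \<tau> a \<in> isos D)"

definition equivalent_categories ::
  "('o, 'a, 'z) cat_scheme \<Rightarrow> ('p, 'b, 'y) cat_scheme \<Rightarrow> bool" where
  "equivalent_categories C D \<longleftrightarrow>
     category C \<and> category D \<and>
     (\<exists>Fo Fa Go Ga \<eta> \<epsilon>.
        is_functor C D Fo Fa \<and> is_functor D C Go Ga \<and>
        is_nat_iso C C id id (Go \<circ> Fo) (Ga \<circ> Fa) \<eta> \<and>
        is_nat_iso D D (Fo \<circ> Go) (Fa \<circ> Ga) id id \<epsilon>)"

definition coarse :: "'x set \<Rightarrow> ('x, 'x \<times> 'x) cat" where
  "coarse X = \<lparr>Obj = X, Arr = X \<times> X, Dom = fst, Cod = snd,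
     Idn = (\<lambda>A. (A, A)), Comp = (\<lambda>g f. (fst f, snd g))\<rparr>"


section \<open>Bicategories\<close>

text \<open>A bicategory extends the category whose objects are the 1-cells and whose arrows are the
  2-cells, under vertical composition, that is, the disjoint union of all hom-categories.
  So \<open>Obj M\<close> is the set of 1-cells and \<open>Arr M\<close> the set of 2-cells, while the
  objects of the bicategory are \<open>Obj0 M\<close>.\<close>

record ('o, 'a, 'c) bicat = "('a, 'c) cat" +
  Obj0 :: "'o set"
  Src :: "'a \<Rightarrow> 'o"
  Trg :: "'a \<Rightarrow> 'o"
  Idn1 :: "'o \<Rightarrow> 'a"
  HComp1 :: "'a \<Rightarrow> 'a \<Rightarrow> 'a" (infixr "\<otimes>\<index>" 70)
  HComp2 :: "'c \<Rightarrow> 'c \<Rightarrow> 'c" (infixr "\<odot>\<index>" 70)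
  Assoc :: "'a \<Rightarrow> 'a \<Rightarrow> 'a \<Rightarrow> 'c"
  Lunit :: "'a \<Rightarrow> 'c"
  Runit :: "'a \<Rightarrow> 'c"

definition hom1 :: "('o, 'a, 'c, 'z) bicat_scheme \<Rightarrow> 'o \<Rightarrow> 'o \<Rightarrow> 'a set" where
  "hom1 M U V = {f \<in> Obj M. Src M f = U \<and> Trg M f = V}"

locale bicategory = category M
  for M :: "('o, 'a, 'c, 'z) bicat_scheme" (structure) +
  assumes Src_in: "f \<in> Obj M \<Longrightarrow> Src M f \<in> Obj0 M"
    and Trg_in: "f \<in> Obj M \<Longrightarrow> Trg M f \<in> Obj0 M"
    and Src_Dom_Cod: "\<alpha> \<in> Arr M \<Longrightarrow> Src M (Dom M \<alpha>) = Src M (Cod M \<alpha>)"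
    and Trg_Dom_Cod: "\<alpha> \<in> Arr M \<Longrightarrow> Trg M (Dom M \<alpha>) = Trg M (Cod M \<alpha>)"
    and Idn1_in: "U \<in> Obj0 M \<Longrightarrow> Idn1 M U \<in> hom1 M U U"
    and HComp1_in: "\<lbrakk>f \<in> hom1 M U V; g \<in> hom1 M V W\<rbrakk> \<Longrightarrow> g \<otimes> f \<in> hom1 M U W"
    and HComp2_in:
      "\<lbrakk>f \<in> hom1 M U V; g \<in> hom1 M V W; \<alpha> \<in> hom M f f'; \<beta> \<in> hom M g g'\<rbrakk>
        \<Longrightarrow> \<beta> \<odot> \<alpha> \<in> hom M (g \<otimes> f) (g' \<otimes> f')"
    and HComp2_Idn:
      "\<lbrakk>f \<in> hom1 M U V; g \<in> hom1 M V W\<rbrakk> \<Longrightarrow> Idn M g \<odot> Idn M f = Idn M (g \<otimes> f)"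
    and interchange:
      "\<lbrakk>f \<in> hom1 M U V; g \<in> hom1 M V W;
        \<alpha> \<in> hom M f f'; \<alpha>' \<in> hom M f' f''; \<beta> \<in> hom M g g'; \<beta>' \<in> hom M g' g''\<rbrakk>
        \<Longrightarrow> (\<beta>' \<cdot> \<beta>) \<odot> (\<alpha>' \<cdot> \<alpha>) = (\<beta>' \<odot> \<alpha>') \<cdot> (\<beta> \<odot> \<alpha>)"
    and Assoc_in:
      "\<lbrakk>f \<in> hom1 M U V; g \<in> hom1 M V W; h \<in> hom1 M W Z\<rbrakk>
        \<Longrightarrow> Assoc M h g f \<in> hom M ((h \<otimes> g) \<otimes> f) (h \<otimes> (g \<otimes> f)) \<inter> isos M"
    and Assoc_natural:
      "\<lbrakk>f \<in> hom1 M U V; g \<in> hom1 M V W; h \<in> hom1 M W Z;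
        \<alpha> \<in> hom M f f'; \<beta> \<in> hom M g g'; \<gamma> \<in> hom M h h'\<rbrakk>
        \<Longrightarrow> Assoc M h' g' f' \<cdot> ((\<gamma> \<odot> \<beta>) \<odot> \<alpha>) = (\<gamma> \<odot> (\<beta> \<odot> \<alpha>)) \<cdot> Assoc M h g f"
    and Lunit_in: "f \<in> hom1 M U V \<Longrightarrow> Lunit M f \<in> hom M (Idn1 M V \<otimes> f) f \<inter> isos M"
    and Lunit_natural:
      "\<lbrakk>f \<in> hom1 M U V; \<alpha> \<in> hom M f f'\<rbrakk>
        \<Longrightarrow> Lunit M f' \<cdot> (Idn M (Idn1 M V) \<odot> \<alpha>) = \<alpha> \<cdot> Lunit M f"
    and Runit_in: "f \<in> hom1 M U V \<Longrightarrow> Runit M f \<in> hom M (f \<otimes> Idn1 M U) f \<inter> isos M"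
    and Runit_natural:
      "\<lbrakk>f \<in> hom1 M U V; \<alpha> \<in> hom M f f'\<rbrakk>
        \<Longrightarrow> Runit M f' \<cdot> (\<alpha> \<odot> Idn M (Idn1 M U)) = \<alpha> \<cdot> Runit M f"
    and pentagon:
      "\<lbrakk>f \<in> hom1 M U V; g \<in> hom1 M V W; h \<in> hom1 M W Z; k \<in> hom1 M Z Z'\<rbrakk>
        \<Longrightarrow> Assoc M k h (g \<otimes> f) \<cdot> Assoc M (k \<otimes> h) g f
          = (Idn M k \<odot> Assoc M h g f) \<cdot> (Assoc M k (h \<otimes> g) f \<cdot> (Assoc M k h g \<odot> Idn M f))"
    and triangle:
      "\<lbrakk>f \<in> hom1 M U V; g \<in> hom1 M V W\<rbrakk>
        \<Longrightarrow> (Idn M g \<odot> Lunit M f) \<cdot> Assoc M g (Idn1 M V) f = Runit M g \<odot> Idn M f"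

text \<open>All families of cells below are \<^const>\<open>extensional\<close>, so that they are determined by their
  values on the indices that matter.\<close>

record ('o, 'a, 'c, 'p, 'b, 'd) colax =
  Map0 :: "'o \<Rightarrow> 'p"
  Map1 :: "'a \<Rightarrow> 'b"
  Map2 :: "'c \<Rightarrow> 'd"
  Cmp :: "'a \<times> 'a \<Rightarrow> 'd"
  Unt :: "'o \<Rightarrow> 'd"

locale colax_morphism =
  fixes B :: "('o, 'a, 'c, 'z) bicat_scheme"
    and M :: "('p, 'b, 'd, 'y) bicat_scheme" (structure)
    and F :: "('o, 'a, 'c, 'p, 'b, 'd) colax"
  assumes Map0_in: "Map0 F \<in> Obj0 B \<rightarrow>\<^sub>E Obj0 M"
    and Map1_in: "f \<in> hom1 B U V \<Longrightarrow> Map1 F f \<in> hom1 M (Map0 F U) (Map0 F V)"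
    and Map1_ext: "Map1 F \<in> extensional (Obj B)"
    and Map_functor: "is_functor B M (Map1 F) (Map2 F)"
    and Map2_ext: "Map2 F \<in> extensional (Arr B)"
    and Cmp_in:
      "\<lbrakk>s \<in> hom1 B U V; t \<in> hom1 B V W\<rbrakk>
        \<Longrightarrow> Cmp F (t, s) \<in> hom M (Map1 F (t \<otimes>\<^bsub>B\<^esub> s)) (Map1 F t \<otimes> Map1 F s)"
    and Cmp_ext: "Cmp F \<in> extensional {(t, s). t \<in> Obj B \<and> s \<in> Obj B \<and> Trg B s = Src B t}"
    and Cmp_natural:
      "\<lbrakk>s \<in> hom1 B U V; t \<in> hom1 B V W; \<alpha> \<in> hom B s s'; \<beta> \<in> hom B t t'\<rbrakk>
        \<Longrightarrow> Cmp F (t', s') \<cdot> Map2 F (\<beta> \<odot>\<^bsub>B\<^esub> \<alpha>) = (Map2 F \<beta> \<odot> Map2 F \<alpha>) \<cdot> Cmp F (t, s)"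
    and Unt_in: "U \<in> Obj0 B \<Longrightarrow> Unt F U \<in> hom M (Map1 F (Idn1 B U)) (Idn1 M (Map0 F U))"
    and Unt_ext: "Unt F \<in> extensional (Obj0 B)"
    and Cmp_assoc:
      "\<lbrakk>s \<in> hom1 B U V; t \<in> hom1 B V W; r \<in> hom1 B W Z\<rbrakk>
        \<Longrightarrow> Assoc M (Map1 F r) (Map1 F t) (Map1 F s) \<cdot>
              ((Cmp F (r, t) \<odot> Idn M (Map1 F s)) \<cdot> Cmp F (r \<otimes>\<^bsub>B\<^esub> t, s))
          = (Idn M (Map1 F r) \<odot> Cmp F (t, s)) \<cdot>
              (Cmp F (r, t \<otimes>\<^bsub>B\<^esub> s) \<cdot> Map2 F (Assoc B r t s))"
    and Cmp_Lunit:
      "s \<in> hom1 B U V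
        \<Longrightarrow> Lunit M (Map1 F s) \<cdot> ((Unt F V \<odot> Idn M (Map1 F s)) \<cdot> Cmp F (Idn1 B V, s))
          = Map2 F (Lunit B s)"
    and Cmp_Runit:
      "s \<in> hom1 B U V
        \<Longrightarrow> Runit M (Map1 F s) \<cdot> ((Idn M (Map1 F s) \<odot> Unt F U) \<cdot> Cmp F (s, Idn1 B U))
          = Map2 F (Runit B s)"


section \<open>The 2-path-category\<close>

text \<open>The 1-cell \<open>[n, s]\<close> from \<open>A\<close> to \<open>B\<close> is the triple \<open>(A, fs, B)\<close>, where \<open>fs\<close> is the list of
  the \<open>n\<close> arrows of \<open>s\<close>; in particular \<open>[0, A]\<close> is \<open>(A, [], A)\<close>.  A nondecreasing map
  \<open>u : n \<rightarrow> m\<close> is the sorted list of its \<open>n\<close> values, and the 2-cell \<open>u : s \<rightarrow> t\<close> is the triple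
  \<open>(s, u, t)\<close>.\<close>

type_synonym ('o, 'a) path = "'o \<times> 'a list \<times> 'o"
type_synonym ('o, 'a) path_cell = "('o, 'a) path \<times> nat list \<times> ('o, 'a) path"

fun is_chain :: "('o, 'a, 'z) cat_scheme \<Rightarrow> 'o \<Rightarrow> 'a list \<Rightarrow> 'o \<Rightarrow> bool" where
  "is_chain C A [] B \<longleftrightarrow> A \<in> Obj C \<and> A = B"
| "is_chain C A (f # fs) B \<longleftrightarrow> f \<in> Arr C \<and> Dom C f = A \<and> is_chain C (Cod C f) fs B"

fun composite :: "('o, 'a, 'z) cat_scheme \<Rightarrow> 'o \<Rightarrow> 'a list \<Rightarrow> 'a" where
  "composite C A [] = Idn C A"
| "composite C A (f # fs) = composite C (Cod C f) fs \<cdot>\<^bsub>C\<^esub> f"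

definition paths :: "('o, 'a, 'z) cat_scheme \<Rightarrow> ('o, 'a) path set" where
  "paths C = {(A, fs, B). is_chain C A fs B}"

definition path_cells :: "('o, 'a, 'z) cat_scheme \<Rightarrow> ('o, 'a) path_cell set" where
  "path_cells C = {((A, fs, B), u, (A', gs, B')).
     (A, fs, B) \<in> paths C \<and> (A', gs, B') \<in> paths C \<and> A = A' \<and> B = B' \<and>
     length u = length fs \<and> sorted u \<and> set u \<subseteq> {..<length gs} \<and>
     (\<forall>j < length gs. gs ! j = composite C (Dom C (gs ! j)) (nths fs {i. u ! i = j}))}"

definition path_id :: "('o, 'a) path \<Rightarrow> ('o, 'a) path_cell" where
  "path_id = (\<lambda>(A, fs, B). ((A, fs, B), [0..<length fs], (A, fs, B)))"

definition path_vcomp ::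
  "('o, 'a) path_cell \<Rightarrow> ('o, 'a) path_cell \<Rightarrow> ('o, 'a) path_cell" where
  "path_vcomp = (\<lambda>(t, v, r) (s, u, t'). (s, map (\<lambda>i. v ! i) u, r))"

definition path_append :: "('o, 'a) path \<Rightarrow> ('o, 'a) path \<Rightarrow> ('o, 'a) path" where
  "path_append = (\<lambda>(B, gs, C) (A, fs, B'). (A, fs @ gs, C))"

definition path_hcomp ::
  "('o, 'a) path_cell \<Rightarrow> ('o, 'a) path_cell \<Rightarrow> ('o, 'a) path_cell" where
  "path_hcomp = (\<lambda>(t, u', t') (s, u, s').
     (path_append t s, u @ map (\<lambda>j. length (fst (snd s')) + j) u', path_append t' s'))"

definition path_bicat ::
  "('o, 'a, 'z) cat_scheme \<Rightarrow> ('o, ('o, 'a) path, ('o, 'a) path_cell) bicat" where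
  "path_bicat C = \<lparr>
     Obj = paths C, Arr = path_cells C, Dom = fst, Cod = snd \<circ> snd,
     Idn = path_id, Comp = path_vcomp,
     Obj0 = Obj C, Src = fst, Trg = snd \<circ> snd, Idn1 = (\<lambda>A. (A, [], A)),
     HComp1 = path_append, HComp2 = path_hcomp,
     Assoc = (\<lambda>r t s. path_id (path_append (path_append r t) s)),
     Lunit = path_id, Runit = path_id\<rparr>"


section \<open>The category of points\<close>

definition is_weak_class :: "('o, 'a, 'c, 'z) bicat_scheme \<Rightarrow> 'c set \<Rightarrow> bool" where
  "is_weak_class M W \<longleftrightarrow>
     W \<subseteq> Arr M \<and> isos M \<subseteq> W \<and>
     (\<forall>\<alpha> \<in> Arr M. \<forall>\<beta> \<in> Arr M. Cod M \<alpha> = Dom M \<beta> \<longrightarrow>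
        (\<alpha> \<in> W \<and> \<beta> \<in> W \<longrightarrow> \<beta> \<cdot>\<^bsub>M\<^esub> \<alpha> \<in> W) \<and>
        (\<alpha> \<in> W \<and> \<beta> \<cdot>\<^bsub>M\<^esub> \<alpha> \<in> W \<longrightarrow> \<beta> \<in> W) \<and>
        (\<beta> \<in> W \<and> \<beta> \<cdot>\<^bsub>M\<^esub> \<alpha> \<in> W \<longrightarrow> \<alpha> \<in> W)) \<and>
     (\<forall>\<alpha> \<in> W. \<forall>\<beta> \<in> W. Trg M (Dom M \<alpha>) = Src M (Dom M \<beta>) \<longrightarrow> \<beta> \<odot>\<^bsub>M\<^esub> \<alpha> \<in> W)"

context bicategory begin

lemma isos_Comp: assumes "\<alpha> \<in> isos M" "\<beta> \<in> isos M" "Cod M \<alpha> = Dom M \<beta>" shows "\<beta> \<cdot> \<alpha> \<in> isos M"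
proof -
  obtain a where a: "a \<in> hom M (Cod M \<alpha>) (Dom M \<alpha>)" "a \<cdot> \<alpha> = Idn M (Dom M \<alpha>)" "\<alpha> \<cdot> a = Idn M (Cod M \<alpha>)" "\<alpha> \<in> Arr M"
    using assms(1) by (auto simp: isos_def)
  obtain b where b: "b \<in> hom M (Cod M \<beta>) (Dom M \<beta>)" "b \<cdot> \<beta> = Idn M (Dom M \<beta>)" "\<beta> \<cdot> b = Idn M (Cod M \<beta>)" "\<beta> \<in> Arr M"
    using assms(2) by (auto simp: isos_def)
  have h: "\<alpha> \<in> hom M (Dom M \<alpha>) (Cod M \<alpha>)" "\<beta> \<in> hom M (Cod M \<alpha>) (Cod M \<beta>)" using a b assms(3) by (auto simp: hom_def)
  have b1: "b \<in> hom M (Cod M \<beta>) (Cod M \<alpha>)" using b assms(3) by simp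
  have ba: "\<beta> \<cdot> \<alpha> \<in> hom M (Dom M \<alpha>) (Cod M \<beta>)" by (rule Comp_in[OF h])
  have ab: "a \<cdot> b \<in> hom M (Cod M \<beta>) (Dom M \<alpha>)" by (rule Comp_in[OF b1 a(1)])
  have "(a \<cdot> b) \<cdot> (\<beta> \<cdot> \<alpha>) = a \<cdot> ((b \<cdot> \<beta>) \<cdot> \<alpha>)"
    by (simp only: Comp_assoc[OF ba b1 a(1)] Comp_assoc[OF h b1])
  also have "\<dots> = Idn M (Dom M \<alpha>)" using a(2) b(2) assms(3) Comp_Idn_left[OF a(4)] by simp
  finally have 1: "(a \<cdot> b) \<cdot> (\<beta> \<cdot> \<alpha>) = Idn M (Dom M \<alpha>)" .
  have "(\<beta> \<cdot> \<alpha>) \<cdot> (a \<cdot> b) = \<beta> \<cdot> ((\<alpha> \<cdot> a) \<cdot> b)"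
    by (simp only: Comp_assoc[OF ab h] Comp_assoc[OF b1 a(1) h(1)])
  also have "\<dots> = Idn M (Cod M \<beta>)" using a(3) b(3) b1 Comp_Idn_left[of b] by (simp add: hom_def)
  finally show ?thesis using 1 ba ab unfolding isos_def hom_def by auto
qed

lemma isos_inv: assumes "\<alpha> \<in> isos M"
  obtains a where "a \<in> isos M" "a \<in> hom M (Cod M \<alpha>) (Dom M \<alpha>)" "a \<cdot> \<alpha> = Idn M (Dom M \<alpha>)" "\<alpha> \<cdot> a = Idn M (Cod M \<alpha>)"
  using assms by (fastforce simp: isos_def hom_def)

lemma is_weak_class_isos: "is_weak_class M (isos M)"
  unfolding is_weak_class_def
proof (intro conjI ballI impI)
  show "isos M \<subseteq> Arr M" by (auto simp: isos_def)
next
  fix \<alpha> \<beta> assume h: "\<alpha> \<in> Arr M" "\<beta> \<in> Arr M" "Cod M \<alpha> = Dom M \<beta>"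
  have hh: "\<alpha> \<in> hom M (Dom M \<alpha>) (Cod M \<alpha>)" "\<beta> \<in> hom M (Cod M \<alpha>) (Cod M \<beta>)" using h by (auto simp: hom_def)
  have c: "\<beta> \<cdot> \<alpha> \<in> hom M (Dom M \<alpha>) (Cod M \<beta>)" by (rule Comp_in[OF hh])
  { assume "\<alpha> \<in> isos M \<and> \<beta> \<in> isos M" then show "\<beta> \<cdot> \<alpha> \<in> isos M" using h isos_Comp by blast }
  { assume A: "\<alpha> \<in> isos M \<and> \<beta> \<cdot> \<alpha> \<in> isos M"
    obtain a where a: "a \<in> isos M" "a \<in> hom M (Cod M \<alpha>) (Dom M \<alpha>)" "\<alpha> \<cdot> a = Idn M (Cod M \<alpha>)"
      using A isos_inv by blast
    have "(\<beta> \<cdot> \<alpha>) \<cdot> a = \<beta>" using Comp_assoc[OF a(2) hh] a(3) h Comp_Idn_right by simp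
    then show "\<beta> \<in> isos M" using isos_Comp[of a "\<beta> \<cdot> \<alpha>"] a A c by (auto simp: hom_def) }
  { assume A: "\<beta> \<in> isos M \<and> \<beta> \<cdot> \<alpha> \<in> isos M"
    obtain b where b: "b \<in> isos M" "b \<in> hom M (Cod M \<beta>) (Cod M \<alpha>)" "b \<cdot> \<beta> = Idn M (Cod M \<alpha>)"
      using A isos_inv h by metis
    have "b \<cdot> (\<beta> \<cdot> \<alpha>) = \<alpha>" using Comp_assoc[OF hh b(2)] b(3) Comp_Idn_left[OF h(1)] by metis
    then show "\<alpha> \<in> isos M" using isos_Comp[of "\<beta> \<cdot> \<alpha>" b] b A c by (auto simp: hom_def) }
next
  fix \<alpha> \<beta> assume h: "\<alpha> \<in> isos M" "\<beta> \<in> isos M" "Trg M (Dom M \<alpha>) = Src M (Dom M \<beta>)"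
  obtain a where a: "a \<in> hom M (Cod M \<alpha>) (Dom M \<alpha>)" "a \<cdot> \<alpha> = Idn M (Dom M \<alpha>)" "\<alpha> \<cdot> a = Idn M (Cod M \<alpha>)" "\<alpha> \<in> Arr M"
    using h by (auto simp: isos_def)
  obtain b where b: "b \<in> hom M (Cod M \<beta>) (Dom M \<beta>)" "b \<cdot> \<beta> = Idn M (Dom M \<beta>)" "\<beta> \<cdot> b = Idn M (Cod M \<beta>)" "\<beta> \<in> Arr M"
    using h by (auto simp: isos_def)
  let ?U = "Src M (Dom M \<alpha>)" let ?V = "Trg M (Dom M \<alpha>)" let ?W = "Trg M (Dom M \<beta>)"
  have d: "Dom M \<alpha> \<in> hom1 M ?U ?V" "Cod M \<alpha> \<in> hom1 M ?U ?V" "Dom M \<beta> \<in> hom1 M ?V ?W" "Cod M \<beta> \<in> hom1 M ?V ?W"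
    using a b h Src_Dom_Cod Trg_Dom_Cod Dom_in Cod_in by (auto simp: hom1_def)
  have k: "\<alpha> \<in> hom M (Dom M \<alpha>) (Cod M \<alpha>)" "\<beta> \<in> hom M (Dom M \<beta>) (Cod M \<beta>)" using a b by (auto simp: hom_def)
  have "(b \<odot> a) \<cdot> (\<beta> \<odot> \<alpha>) = Idn M (Dom M \<beta> \<otimes> Dom M \<alpha>)"
    using interchange[OF d(1) d(3) k(1) a(1) k(2) b(1)] a b HComp2_Idn[OF d(1) d(3)] by simp
  moreover have "(\<beta> \<odot> \<alpha>) \<cdot> (b \<odot> a) = Idn M (Cod M \<beta> \<otimes> Cod M \<alpha>)"
    using interchange[OF d(2) d(4) a(1) k(1) b(1) k(2)] a b HComp2_Idn[OF d(2) d(4)] by simp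
  moreover note HComp2_in[OF d(1) d(3) k] HComp2_in[OF d(2) d(4) a(1) b(1)]
  ultimately show "\<beta> \<odot> \<alpha> \<in> isos M" by (auto simp: isos_def hom_def)
qed (auto)

end

type_synonym ('x, 'f, 'o, 'a, 'c) point =
  "('x, ('x, 'f) path, ('x, 'f) path_cell, 'o, 'a, 'c) colax"

definition is_point ::
  "('x, 'f, 'y) cat_scheme \<Rightarrow> ('o, 'a, 'c, 'z) bicat_scheme \<Rightarrow> 'c set \<Rightarrow>
   ('x, 'f, 'o, 'a, 'c) point \<Rightarrow> bool" where
  "is_point C M W F \<longleftrightarrow>
     is_weak_class M W \<and>
     colax_morphism (path_bicat C) M F \<and>
     (\<forall>s \<in> paths C. \<forall>t \<in> paths C. Trg (path_bicat C) s = Src (path_bicat C) t \<longrightarrow>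
        Cmp F (t, s) \<in> W) \<and>
     (\<forall>A \<in> Obj C. Unt F A \<in> W)"

definition is_point_mor ::
  "('x, 'f, 'y) cat_scheme \<Rightarrow> ('o, 'a, 'c, 'z) bicat_scheme \<Rightarrow>
   ('x, 'f, 'o, 'a, 'c) point \<Rightarrow> ('x, 'f, 'o, 'a, 'c) point \<Rightarrow> (('x, 'f) path \<Rightarrow> 'c) \<Rightarrow> bool" where
  "is_point_mor C M F G \<sigma> \<longleftrightarrow>
     (\<forall>A \<in> Obj C. Map0 F A = Map0 G A) \<and>
     \<sigma> \<in> extensional (paths C) \<and>
     is_nat_trans (path_bicat C) M (Map1 F) (Map2 F) (Map1 G) (Map2 G) \<sigma> \<and>
     (\<forall>s \<in> paths C. \<forall>t \<in> paths C. Trg (path_bicat C) s = Src (path_bicat C) t \<longrightarrow>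
        Cmp G (t, s) \<cdot>\<^bsub>M\<^esub> \<sigma> (path_append t s) = (\<sigma> t \<odot>\<^bsub>M\<^esub> \<sigma> s) \<cdot>\<^bsub>M\<^esub> Cmp F (t, s)) \<and>
     (\<forall>A \<in> Obj C. Unt G A \<cdot>\<^bsub>M\<^esub> \<sigma> (A, [], A) = Unt F A)"

definition point_cat ::
  "('x, 'f, 'y) cat_scheme \<Rightarrow> ('o, 'a, 'c, 'z) bicat_scheme \<Rightarrow> 'c set \<Rightarrow>
   (('x, 'f, 'o, 'a, 'c) point,
    ('x, 'f, 'o, 'a, 'c) point \<times> (('x, 'f) path \<Rightarrow> 'c) \<times> ('x, 'f, 'o, 'a, 'c) point) cat" where
  "point_cat C M W = \<lparr>
     Obj = {F. is_point C M W F},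
     Arr = {(F, \<sigma>, G). is_point C M W F \<and> is_point C M W G \<and> is_point_mor C M F G \<sigma>},
     Dom = fst, Cod = snd \<circ> snd,
     Idn = (\<lambda>F. (F, restrict (\<lambda>s. Idn M (Map1 F s)) (paths C), F)),
     Comp = (\<lambda>(G, \<tau>, H) (F, \<sigma>, G'). (F, restrict (\<lambda>s. \<tau> s \<cdot>\<^bsub>M\<^esub> \<sigma> s) (paths C), H))\<rparr>"


section \<open>Enriched categories\<close>

record ('x, 'o, 'a, 'c) enriched =
  Over :: "'o \<Rightarrow> 'x set"
  EHom :: "'x \<times> 'x \<Rightarrow> 'a"
  EId :: "'x \<Rightarrow> 'c"
  EComp :: "'x \<times> 'x \<times> 'x \<Rightarrow> 'c"

definition EObj ::
  "('o, 'a, 'c, 'z) bicat_scheme \<Rightarrow> ('x, 'o, 'a, 'c) enriched \<Rightarrow> 'x set" where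
  "EObj M \<A> = (\<Union>U \<in> Obj0 M. Over \<A> U)"

locale enriched_category =
  fixes M :: "('o, 'a, 'c, 'z) bicat_scheme" (structure)
    and \<A> :: "('x, 'o, 'a, 'c) enriched"
  assumes Over_disjoint: "disjoint_family_on (Over \<A>) (Obj0 M)"
    and Over_ext: "U \<notin> Obj0 M \<Longrightarrow> Over \<A> U = {}"
    and EHom_in:
      "\<lbrakk>U \<in> Obj0 M; V \<in> Obj0 M; A \<in> Over \<A> U; B \<in> Over \<A> V\<rbrakk>
        \<Longrightarrow> EHom \<A> (A, B) \<in> hom1 M U V"
    and EHom_ext: "EHom \<A> \<in> extensional (EObj M \<A> \<times> EObj M \<A>)"
    and EId_in:
      "\<lbrakk>U \<in> Obj0 M; A \<in> Over \<A> U\<rbrakk> \<Longrightarrow> EId \<A> A \<in> hom M (Idn1 M U) (EHom \<A> (A, A))"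
    and EId_ext: "EId \<A> \<in> extensional (EObj M \<A>)"
    and EComp_in:
      "\<lbrakk>A \<in> EObj M \<A>; B \<in> EObj M \<A>; C \<in> EObj M \<A>\<rbrakk>
        \<Longrightarrow> EComp \<A> (A, B, C) \<in> hom M (EHom \<A> (B, C) \<otimes> EHom \<A> (A, B)) (EHom \<A> (A, C))"
    and EComp_ext: "EComp \<A> \<in> extensional (EObj M \<A> \<times> EObj M \<A> \<times> EObj M \<A>)"
    and EId_left:
      "\<lbrakk>A \<in> EObj M \<A>; B \<in> EObj M \<A>\<rbrakk>
        \<Longrightarrow> EComp \<A> (A, B, B) \<cdot> (EId \<A> B \<odot> Idn M (EHom \<A> (A, B))) = Lunit M (EHom \<A> (A, B))"
    and EId_right:
      "\<lbrakk>A \<in> EObj M \<A>; B \<in> EObj M \<A>\<rbrakk>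
        \<Longrightarrow> EComp \<A> (A, A, B) \<cdot> (Idn M (EHom \<A> (A, B)) \<odot> EId \<A> A) = Runit M (EHom \<A> (A, B))"
    and EComp_assoc:
      "\<lbrakk>A \<in> EObj M \<A>; B \<in> EObj M \<A>; C \<in> EObj M \<A>; D \<in> EObj M \<A>\<rbrakk>
        \<Longrightarrow> EComp \<A> (A, B, D) \<cdot> (EComp \<A> (B, C, D) \<odot> Idn M (EHom \<A> (A, B)))
          = EComp \<A> (A, C, D) \<cdot>
              ((Idn M (EHom \<A> (C, D)) \<odot> EComp \<A> (A, B, C)) \<cdot>
                Assoc M (EHom \<A> (C, D)) (EHom \<A> (B, C)) (EHom \<A> (A, B)))"

definition is_enriched_mor ::
  "('o, 'a, 'c, 'z) bicat_scheme \<Rightarrow> 'x set \<Rightarrow>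
   ('x, 'o, 'a, 'c) enriched \<Rightarrow> ('x, 'o, 'a, 'c) enriched \<Rightarrow> ('x \<times> 'x \<Rightarrow> 'c) \<Rightarrow> bool" where
  "is_enriched_mor M X \<A> \<B> T \<longleftrightarrow>
     (\<forall>U \<in> Obj0 M. Over \<A> U = Over \<B> U) \<and>
     T \<in> extensional (X \<times> X) \<and>
     (\<forall>A \<in> X. \<forall>B \<in> X. T (A, B) \<in> hom M (EHom \<A> (A, B)) (EHom \<B> (A, B))) \<and>
     (\<forall>A \<in> X. T (A, A) \<cdot>\<^bsub>M\<^esub> EId \<A> A = EId \<B> A) \<and>
     (\<forall>A \<in> X. \<forall>B \<in> X. \<forall>C \<in> X.
        T (A, C) \<cdot>\<^bsub>M\<^esub> EComp \<A> (A, B, C)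
          = EComp \<B> (A, B, C) \<cdot>\<^bsub>M\<^esub> (T (B, C) \<odot>\<^bsub>M\<^esub> T (A, B)))"

definition enriched_cat ::
  "('o, 'a, 'c, 'z) bicat_scheme \<Rightarrow> 'x set \<Rightarrow>
   (('x, 'o, 'a, 'c) enriched,
    ('x, 'o, 'a, 'c) enriched \<times> ('x \<times> 'x \<Rightarrow> 'c) \<times> ('x, 'o, 'a, 'c) enriched) cat" where
  "enriched_cat M X = \<lparr>
     Obj = {\<A>. enriched_category M \<A> \<and> EObj M \<A> = X},
     Arr = {(\<A>, T, \<B>). enriched_category M \<A> \<and> EObj M \<A> = X \<and>
              enriched_category M \<B> \<and> EObj M \<B> = X \<and> is_enriched_mor M X \<A> \<B> T},
     Dom = fst, Cod = snd \<circ> snd,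
     Idn = (\<lambda>\<A>. (\<A>, restrict (\<lambda>p. Idn M (EHom \<A> p)) (X \<times> X), \<A>)),
     Comp = (\<lambda>(\<B>, S, \<C>) (\<A>, T, \<B>'). (\<A>, restrict (\<lambda>p. S p \<cdot>\<^bsub>M\<^esub> T p) (X \<times> X), \<C>))\<rparr>"

end

theory Submission
  imports Defs
begin

text \<open>A point \<open>F\<close> is sent to the enriched category with \<open>F[1, (A, B)]\<close> as arrow from \<open>A\<close> to \<open>B\<close>, whose
  composition is \<open>F\<close> of the unique map \<open>2 \<rightarrow> 1\<close> after the inverse of the comparison cell, and whose
  unit is \<open>F\<close> of \<open>0 \<rightarrow> 1\<close> after the inverse of the unit cell.  This functor is an equivalence:
  since the comparison cells are invertible, a morphism of points is determined by its components on
  paths of length one, and the extension of such components to all paths is natural because every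
  nondecreasing map is an ordinal sum of maps \<open>n \<rightarrow> 1\<close>, which are generated by \<open>0 \<rightarrow> 1\<close> and \<open>2 \<rightarrow> 1\<close>
  (fullness and faithfulness).  Conversely an enriched category yields a point by sending a path to the
  iterated composite of its arrows, bracketed to one side and started with an identity 1-cell; this
  point gives back \<open>I \<otimes> \<A>(A, B)\<close>, isomorphic to \<open>\<A>(A, B)\<close> by the left unit constraint
  (essential surjectivity).\<close>

section \<open>Equivalences of categories\<close>

text \<open>Full faithfulness and a preimage of each object suffice, so no functor from enriched
  categories to points is built on morphisms, and iterated composites are studied for one enriched
  category at a time. The obstacle is that \<open>M\<close> is not strict. In place of a general
  coherence theorem, one bracketing is fixed by recursion on the path, so that each law is one
  induction with a unit law at the base and associativity or naturality in the step. Starting with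
  an identity 1-cell lets the empty path be the base case, with an identity as unit cell; the price
  is the extra factor on paths of length one and the need for unit coherences beyond the triangle
  axiom. Coarseness enters through the 2-cells: parallel arrows coincide, so the composite condition
  only says that the blocks of the source path end where the arrows of the target path end.
  Nondecreasing maps thus become an inductive predicate, and the same block decomposition drives the
  functoriality of the constructed point and the naturality of an extended morphism. Equations
  involving inverses of comparison cells are checked after composing with an invertible cell, which
  is then cancelled.\<close>

context category
begin

lemma Comp_simps [simp]:
  assumes "f \<in> Arr C" "g \<in> Arr C" "Cod C f = Dom C g"
  shows "g \<cdot> f \<in> Arr C" "Dom C (g \<cdot> f) = Dom C f" "Cod C (g \<cdot> f) = Cod C g"
  using Comp_in[of f "Dom C f" "Cod C f" g "Cod C g"] assms by (auto simp: hom_def)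

lemma Idn_simps [simp]:
  assumes "a \<in> Obj C"
  shows "Idn C a \<in> Arr C" "Dom C (Idn C a) = a" "Cod C (Idn C a) = a"
  using Idn_in[OF assms] by (auto simp: hom_def)

lemma Comp_Idn_simps [simp]:
  "f \<in> Arr C \<Longrightarrow> Cod C f = a \<Longrightarrow> Idn C a \<cdot> f = f"
  "f \<in> Arr C \<Longrightarrow> Dom C f = a \<Longrightarrow> f \<cdot> Idn C a = f"
  using Comp_Idn_left Comp_Idn_right by auto

text \<open>Fixes right-nested composites as normal form. The steps in later calculations that only
  regroup factors rest on this rule.\<close>

lemma Comp_Comp [simp]:
  assumes "f \<in> Arr C" "g \<in> Arr C" "h \<in> Arr C" "Cod C f = Dom C g" "Cod C g = Dom C h"
  shows "(h \<cdot> g) \<cdot> f = h \<cdot> (g \<cdot> f)"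
  using Comp_assoc[of f "Dom C f" "Cod C f" g "Cod C g" h "Cod C h"] assms by (auto simp: hom_def)

lemma Dom_Cod_in [simp]: "f \<in> Arr C \<Longrightarrow> Dom C f \<in> Obj C" "f \<in> Arr C \<Longrightarrow> Cod C f \<in> Obj C"
  using Dom_in Cod_in by auto

definition inv_of where
  "inv_of f = (SOME g. g \<in> hom C (Cod C f) (Dom C f) \<and>
     g \<cdot> f = Idn C (Dom C f) \<and> f \<cdot> g = Idn C (Cod C f))"

lemma inv_of:
  assumes "f \<in> isos C"
  shows "inv_of f \<in> Arr C" "Dom C (inv_of f) = Cod C f" "Cod C (inv_of f) = Dom C f"
    "inv_of f \<cdot> f = Idn C (Dom C f)" "f \<cdot> inv_of f = Idn C (Cod C f)"
proof -
  have "\<exists>g. g \<in> hom C (Cod C f) (Dom C f) \<and> g \<cdot> f = Idn C (Dom C f) \<and> f \<cdot> g = Idn C (Cod C f)"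
    using assms by (auto simp: isos_def)
  from someI_ex[OF this, folded inv_of_def]
  show "inv_of f \<in> Arr C" "Dom C (inv_of f) = Cod C f" "Cod C (inv_of f) = Dom C f"
    "inv_of f \<cdot> f = Idn C (Dom C f)" "f \<cdot> inv_of f = Idn C (Cod C f)"
    by (auto simp: hom_def)
qed

lemma isos_Arr: "f \<in> isos C \<Longrightarrow> f \<in> Arr C"
  by (simp add: isos_def)

declare inv_of [simp]

lemma inv_of_Comp [simp]:
  assumes "f \<in> isos C" "x \<in> Arr C"
  shows "Cod C x = Dom C f \<Longrightarrow> inv_of f \<cdot> (f \<cdot> x) = x"
    "Cod C x = Cod C f \<Longrightarrow> f \<cdot> (inv_of f \<cdot> x) = x"
proof -
  note f = isos_Arr[OF assms(1)]
  show "inv_of f \<cdot> (f \<cdot> x) = x" if "Cod C x = Dom C f"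
    using assms f that by (subst Comp_Comp[symmetric]) auto
  show "f \<cdot> (inv_of f \<cdot> x) = x" if "Cod C x = Cod C f"
    using assms f that by (subst Comp_Comp[symmetric]) auto
qed

lemma isosI:
  assumes "f \<in> Arr C" "g \<in> Arr C" "Dom C g = Cod C f" "Cod C g = Dom C f"
    "g \<cdot> f = Idn C (Dom C f)" "f \<cdot> g = Idn C (Cod C f)"
  shows "f \<in> isos C"
  using assms by (auto simp: isos_def hom_def)

lemma inv_of_isos [simp]: "f \<in> isos C \<Longrightarrow> inv_of f \<in> isos C"
  by (rule isosI[of _ f]) (auto simp: isos_Arr)

lemma Idn_isos [simp]: "a \<in> Obj C \<Longrightarrow> Idn C a \<in> isos C"
  by (rule isosI[of _ "Idn C a"]) auto

lemma isos_cancel_left: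
  assumes "p \<cdot> x = p \<cdot> y" "p \<in> isos C" "x \<in> Arr C" "y \<in> Arr C" "Cod C x = Dom C p" "Cod C y = Dom C p"
  shows "x = y"
  using assms inv_of_Comp(1)[of p x] inv_of_Comp(1)[of p y] by metis

lemma isos_cancel_right:
  assumes "x \<cdot> p = y \<cdot> p" "p \<in> isos C" "x \<in> Arr C" "y \<in> Arr C" "Dom C x = Cod C p" "Dom C y = Cod C p"
  shows "x = y"
proof -
  have "(x \<cdot> p) \<cdot> inv_of p = (y \<cdot> p) \<cdot> inv_of p" using assms by simp
  then show ?thesis using assms(2-) isos_Arr[OF assms(2)] by simp
qed

end

text \<open>The quasi-inverse and both isomorphisms are obtained by choice; every equation in
  \<open>C\<close> is checked after applying \<open>Fa\<close>, which is enough by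
  faithfulness.\<close>

lemma equivalent_categoriesI:
  assumes C: "category C" and D: "category D" and F: "is_functor C D Fo Fa"
    and faithful: "\<And>f g. f \<in> Arr C \<Longrightarrow> g \<in> Arr C \<Longrightarrow> Dom C f = Dom C g \<Longrightarrow> Cod C f = Cod C g
      \<Longrightarrow> Fa f = Fa g \<Longrightarrow> f = g"
    and full: "\<And>a b h. a \<in> Obj C \<Longrightarrow> b \<in> Obj C \<Longrightarrow> h \<in> hom D (Fo a) (Fo b) \<Longrightarrow> \<exists>f \<in> hom C a b. Fa f = h"
    and surj: "\<And>d. d \<in> Obj D \<Longrightarrow> \<exists>c \<in> Obj C. \<exists>e \<in> isos D. Dom D e = Fo c \<and> Cod D e = d"
  shows "equivalent_categories C D"
proof -
  interpret C: category C by fact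
  interpret D: category D by fact
  define Go where "Go d = (SOME c. c \<in> Obj C \<and> (\<exists>e \<in> isos D. Dom D e = Fo c \<and> Cod D e = d))" for d
  define \<epsilon> where "\<epsilon> d = (SOME e. e \<in> isos D \<and> Dom D e = Fo (Go d) \<and> Cod D e = d)" for d
  have Go: "Go d \<in> Obj C \<and> (\<exists>e \<in> isos D. Dom D e = Fo (Go d) \<and> Cod D e = d)" if "d \<in> Obj D" for d
    unfolding Go_def using someI_ex[of "\<lambda>c. c \<in> Obj C \<and> (\<exists>e \<in> isos D. Dom D e = Fo c \<and> Cod D e = d)"]
      surj[OF that] by blast
  have \<epsilon>: "\<epsilon> d \<in> isos D \<and> Dom D (\<epsilon> d) = Fo (Go d) \<and> Cod D (\<epsilon> d) = d" if "d \<in> Obj D" for d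
    unfolding \<epsilon>_def using someI_ex[of "\<lambda>e. e \<in> isos D \<and> Dom D e = Fo (Go d) \<and> Cod D e = d"]
      Go[OF that] by blast
  note \<epsilon>Arr = D.isos_Arr[OF conjunct1[OF \<epsilon>]]
  define lift where "lift a b h = (SOME f. f \<in> hom C a b \<and> Fa f = h)" for a b h
  have lift: "lift a b h \<in> Arr C" "Dom C (lift a b h) = a" "Cod C (lift a b h) = b" "Fa (lift a b h) = h"
    if "a \<in> Obj C" "b \<in> Obj C" "h \<in> Arr D" "Dom D h = Fo a" "Cod D h = Fo b" for a b h
  proof -
    have "\<exists>f. f \<in> hom C a b \<and> Fa f = h"
      using full[OF that(1,2), of h] that(3-) by (auto simp: hom_def)
    from someI_ex[OF this, folded lift_def]
    show "lift a b h \<in> Arr C" "Dom C (lift a b h) = a" "Cod C (lift a b h) = b" "Fa (lift a b h) = h"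
      by (auto simp: hom_def)
  qed
  have Fo: "\<And>a. a \<in> Obj C \<Longrightarrow> Fo a \<in> Obj D" and
    Fa: "\<And>f. f \<in> Arr C \<Longrightarrow> Fa f \<in> Arr D" "\<And>f. f \<in> Arr C \<Longrightarrow> Dom D (Fa f) = Fo (Dom C f)"
      "\<And>f. f \<in> Arr C \<Longrightarrow> Cod D (Fa f) = Fo (Cod C f)"
      "\<And>a. a \<in> Obj C \<Longrightarrow> Fa (Idn C a) = Idn D (Fo a)"
      "\<And>f g. f \<in> Arr C \<Longrightarrow> g \<in> Arr C \<Longrightarrow> Cod C f = Dom C g \<Longrightarrow> Fa (g \<cdot>\<^bsub>C\<^esub> f) = Fa g \<cdot>\<^bsub>D\<^esub> Fa f"
    using F by (auto simp: is_functor_def hom_def)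
  \<comment> \<open>\<open>h\<close> is conjugated by the chosen isomorphisms before it is lifted,
    which makes \<open>\<epsilon>\<close> natural; \<open>\<eta>\<close> below lifts the inverse of
    \<open>\<epsilon>\<close> at \<open>Fo c\<close>.\<close>
  define Ga where "Ga h = lift (Go (Dom D h)) (Go (Cod D h))
    (D.inv_of (\<epsilon> (Cod D h)) \<cdot>\<^bsub>D\<^esub> (h \<cdot>\<^bsub>D\<^esub> \<epsilon> (Dom D h)))" for h
  define \<eta> where "\<eta> c = lift c (Go (Fo c)) (D.inv_of (\<epsilon> (Fo c)))" for c
  have Ga: "Ga h \<in> Arr C" "Dom C (Ga h) = Go (Dom D h)" "Cod C (Ga h) = Go (Cod D h)"
    "Fa (Ga h) = D.inv_of (\<epsilon> (Cod D h)) \<cdot>\<^bsub>D\<^esub> (h \<cdot>\<^bsub>D\<^esub> \<epsilon> (Dom D h))" if "h \<in> Arr D" for h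
    unfolding Ga_def using that Go \<epsilon> \<epsilon>Arr by (auto intro!: lift)
  have \<eta>: "\<eta> c \<in> Arr C" "Dom C (\<eta> c) = c" "Cod C (\<eta> c) = Go (Fo c)" "Fa (\<eta> c) = D.inv_of (\<epsilon> (Fo c))"
    if "c \<in> Obj C" for c
    unfolding \<eta>_def using that Go \<epsilon> Fo by (auto intro!: lift)
  have GF: "is_functor D C Go Ga"
    unfolding is_functor_def
  proof (intro conjI ballI impI)
    show "Go a \<in> Obj C" if "a \<in> Obj D" for a using Go that by simp
    show "Ga f \<in> hom C (Go (Dom D f)) (Go (Cod D f))" if "f \<in> Arr D" for f using Ga that by (simp add: hom_def)
    show "Ga (Idn D a) = Idn C (Go a)" if "a \<in> Obj D" for a
      using that Go[OF that] \<epsilon>[OF that] \<epsilon>Arr[OF that] by (intro faithful) (auto simp: Ga Fa)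
    show "Ga (g \<cdot>\<^bsub>D\<^esub> f) = Ga g \<cdot>\<^bsub>C\<^esub> Ga f" if h: "f \<in> Arr D" "g \<in> Arr D" "Cod D f = Dom D g" for f g
      using h \<epsilon> \<epsilon>Arr by (intro faithful) (auto simp: Ga Fa)
  qed
  \<comment> \<open>A fully faithful functor reflects isomorphisms: the inverse is lifted by
    fullness. This gives the invertibility of \<open>\<eta>\<close>.\<close>
  have fi: "f \<in> isos C" if "f \<in> Arr C" "Fa f \<in> isos D" for f
  proof -
    let ?g = "lift (Cod C f) (Dom C f) (D.inv_of (Fa f))"
    have g: "?g \<in> Arr C" "Dom C ?g = Cod C f" "Cod C ?g = Dom C f" "Fa ?g = D.inv_of (Fa f)"
      using that Fa by (auto intro!: lift)
    show ?thesis using that g by (intro C.isosI[of f ?g] faithful) (auto simp: Fa)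
  qed
  have "is_nat_iso C C id id (Go \<circ> Fo) (Ga \<circ> Fa) \<eta>"
    unfolding is_nat_iso_def is_nat_trans_def
  proof (intro conjI ballI)
    show "\<eta> a \<in> hom C (id a) ((Go \<circ> Fo) a)" if "a \<in> Obj C" for a using \<eta>[OF that] by (simp add: hom_def)
    show "\<eta> a \<in> isos C" if "a \<in> Obj C" for a using \<eta>[OF that] \<epsilon>[OF Fo[OF that]] by (auto intro: fi)
    show "(Ga \<circ> Fa) f \<cdot>\<^bsub>C\<^esub> \<eta> (Dom C f) = \<eta> (Cod C f) \<cdot>\<^bsub>C\<^esub> id f" if "f \<in> Arr C" for f
      using that \<eta> \<epsilon> \<epsilon>Arr Fo by (intro faithful) (auto simp: Ga Fa)
  qed
  moreover have "is_nat_iso D D (Fo \<circ> Go) (Fa \<circ> Ga) id id \<epsilon>"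
    unfolding is_nat_iso_def is_nat_trans_def
    using \<epsilon> \<epsilon>Arr Fo Go by (auto simp: Ga Fa hom_def)
  ultimately show ?thesis
    unfolding equivalent_categories_def using C D F GF by blast
qed

section \<open>Calculus of 2-cells\<close>

context bicategory
begin

lemma HComp1_simps [simp]:
  assumes "f \<in> Obj M" "g \<in> Obj M" "Trg M f = Src M g"
  shows "g \<otimes> f \<in> Obj M" "Src M (g \<otimes> f) = Src M f" "Trg M (g \<otimes> f) = Trg M g"
  using HComp1_in[of f "Src M f" "Trg M f" g "Trg M g"] assms by (auto simp: hom1_def)

lemma Idn1_simps [simp]:
  assumes "U \<in> Obj0 M"
  shows "Idn1 M U \<in> Obj M" "Src M (Idn1 M U) = U" "Trg M (Idn1 M U) = U"
  using Idn1_in[OF assms] by (auto simp: hom1_def)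

lemma Src_Trg_in [simp]: "f \<in> Obj M \<Longrightarrow> Src M f \<in> Obj0 M" "f \<in> Obj M \<Longrightarrow> Trg M f \<in> Obj0 M"
  using Src_in Trg_in by auto

lemma HComp2_simps [simp]:
  assumes "\<alpha> \<in> Arr M" "\<beta> \<in> Arr M" "Trg M (Dom M \<alpha>) = Src M (Dom M \<beta>)"
  shows "\<beta> \<odot> \<alpha> \<in> Arr M" "Dom M (\<beta> \<odot> \<alpha>) = Dom M \<beta> \<otimes> Dom M \<alpha>"
    "Cod M (\<beta> \<odot> \<alpha>) = Cod M \<beta> \<otimes> Cod M \<alpha>"
  using HComp2_in[of "Dom M \<alpha>" "Src M (Dom M \<alpha>)" "Src M (Dom M \<beta>)" "Dom M \<beta>" "Trg M (Dom M \<beta>)"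
      \<alpha> "Cod M \<alpha>" \<beta> "Cod M \<beta>"] assms by (auto simp: hom1_def hom_def)

lemma HComp2_isos [simp]:
  assumes "\<alpha> \<in> isos M" "\<beta> \<in> isos M" "Trg M (Dom M \<alpha>) = Src M (Dom M \<beta>)"
  shows "\<beta> \<odot> \<alpha> \<in> isos M"
  using is_weak_class_isos assms by (auto simp: is_weak_class_def)

lemma Idn_HComp2 [simp]:
  assumes "f \<in> Obj M" "g \<in> Obj M" "Trg M f = Src M g"
  shows "Idn M g \<odot> Idn M f = Idn M (g \<otimes> f)"
  using HComp2_Idn[of f "Src M f" "Trg M f" g "Trg M g"] assms by (auto simp: hom1_def)

lemma HComp2_Comp:
  assumes "\<alpha> \<in> Arr M" "\<alpha>' \<in> Arr M" "\<beta> \<in> Arr M" "\<beta>' \<in> Arr M" "Cod M \<alpha> = Dom M \<alpha>'" "Cod M \<beta> = Dom M \<beta>'"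
    "Trg M (Dom M \<alpha>) = Src M (Dom M \<beta>)"
  shows "(\<beta>' \<odot> \<alpha>') \<cdot> (\<beta> \<odot> \<alpha>) = (\<beta>' \<cdot> \<beta>) \<odot> (\<alpha>' \<cdot> \<alpha>)"
  using interchange[of "Dom M \<alpha>" "Src M (Dom M \<alpha>)" "Src M (Dom M \<beta>)" "Dom M \<beta>" "Trg M (Dom M \<beta>)"
      \<alpha> "Cod M \<alpha>" \<alpha>' "Cod M \<alpha>'" \<beta> "Cod M \<beta>" \<beta>' "Cod M \<beta>'"] assms by (auto simp: hom1_def hom_def)

lemma Src_Trg_Cod:
  "\<alpha> \<in> Arr M \<Longrightarrow> Src M (Cod M \<alpha>) = Src M (Dom M \<alpha>)"
  "\<alpha> \<in> Arr M \<Longrightarrow> Trg M (Cod M \<alpha>) = Trg M (Dom M \<alpha>)"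
  using Src_Dom_Cod Trg_Dom_Cod by auto

text \<open>In right-nested form the two factors to be merged by interchange are usually preceded by
  a further cell \<open>x\<close>, where \<open>HComp2_Comp\<close> alone does not match.\<close>

lemma HComp2_Comp_Comp:
  assumes "\<alpha> \<in> Arr M" "\<alpha>' \<in> Arr M" "\<beta> \<in> Arr M" "\<beta>' \<in> Arr M" "Cod M \<alpha> = Dom M \<alpha>'" "Cod M \<beta> = Dom M \<beta>'"
    "Trg M (Dom M \<alpha>) = Src M (Dom M \<beta>)" "x \<in> Arr M" "Cod M x = Dom M \<beta> \<otimes> Dom M \<alpha>"
  shows "(\<beta>' \<odot> \<alpha>') \<cdot> ((\<beta> \<odot> \<alpha>) \<cdot> x) = ((\<beta>' \<cdot> \<beta>) \<odot> (\<alpha>' \<cdot> \<alpha>)) \<cdot> x"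
proof -
  have "Trg M (Dom M \<alpha>') = Src M (Dom M \<beta>')"
    using assms Src_Trg_Cod[of \<alpha>] Src_Trg_Cod[of \<beta>] by simp
  then show ?thesis
    using assms HComp2_Comp[OF assms(1-7)] Comp_Comp[of x "\<beta> \<odot> \<alpha>" "\<beta>' \<odot> \<alpha>'"] by simp
qed

lemma Assoc_simps [simp]:
  assumes "f \<in> Obj M" "g \<in> Obj M" "h \<in> Obj M" "Trg M f = Src M g" "Trg M g = Src M h"
  shows "Assoc M h g f \<in> Arr M" "Assoc M h g f \<in> isos M" "Dom M (Assoc M h g f) = (h \<otimes> g) \<otimes> f"
    "Cod M (Assoc M h g f) = h \<otimes> (g \<otimes> f)"
  using Assoc_in[of f "Src M f" "Src M g" g "Src M h" h "Trg M h"] assms by (auto simp: hom1_def hom_def)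

lemma Lunit_simps [simp]:
  assumes "f \<in> Obj M"
  shows "Lunit M f \<in> Arr M" "Lunit M f \<in> isos M" "Dom M (Lunit M f) = Idn1 M (Trg M f) \<otimes> f"
    "Cod M (Lunit M f) = f"
  using Lunit_in[of f "Src M f" "Trg M f"] assms by (auto simp: hom1_def hom_def)

lemma Runit_simps [simp]:
  assumes "f \<in> Obj M"
  shows "Runit M f \<in> Arr M" "Runit M f \<in> isos M" "Dom M (Runit M f) = f \<otimes> Idn1 M (Src M f)"
    "Cod M (Runit M f) = f"
  using Runit_in[of f "Src M f" "Trg M f"] assms by (auto simp: hom1_def hom_def)

lemma Lunit_naturality:
  assumes "\<alpha> \<in> Arr M" "Trg M (Dom M \<alpha>) = V"
  shows "Lunit M (Cod M \<alpha>) \<cdot> (Idn M (Idn1 M V) \<odot> \<alpha>) = \<alpha> \<cdot> Lunit M (Dom M \<alpha>)"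
  using Lunit_natural[of "Dom M \<alpha>" "Src M (Dom M \<alpha>)" V \<alpha> "Cod M \<alpha>"] assms
  by (auto simp: hom1_def hom_def)

lemma Runit_naturality:
  assumes "\<alpha> \<in> Arr M" "Src M (Dom M \<alpha>) = U"
  shows "Runit M (Cod M \<alpha>) \<cdot> (\<alpha> \<odot> Idn M (Idn1 M U)) = \<alpha> \<cdot> Runit M (Dom M \<alpha>)"
  using Runit_natural[of "Dom M \<alpha>" U "Trg M (Dom M \<alpha>)" \<alpha> "Cod M \<alpha>"] assms
  by (auto simp: hom1_def hom_def)

lemma Assoc_naturality:
  assumes "\<alpha> \<in> Arr M" "\<beta> \<in> Arr M" "\<gamma> \<in> Arr M" "Trg M (Dom M \<alpha>) = Src M (Dom M \<beta>)"
    "Trg M (Dom M \<beta>) = Src M (Dom M \<gamma>)"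
  shows "Assoc M (Cod M \<gamma>) (Cod M \<beta>) (Cod M \<alpha>) \<cdot> ((\<gamma> \<odot> \<beta>) \<odot> \<alpha>)
    = (\<gamma> \<odot> (\<beta> \<odot> \<alpha>)) \<cdot> Assoc M (Dom M \<gamma>) (Dom M \<beta>) (Dom M \<alpha>)"
  using Assoc_natural[of "Dom M \<alpha>" "Src M (Dom M \<alpha>)" "Src M (Dom M \<beta>)" "Dom M \<beta>" "Src M (Dom M \<gamma>)"
      "Dom M \<gamma>" "Trg M (Dom M \<gamma>)" \<alpha> "Cod M \<alpha>" \<beta> "Cod M \<beta>" \<gamma> "Cod M \<gamma>"] assms
  by (auto simp: hom1_def hom_def)

lemma Pentagon:
  assumes "f \<in> Obj M" "g \<in> Obj M" "h \<in> Obj M" "k \<in> Obj M"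
    "Trg M f = Src M g" "Trg M g = Src M h" "Trg M h = Src M k"
  shows "Assoc M k h (g \<otimes> f) \<cdot> Assoc M (k \<otimes> h) g f
    = (Idn M k \<odot> Assoc M h g f) \<cdot> (Assoc M k (h \<otimes> g) f \<cdot> (Assoc M k h g \<odot> Idn M f))"
  using pentagon[of f "Src M f" "Src M g" g "Src M h" h "Src M k" k "Trg M k"] assms
  by (auto simp: hom1_def)

lemma Triangle:
  assumes "f \<in> Obj M" "g \<in> Obj M" "Trg M f = V" "Src M g = V"
  shows "(Idn M g \<odot> Lunit M f) \<cdot> Assoc M g (Idn1 M V) f = Runit M g \<odot> Idn M f"
  using triangle[of f "Src M f" V g "Trg M g"] assms by (auto simp: hom1_def)

section \<open>Unit coherences that follow from pentagon and triangle\<close>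

lemma Lunit_faithful:
  assumes "Idn M (Idn1 M V) \<odot> \<alpha> = Idn M (Idn1 M V) \<odot> \<beta>" "\<alpha> \<in> Arr M" "\<beta> \<in> Arr M"
    "Dom M \<alpha> = Dom M \<beta>" "Cod M \<alpha> = Cod M \<beta>" "Trg M (Dom M \<alpha>) = V"
  shows "\<alpha> = \<beta>"
  using assms Lunit_naturality[of \<alpha> V] Lunit_naturality[of \<beta> V]
  by (intro isos_cancel_right[of \<alpha> "Lunit M (Dom M \<alpha>)" \<beta>]) auto

lemma Runit_faithful:
  assumes "\<alpha> \<odot> Idn M (Idn1 M U) = \<beta> \<odot> Idn M (Idn1 M U)" "\<alpha> \<in> Arr M" "\<beta> \<in> Arr M"
    "Dom M \<alpha> = Dom M \<beta>" "Cod M \<alpha> = Cod M \<beta>" "Src M (Dom M \<alpha>) = U"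
  shows "\<alpha> = \<beta>"
  using assms Runit_naturality[of \<alpha> U] Runit_naturality[of \<beta> U]
  by (intro isos_cancel_right[of \<alpha> "Runit M (Dom M \<alpha>)" \<beta>]) auto

text \<open>Kelly's argument. By naturality of \<open>Lunit\<close>, tensoring with an identity
  1-cell is faithful, so the equation may be checked after tensoring on the left; there it follows
  from the pentagon for \<open>?I\<close>, \<open>?I\<close>, \<open>g\<close>, \<open>f\<close> and
  two triangles, up to the invertible cell \<open>?p\<close>.\<close>

lemma Lunit_HComp1:
  assumes f: "f \<in> Obj M" "g \<in> Obj M" "Trg M f = Src M g" "Trg M g = W"
  shows "Lunit M (g \<otimes> f) \<cdot> Assoc M (Idn1 M W) g f = Lunit M g \<odot> Idn M f"
proof -
  let ?I = "Idn1 M W"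
  have W: "W \<in> Obj0 M" using f by auto
  let ?p = "Assoc M ?I (?I \<otimes> g) f \<cdot> (Assoc M ?I ?I g \<odot> Idn M f)"
  have "(Idn M ?I \<odot> (Lunit M (g \<otimes> f) \<cdot> Assoc M ?I g f)) \<cdot> ?p
    = (Idn M ?I \<odot> Lunit M (g \<otimes> f)) \<cdot> (Idn M ?I \<odot> Assoc M ?I g f) \<cdot> ?p"
    using f W by (simp add: HComp2_Comp_Comp)
  also have "\<dots> = (Idn M ?I \<odot> Lunit M (g \<otimes> f)) \<cdot> Assoc M ?I ?I (g \<otimes> f) \<cdot> Assoc M (?I \<otimes> ?I) g f"
    using f W by (simp add: Pentagon)
  also have "\<dots> = ((Idn M ?I \<odot> Lunit M (g \<otimes> f)) \<cdot> Assoc M ?I ?I (g \<otimes> f)) \<cdot> Assoc M (?I \<otimes> ?I) g f"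
    using f W by simp
  also have "\<dots> = (Runit M ?I \<odot> (Idn M g \<odot> Idn M f)) \<cdot> Assoc M (?I \<otimes> ?I) g f"
    using f W by (subst Triangle) auto
  also have "\<dots> = Assoc M ?I g f \<cdot> ((Runit M ?I \<odot> Idn M g) \<odot> Idn M f)"
    using f W Assoc_naturality[of "Idn M f" "Idn M g" "Runit M ?I"] by simp
  also have "\<dots> = Assoc M ?I g f \<cdot> (((Idn M ?I \<odot> Lunit M g) \<cdot> Assoc M ?I ?I g) \<odot> Idn M f)"
    using f W by (subst Triangle) auto
  also have "\<dots> = Assoc M ?I g f \<cdot> ((Idn M ?I \<odot> Lunit M g) \<odot> Idn M f) \<cdot> (Assoc M ?I ?I g \<odot> Idn M f)"
    using f W by (simp add: HComp2_Comp)
  also have "\<dots> = (Assoc M ?I g f \<cdot> ((Idn M ?I \<odot> Lunit M g) \<odot> Idn M f)) \<cdot> (Assoc M ?I ?I g \<odot> Idn M f)"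
    using f W by simp
  also have "\<dots> = (Idn M ?I \<odot> (Lunit M g \<odot> Idn M f)) \<cdot> ?p"
    using f W Assoc_naturality[of "Idn M f" "Lunit M g" "Idn M ?I"] by simp
  finally have "Idn M ?I \<odot> (Lunit M (g \<otimes> f) \<cdot> Assoc M ?I g f) = Idn M ?I \<odot> (Lunit M g \<odot> Idn M f)"
    by (rule isos_cancel_right) (use f W in \<open>auto intro!: isos_Comp\<close>)
  then show ?thesis by (rule Lunit_faithful) (use f W in auto)
qed

text \<open>The mirror image: the pentagon for \<open>g\<close>, \<open>f\<close>,
  \<open>?I\<close>, \<open>?I\<close>, with the identity 1-cell tensored on the right and an
  associator cancelled on the left.\<close>

lemma Runit_HComp1:
  assumes f: "f \<in> Obj M" "g \<in> Obj M" "Trg M f = Src M g" "Src M f = U"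
  shows "(Idn M g \<odot> Runit M f) \<cdot> Assoc M g f (Idn1 M U) = Runit M (g \<otimes> f)"
proof -
  let ?I = "Idn1 M U"
  have U: "U \<in> Obj0 M" using f by auto
  have "Assoc M g f ?I \<cdot> (((Idn M g \<odot> Runit M f) \<cdot> Assoc M g f ?I) \<odot> Idn M ?I)
    = Assoc M g f ?I \<cdot> ((Idn M g \<odot> Runit M f) \<odot> Idn M ?I) \<cdot> (Assoc M g f ?I \<odot> Idn M ?I)"
    using f U by (simp add: HComp2_Comp)
  also have "\<dots> = (Assoc M g f ?I \<cdot> ((Idn M g \<odot> Runit M f) \<odot> Idn M ?I)) \<cdot> (Assoc M g f ?I \<odot> Idn M ?I)"
    using f U by simp
  also have "\<dots> = (Idn M g \<odot> (Runit M f \<odot> Idn M ?I)) \<cdot> Assoc M g (f \<otimes> ?I) ?I \<cdot> (Assoc M g f ?I \<odot> Idn M ?I)"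
    using f U Assoc_naturality[of "Idn M ?I" "Runit M f" "Idn M g"] by simp
  also have "\<dots> = (Idn M g \<odot> ((Idn M f \<odot> Lunit M ?I) \<cdot> Assoc M f ?I ?I)) \<cdot> Assoc M g (f \<otimes> ?I) ?I
      \<cdot> (Assoc M g f ?I \<odot> Idn M ?I)"
    using f U by (subst Triangle) auto
  also have "\<dots> = (Idn M g \<odot> (Idn M f \<odot> Lunit M ?I)) \<cdot> (Idn M g \<odot> Assoc M f ?I ?I) \<cdot> Assoc M g (f \<otimes> ?I) ?I
      \<cdot> (Assoc M g f ?I \<odot> Idn M ?I)"
    using f U by (simp add: HComp2_Comp_Comp)
  also have "\<dots> = (Idn M g \<odot> (Idn M f \<odot> Lunit M ?I)) \<cdot> Assoc M g f (?I \<otimes> ?I) \<cdot> Assoc M (g \<otimes> f) ?I ?I"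
    using f U by (simp add: Pentagon)
  also have "\<dots> = ((Idn M g \<odot> (Idn M f \<odot> Lunit M ?I)) \<cdot> Assoc M g f (?I \<otimes> ?I)) \<cdot> Assoc M (g \<otimes> f) ?I ?I"
    using f U by simp
  also have "\<dots> = (Assoc M g f ?I \<cdot> (Idn M (g \<otimes> f) \<odot> Lunit M ?I)) \<cdot> Assoc M (g \<otimes> f) ?I ?I"
    using f U Assoc_naturality[of "Lunit M ?I" "Idn M f" "Idn M g"] by simp
  also have "\<dots> = Assoc M g f ?I \<cdot> (Runit M (g \<otimes> f) \<odot> Idn M ?I)"
    using f U Triangle[of ?I "g \<otimes> f" U] by simp
  finally have "((Idn M g \<odot> Runit M f) \<cdot> Assoc M g f ?I) \<odot> Idn M ?I = Runit M (g \<otimes> f) \<odot> Idn M ?I"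
    by (rule isos_cancel_left) (use f U in auto)
  then show ?thesis by (rule Runit_faithful) (use f U in auto)
qed

text \<open>Naturality of \<open>Lunit\<close> at itself gives
  \<open>Idn M ?I \<odot> Lunit M ?I = Lunit M (?I \<otimes> ?I)\<close>. The triangle and
  \<open>Lunit_HComp1\<close> then have the same left side, so their right sides agree.\<close>

lemma Lunit_Idn1:
  assumes U: "U \<in> Obj0 M"
  shows "Lunit M (Idn1 M U) = Runit M (Idn1 M U)"
proof -
  let ?I = "Idn1 M U"
  have "Lunit M ?I \<cdot> (Idn M ?I \<odot> Lunit M ?I) = Lunit M ?I \<cdot> Lunit M (?I \<otimes> ?I)"
    using U Lunit_naturality[of "Lunit M ?I" U] by simp
  then have "Idn M ?I \<odot> Lunit M ?I = Lunit M (?I \<otimes> ?I)"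
    by (rule isos_cancel_left) (use U in auto)
  then have "Lunit M ?I \<odot> Idn M ?I = Runit M ?I \<odot> Idn M ?I"
    using Lunit_HComp1[of ?I ?I U] Triangle[of ?I ?I U] U by simp
  then show ?thesis by (rule Runit_faithful) (use U in auto)
qed

end

section \<open>Paths in the coarse category\<close>

lemma nths_cong_index:
  assumes "\<And>i. i < length xs \<Longrightarrow> i \<in> I \<longleftrightarrow> i \<in> J"
  shows "nths xs I = nths xs J"
  unfolding nths_def
  by (rule arg_cong[where f = "map fst"], rule filter_cong) (auto simp: assms dest!: set_zip_rightD)

lemma coarse_simps [simp]:
  "Obj (coarse X) = X" "Arr (coarse X) = X \<times> X" "Dom (coarse X) = fst" "Cod (coarse X) = snd"
  "Idn (coarse X) A = (A, A)" "Comp (coarse X) g f = (fst f, snd g)"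
  by (simp_all add: coarse_def)

abbreviation chain :: "'x set \<Rightarrow> 'x \<Rightarrow> ('x \<times> 'x) list \<Rightarrow> 'x \<Rightarrow> bool" where
  "chain X \<equiv> is_chain (coarse X)"

lemma chain_Nil [simp]: "chain X A [] B \<longleftrightarrow> A \<in> X \<and> A = B"
  by simp

lemma chain_Cons [simp]:
  "chain X A (f # fs) B \<longleftrightarrow> fst f \<in> X \<and> snd f \<in> X \<and> fst f = A \<and> chain X (snd f) fs B"
  by (cases f) auto

declare is_chain.simps [simp del]

lemma chain_in: "chain X A fs B \<Longrightarrow> A \<in> X \<and> B \<in> X"
  by (induction fs arbitrary: A) auto

lemma chain_append: "chain X A (fs @ gs) B \<longleftrightarrow> (\<exists>C. chain X A fs C \<and> chain X C gs B)"
  by (induction fs arbitrary: A) (auto dest: chain_in)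

text \<open>This is what reduces the composite condition on 2-cells to a condition on the endpoints
  of blocks.\<close>

lemma composite_coarse: "chain X A fs B \<Longrightarrow> composite (coarse X) A fs = (A, B)"
  by (induction fs arbitrary: A) auto

text \<open>\<open>cut X B A fs u gs\<close> presents the nondecreasing map \<open>u\<close> by its fibres: \<open>fs\<close> is cut into
  consecutive blocks, one above each arrow of \<open>gs\<close>.\<close>

inductive cut :: "'x set \<Rightarrow> 'x \<Rightarrow> 'x \<Rightarrow> ('x \<times> 'x) list \<Rightarrow> nat list \<Rightarrow> ('x \<times> 'x) list \<Rightarrow> bool"
  for X B where
  Nil: "B \<in> X \<Longrightarrow> cut X B B [] [] []"
| Cons: "chain X A fs A' \<Longrightarrow> cut X B A' fs' u gs
    \<Longrightarrow> cut X B A (fs @ fs') (replicate (length fs) 0 @ map Suc u) ((A, A') # gs)"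

lemma cut_chain: "cut X B A fs u gs \<Longrightarrow> chain X A fs B \<and> chain X A gs B"
  by (induction rule: cut.induct) (auto simp: chain_append dest: chain_in)

lemma cut_length: "cut X B A fs u gs \<Longrightarrow> length u = length fs \<and> set u \<subseteq> {..<length gs}"
  by (induction rule: cut.induct) auto

lemma cut_sorted: "cut X B A fs u gs \<Longrightarrow> sorted u"
  by (induction rule: cut.induct) (auto simp: sorted_append sorted_map intro: sorted_wrt_mono_rel)

text \<open>Prepending a block shifts the other fibres by one, so the fibre condition of
  \<open>path_cells\<close> can be checked block by block.\<close>

lemma nths_block:
  assumes "length u = length fs'"
  shows "nths (fs @ fs') {i. (replicate (length fs) 0 @ map Suc u) ! i = 0} = fs"
    and "nths (fs @ fs') {i. (replicate (length fs) 0 @ map Suc u) ! i = Suc j} = nths fs' {i. u ! i = j}"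
proof -
  let ?v = "replicate (length fs) 0 @ map Suc u"
  have "nths fs {i. ?v ! i = 0} = nths fs UNIV" "nths fs {i. ?v ! i = Suc j} = nths fs {}"
    by (rule nths_cong_index; simp add: nth_append)+
  moreover have "nths fs' {i. i + length fs \<in> {i. ?v ! i = 0}} = nths fs' {}"
    "nths fs' {i. i + length fs \<in> {i. ?v ! i = Suc j}} = nths fs' {i. u ! i = j}"
    by (rule nths_cong_index; use assms in \<open>simp add: nth_append\<close>)+
  ultimately show "nths (fs @ fs') {i. ?v ! i = 0} = fs"
    "nths (fs @ fs') {i. ?v ! i = Suc j} = nths fs' {i. u ! i = j}"
    unfolding nths_append by (simp_all add: nths_all)
qed

lemma cut_composite:
  "cut X B A fs u gs \<Longrightarrow> j < length gs
    \<Longrightarrow> gs ! j = composite (coarse X) (fst (gs ! j)) (nths fs {i. u ! i = j})"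
proof (induction arbitrary: j rule: cut.induct)
  case (Cons A fs A' fs' u gs)
  have "length u = length fs'" using cut_length[OF Cons(2)] by simp
  note b = nths_block[OF this]
  show ?case
    using Cons by (cases j) (auto simp: b composite_coarse)
qed simp

lemma sorted_zeros:
  "sorted u \<Longrightarrow> \<exists>n u'. u = replicate n (0::nat) @ map Suc u'"
proof (induction u)
  case (Cons a u)
  then obtain n u' where u: "u = replicate n 0 @ map Suc u'" by auto
  show ?case
  proof (cases a)
    case 0
    then have "a # u = replicate (Suc n) 0 @ map Suc u'" using u by simp
    then show ?thesis by blast
  next
    case (Suc b)
    then have "n = 0" using Cons.prems u by (cases n) auto
    then have "a # u = replicate 0 0 @ map Suc (b # u')" using u Suc by simp
    then show ?thesis by blast
  qed
next
  case Nil
  have "[] = replicate 0 (0::nat) @ map Suc []" by simp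
  then show ?case by blast
qed

text \<open>Induction on the target path: the leading zeros of \<open>u\<close> delimit the block
  over its first arrow, and what remains, lowered by one, is again such a map.\<close>

lemma cutI:
  assumes "chain X A fs B" "chain X A gs B" "length u = length fs" "sorted u" "set u \<subseteq> {..<length gs}"
    "\<And>j. j < length gs \<Longrightarrow> gs ! j = composite (coarse X) (fst (gs ! j)) (nths fs {i. u ! i = j})"
  shows "cut X B A fs u gs"
  using assms
proof (induction gs arbitrary: A fs u)
  case Nil
  then show ?case by (auto intro: cut.Nil)
next
  case (Cons g gs)
  obtain n u' where u: "u = replicate n 0 @ map Suc u'" using sorted_zeros[OF Cons.prems(4)] by blast
  define s0 fs' where "s0 = take n fs" and "fs' = drop n fs"
  have fs: "fs = s0 @ fs'" "length s0 = n" "length u' = length fs'"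
    using Cons.prems(3) u by (auto simp: s0_def fs'_def)
  have u: "u = replicate (length s0) 0 @ map Suc u'" using u fs by simp
  obtain C where C: "chain X A s0 C" "chain X C fs' B" using Cons.prems(1) fs by (auto simp: chain_append)
  note b = nths_block[OF fs(3)]
  \<comment> \<open>The fibre condition at index 0 forces the first target arrow to join the
    endpoints of the first block.\<close>
  have "g = composite (coarse X) A s0"
    using Cons.prems(2) Cons.prems(6)[of 0] unfolding fs(1) u by (simp add: b)
  then have g: "g = (A, C)" using composite_coarse[OF C(1)] by simp
  have "cut X B C fs' u' gs"
  proof (rule Cons.IH)
    show "chain X C gs B" using Cons.prems(2) g by simp
    show "sorted u'" using Cons.prems(4) u by (simp add: sorted_append sorted_map)
    show "set u' \<subseteq> {..<length gs}" using Cons.prems(5) u by auto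
    show "gs ! j = composite (coarse X) (fst (gs ! j)) (nths fs' {i. u' ! i = j})" if "j < length gs" for j
      using Cons.prems(6)[of "Suc j"] that unfolding fs(1) u by (simp add: b)
  qed (use C fs in auto)
  then show ?case unfolding fs(1) u g by (rule cut.Cons[OF C(1)])
qed

text \<open>Turns the explicit description of 2-cells in \<open>path_cells\<close> into an induction
  principle.\<close>

lemma cut_iff:
  "cut X B A fs u gs \<longleftrightarrow> chain X A fs B \<and> chain X A gs B \<and> length u = length fs \<and> sorted u \<and>
    set u \<subseteq> {..<length gs} \<and>
    (\<forall>j < length gs. gs ! j = composite (coarse X) (fst (gs ! j)) (nths fs {i. u ! i = j}))"
    (is "_ \<longleftrightarrow> ?r")
proof
  assume c: "cut X B A fs u gs"
  show ?r
    using cut_chain[OF c] cut_length[OF c] cut_sorted[OF c] cut_composite[OF c] by blast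
next
  assume ?r
  then show "cut X B A fs u gs" by (intro cutI) blast+
qed

lemma Arr_path_bicat:
  "Arr (path_bicat (coarse X)) = {((A, fs, B), u, (A, gs, B)) | A fs B u gs. cut X B A fs u gs}"
  by (auto simp: path_bicat_def path_cells_def paths_def cut_iff)

lemma Obj_path_bicat:
  "Obj (path_bicat (coarse X)) = {(A, fs, B) | A fs B. chain X A fs B}"
  by (auto simp: path_bicat_def paths_def)

lemma path_bicat_simps:
  "Dom (path_bicat C) = fst" "Cod (path_bicat C) = snd \<circ> snd" "Src (path_bicat C) = fst"
  "Trg (path_bicat C) = snd \<circ> snd" "Obj0 (path_bicat C) = Obj C" "Idn1 (path_bicat C) = (\<lambda>A. (A, [], A))"
  "Idn (path_bicat C) = path_id" "Comp (path_bicat C) = path_vcomp" "HComp1 (path_bicat C) = path_append"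
  "HComp2 (path_bicat C) = path_hcomp"
  "Assoc (path_bicat C) = (\<lambda>r t s. path_id (path_append (path_append r t) s))"
  "Lunit (path_bicat C) = path_id" "Runit (path_bicat C) = path_id"
  by (simp_all add: path_bicat_def)

lemma hom1_path_bicat:
  "s \<in> hom1 (path_bicat (coarse X)) A B \<longleftrightarrow> (\<exists>fs. s = (A, fs, B) \<and> chain X A fs B)"
  by (auto simp: hom1_def path_bicat_simps Obj_path_bicat)

lemma hom_path_bicat:
  "\<alpha> \<in> hom (path_bicat (coarse X)) s t \<longleftrightarrow>
    (\<exists>A fs B u gs. \<alpha> = (s, u, t) \<and> s = (A, fs, B) \<and> t = (A, gs, B) \<and> cut X B A fs u gs)"
  by (auto simp: hom_def path_bicat_simps Arr_path_bicat)

lemma cut_refl: "chain X A fs B \<Longrightarrow> cut X B A fs [0..<length fs] fs"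
proof (induction fs arbitrary: A)
  case Nil
  then show ?case by (auto intro: cut.Nil)
next
  case (Cons f fs)
  then have "chain X A [f] (snd f)" by (auto dest: chain_in)
  from cut.Cons[OF this Cons.IH] show ?case
    using Cons.prems by (cases f) (simp add: map_Suc_upt upt_conv_Cons del: upt_Suc)
qed

section \<open>Ordinal sums, decompositions and composites of block maps\<close>

lemma map_plus_0 [simp]: "map ((+) (0::nat)) u = u"
  by (simp add: map_idI)

lemma cut_append:
  "cut X B A fs u gs \<Longrightarrow> cut X C B fs' u' gs'
    \<Longrightarrow> cut X C A (fs @ fs') (u @ map (\<lambda>j. length gs + j) u') (gs @ gs')"
proof (induction rule: cut.induct)
  case (Cons A fs A' fs0 u gs)
  from cut.Cons[OF Cons(1) Cons.IH[OF Cons.prems]] show ?case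
    by (simp add: comp_def)
qed simp

text \<open>Converse of \<open>cut_append\<close>: a map into a concatenation is an ordinal sum,
  since blocks over the first part precede those over the second. It lets composites be treated
  block by block.\<close>

lemma cut_split:
  "cut X C A fs u (gs @ gs') \<Longrightarrow> chain X A gs B \<Longrightarrow>
    \<exists>fs1 fs2 u1 u2. fs = fs1 @ fs2 \<and> u = u1 @ map (\<lambda>j. length gs + j) u2 \<and>
      cut X B A fs1 u1 gs \<and> cut X C B fs2 u2 gs'"
proof (induction gs arbitrary: A fs u)
  case Nil
  then have "fs = [] @ fs \<and> u = [] @ map (\<lambda>j. length [] + j) u \<and> cut X B A [] [] [] \<and> cut X C B fs u gs'"
    by (auto intro: cut.Nil)
  then show ?case by blast
next
  case (Cons g gs)
  from Cons.prems(1) obtain fs0 A' fs' u' where g: "g = (A, A')" "chain X A fs0 A'" "cut X C A' fs' u' (gs @ gs')"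
    "fs = fs0 @ fs'" "u = replicate (length fs0) 0 @ map Suc u'"
    by (auto elim: cut.cases)
  from Cons.IH[OF g(3)] Cons.prems(2) g obtain fs1 fs2 u1 u2 where
    h: "fs' = fs1 @ fs2" "u' = u1 @ map (\<lambda>j. length gs + j) u2" "cut X B A' fs1 u1 gs" "cut X C B fs2 u2 gs'"
    by auto
  have "u = (replicate (length fs0) 0 @ map Suc u1) @ map (\<lambda>j. length (g # gs) + j) u2"
    using g h by simp
  moreover have "cut X B A (fs0 @ fs1) (replicate (length fs0) 0 @ map Suc u1) (g # gs)"
    unfolding g(1) by (rule cut.Cons) (use g h in auto)
  moreover have "fs = (fs0 @ fs1) @ fs2" using g h by simp
  ultimately show ?case using h by blast
qed

lemma vcomp_block:
  assumes "set u1 \<subseteq> {..<n}" "set u2 \<subseteq> {..<length v}"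
  shows "map ((!) (replicate n 0 @ map Suc v)) (u1 @ map (\<lambda>j. n + j) u2)
    = replicate (length u1) 0 @ map Suc (map ((!) v) u2)"
  using assms by (auto simp: nth_append comp_def map_replicate_const[symmetric] subset_iff)

lemma cut_comp:
  "cut X B A gs v hs \<Longrightarrow> cut X B A fs u gs \<Longrightarrow> cut X B A fs (map ((!) v) u) hs"
proof (induction arbitrary: fs u rule: cut.induct)
  case Nil
  then show ?case using cut_length[OF Nil(2)] by auto
next
  case (Cons A gs A' gs' v hs)
  from cut_split[OF Cons.prems Cons.hyps(1)] obtain fs1 fs2 u1 u2 where
    h: "fs = fs1 @ fs2" "u = u1 @ map (\<lambda>j. length gs + j) u2" "cut X A' A fs1 u1 gs" "cut X B A' fs2 u2 gs'"
    by blast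
  have "map ((!) (replicate (length gs) 0 @ map Suc v)) u = replicate (length u1) 0 @ map Suc (map ((!) v) u2)"
    unfolding h using cut_length[OF h(3)] cut_length[OF h(4)] cut_length[OF Cons.hyps(2)]
    by (intro vcomp_block) auto
  then show ?case
    using cut.Cons[OF conjunct1[OF cut_chain[OF h(3)]] Cons.IH[OF h(4)]] h(1) cut_length[OF h(3)]
    by (simp del: map_map)
qed

lemma cut_collapse: "chain X A fs B \<Longrightarrow> cut X B A fs (replicate (length fs) 0) [(A, B)]"
  using cut.Cons[OF _ cut.Nil, of X A fs B] by (auto dest: chain_in)

lemma path_append_simp [simp]: "path_append (B, gs, C) (A, fs, B') = (A, fs @ gs, C)"
  by (simp add: path_append_def)

lemma path_id_simp [simp]: "path_id (A, fs, B) = ((A, fs, B), [0..<length fs], (A, fs, B))"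
  by (simp add: path_id_def)

lemma path_vcomp_simp [simp]: "path_vcomp (t, v, r) (s, u, t') = (s, map ((!) v) u, r)"
  by (simp add: path_vcomp_def)

lemma path_hcomp_simp [simp]:
  "path_hcomp ((B, gs, C), v, (B', gs', C')) ((A, fs, B0), u, (A', fs', B1)) =
    ((A, fs @ gs, C), u @ map (\<lambda>j. length fs' + j) v, (A', fs' @ gs', C'))"
  by (simp add: path_hcomp_def)

section \<open>The point of an enriched category\<close>

locale enriched_over = bicategory M + enriched_category M \<A>
  for M :: "('o, 'a, 'c, 'z) bicat_scheme" (structure)
    and \<A> :: "('x, 'o, 'a, 'c) enriched" +
  fixes X :: "'x set"
  assumes EObj: "EObj M \<A> = X"
begin

text \<open>Reads off the base object from the fibres \<open>Over\<close>; the choice is unique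
  because these are disjoint.\<close>

definition ob :: "'x \<Rightarrow> 'o" where
  "ob A = (SOME U. U \<in> Obj0 M \<and> A \<in> Over \<A> U)"

lemma ob:
  assumes "A \<in> X"
  shows "ob A \<in> Obj0 M" "A \<in> Over \<A> (ob A)"
proof -
  have "\<exists>U. U \<in> Obj0 M \<and> A \<in> Over \<A> U" using assms EObj by (auto simp: EObj_def)
  from someI_ex[OF this, folded ob_def]
  show "ob A \<in> Obj0 M" "A \<in> Over \<A> (ob A)" by auto
qed

lemma ob_eq: "U \<in> Obj0 M \<Longrightarrow> A \<in> Over \<A> U \<Longrightarrow> ob A = U"
  using Over_disjoint ob[of A] EObj by (fastforce simp: EObj_def disjoint_family_on_def)

lemma enr_simps [simp]:
  "A \<in> X \<Longrightarrow> ob A \<in> Obj0 M"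
  "A \<in> X \<Longrightarrow> B \<in> X \<Longrightarrow> EHom \<A> (A, B) \<in> Obj M"
  "A \<in> X \<Longrightarrow> B \<in> X \<Longrightarrow> Src M (EHom \<A> (A, B)) = ob A"
  "A \<in> X \<Longrightarrow> B \<in> X \<Longrightarrow> Trg M (EHom \<A> (A, B)) = ob B"
  "A \<in> X \<Longrightarrow> EId \<A> A \<in> Arr M"
  "A \<in> X \<Longrightarrow> Dom M (EId \<A> A) = Idn1 M (ob A)"
  "A \<in> X \<Longrightarrow> Cod M (EId \<A> A) = EHom \<A> (A, A)"
  "A \<in> X \<Longrightarrow> B \<in> X \<Longrightarrow> C \<in> X \<Longrightarrow> EComp \<A> (A, B, C) \<in> Arr M"
  "A \<in> X \<Longrightarrow> B \<in> X \<Longrightarrow> C \<in> X \<Longrightarrow> Dom M (EComp \<A> (A, B, C)) = EHom \<A> (B, C) \<otimes> EHom \<A> (A, B)"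
  "A \<in> X \<Longrightarrow> B \<in> X \<Longrightarrow> C \<in> X \<Longrightarrow> Cod M (EComp \<A> (A, B, C)) = EHom \<A> (A, C)"
  using ob EHom_in[of "ob A" "ob B" A B] EId_in[of "ob A" A] EComp_in[of A B C] EObj
  by (auto simp: hom1_def hom_def)

lemmas enr_axioms = EId_left[unfolded EObj] EId_right[unfolded EObj] EComp_assoc[unfolded EObj]

text \<open>The first arrow of the path is the rightmost factor, as required by the order of
  \<open>\<otimes>\<close>, and brackets accumulate on the left. The end \<open>B\<close> is an
  argument because the empty list does not determine it.\<close>

primrec tens :: "'x \<Rightarrow> ('x \<times> 'x) list \<Rightarrow> 'a" where
  "tens B [] = Idn1 M (ob B)"
| "tens B (f # fs) = tens B fs \<otimes> EHom \<A> f"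

text \<open>The iterated composition of the enriched category, started with its unit; it takes
  values in the bare \<open>EHom\<close>, without the identity factor that \<open>tens\<close>
  has.\<close>

primrec collapse :: "'x \<Rightarrow> ('x \<times> 'x) list \<Rightarrow> 'c" where
  "collapse B [] = EId \<A> B"
| "collapse B (f # fs) = EComp \<A> (fst f, snd f, B) \<cdot> (collapse B fs \<odot> Idn M (EHom \<A> f))"

text \<open>The future comparison cell, a rebracketing. For an empty first path the second factor is
  an identity 1-cell, which the inverse right unit constraint inserts.\<close>

primrec tens_split :: "'x \<Rightarrow> ('x \<times> 'x) list \<Rightarrow> 'x \<Rightarrow> ('x \<times> 'x) list \<Rightarrow> 'c" where
  "tens_split C gs B [] = inv_of (Runit M (tens C gs))"
| "tens_split C gs B (f # fs) = Assoc M (tens C gs) (tens B fs) (EHom \<A> f) \<cdot> (tens_split C gs B fs \<odot> Idn M (EHom \<A> f))"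

text \<open>The \<open>n\<close> leading zeros of \<open>u\<close> mark the block over
  \<open>g\<close>: it is split off and collapsed, and the remaining values are lowered by one for
  the recursive call.\<close>

primrec tens_map :: "'x \<Rightarrow> ('x \<times> 'x) list \<Rightarrow> nat list \<Rightarrow> ('x \<times> 'x) list \<Rightarrow> 'c" where
  "tens_map B fs u [] = Idn M (tens B fs)"
| "tens_map B fs u (g # gs) = (let n = length (takeWhile (\<lambda>i. i = 0) u) in
    (tens_map B (drop n fs) (map (\<lambda>i. i - 1) (drop n u)) gs \<odot> collapse (snd g) (take n fs)) \<cdot>
      tens_split B (drop n fs) (snd g) (take n fs))"

text \<open>A shifted list has no zeros, so the leading zeros of a map in block form are exactly its
  first block. From here on this replaces the recursion equation with
  \<open>takeWhile\<close>.\<close>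

lemma tens_map_Cons:
  "tens_map B (fs @ fs') (replicate (length fs) 0 @ map Suc u) ((A, A') # gs) =
    (tens_map B fs' u gs \<odot> collapse A' fs) \<cdot> tens_split B fs' A' fs"
proof -
  have "takeWhile (\<lambda>i. i = 0) (map Suc u) = []" by (cases u) auto
  then have "length (takeWhile (\<lambda>i. i = 0) (replicate (length fs) 0 @ map Suc u)) = length fs"
    by (simp add: takeWhile_append)
  then show ?thesis by (simp add: comp_def del: takeWhile_eq_Nil_iff)
qed

declare tens_map.simps(2) [simp del]

lemma tens_simps:
  assumes "chain X A fs B"
  shows "tens B fs \<in> Obj M" "Src M (tens B fs) = ob A" "Trg M (tens B fs) = ob B" "A \<in> X" "B \<in> X"
proof -
  have "tens B fs \<in> Obj M \<and> Src M (tens B fs) = ob A \<and> Trg M (tens B fs) = ob B"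
    using assms by (induction fs arbitrary: A) auto
  then show "tens B fs \<in> Obj M" "Src M (tens B fs) = ob A" "Trg M (tens B fs) = ob B" "A \<in> X" "B \<in> X"
    using chain_in[OF assms] by auto
qed

lemma collapse_simps:
  assumes "chain X A fs B"
  shows "collapse B fs \<in> Arr M" "Dom M (collapse B fs) = tens B fs" "Cod M (collapse B fs) = EHom \<A> (A, B)"
proof -
  have "collapse B fs \<in> Arr M \<and> Dom M (collapse B fs) = tens B fs \<and> Cod M (collapse B fs) = EHom \<A> (A, B)"
    using assms
  proof (induction fs arbitrary: A)
    case (Cons f fs)
    obtain A' where f: "f = (A, A')" "chain X A' fs B" "A \<in> X" "A' \<in> X" using Cons.prems by (cases f) auto
    show ?case using Cons.IH[OF f(2)] f tens_simps[OF f(2)] by simp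
  qed auto
  then show "collapse B fs \<in> Arr M" "Dom M (collapse B fs) = tens B fs" "Cod M (collapse B fs) = EHom \<A> (A, B)"
    by auto
qed

lemma tens_split_simps:
  assumes "chain X A fs B" "chain X B gs C"
  shows "tens_split C gs B fs \<in> Arr M" "tens_split C gs B fs \<in> isos M" "Dom M (tens_split C gs B fs) = tens C (fs @ gs)"
    "Cod M (tens_split C gs B fs) = tens C gs \<otimes> tens B fs"
proof -
  have "tens_split C gs B fs \<in> isos M \<and> Dom M (tens_split C gs B fs) = tens C (fs @ gs) \<and>
    Cod M (tens_split C gs B fs) = tens C gs \<otimes> tens B fs"
    using assms(1)
  proof (induction fs arbitrary: A)
    case (Cons f fs)
    obtain A' where f: "f = (A, A')" "chain X A' fs B" "A \<in> X" "A' \<in> X" using Cons.prems by (cases f) auto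
    have fg: "chain X A' (fs @ gs) C" using f assms by (auto simp: chain_append)
    show ?case using Cons.IH[OF f(2)] f tens_simps[OF f(2)] tens_simps[OF assms(2)] tens_simps[OF fg]
      by (auto simp: isos_Arr intro!: isos_Comp)
  next
    case Nil
    then show ?case using tens_simps[OF assms(2)] by auto
  qed
  then show "tens_split C gs B fs \<in> Arr M" "tens_split C gs B fs \<in> isos M" "Dom M (tens_split C gs B fs) = tens C (fs @ gs)"
    "Cod M (tens_split C gs B fs) = tens C gs \<otimes> tens B fs"
    using isos_Arr by auto
qed

lemma tens_map_simps:
  assumes "cut X B A fs u gs"
  shows "tens_map B fs u gs \<in> Arr M" "Dom M (tens_map B fs u gs) = tens B fs" "Cod M (tens_map B fs u gs) = tens B gs"
proof -
  have "tens_map B fs u gs \<in> Arr M \<and> Dom M (tens_map B fs u gs) = tens B fs \<and> Cod M (tens_map B fs u gs) = tens B gs"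
    using assms
  proof (induction rule: cut.induct)
    case (Cons A fs A' fs' u gs)
    have c: "chain X A' fs' B" "chain X A' gs B" using cut_chain[OF Cons(2)] by auto
    show ?case
      using Cons.IH tens_simps[OF c(1)] tens_simps[OF c(2)] tens_simps[OF Cons(1)] collapse_simps[OF Cons(1)]
        tens_split_simps[OF Cons(1) c(1)]
      by (simp add: tens_map_Cons)
  qed auto
  then show "tens_map B fs u gs \<in> Arr M" "Dom M (tens_map B fs u gs) = tens B fs" "Cod M (tens_map B fs u gs) = tens B gs"
    by auto
qed

text \<open>General associativity of enriched composition. The base case is the right identity
  axiom, the step one instance of the associativity axiom and naturality of
  \<open>Assoc\<close>.\<close>

lemma collapse_append:
  assumes "chain X A fs B" "chain X B gs C"
  shows "collapse C (fs @ gs) = EComp \<A> (A, B, C) \<cdot> ((collapse C gs \<odot> collapse B fs) \<cdot> tens_split C gs B fs)"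
  using assms(1)
proof (induction fs arbitrary: A)
  case Nil
  then have [simp]: "A = B" by simp
  note [simp] = tens_simps[OF assms(2)] collapse_simps[OF assms(2)]
  let ?t = "collapse C gs" and ?r = "inv_of (Runit M (tens C gs))"
  have "EComp \<A> (B, B, C) \<cdot> ((?t \<odot> EId \<A> B) \<cdot> ?r)
    = EComp \<A> (B, B, C) \<cdot> ((Idn M (EHom \<A> (B, C)) \<odot> EId \<A> B) \<cdot> ((?t \<odot> Idn M (Idn1 M (ob B))) \<cdot> ?r))"
    by (simp add: HComp2_Comp_Comp)
  also have "\<dots> = (EComp \<A> (B, B, C) \<cdot> (Idn M (EHom \<A> (B, C)) \<odot> EId \<A> B)) \<cdot> ((?t \<odot> Idn M (Idn1 M (ob B))) \<cdot> ?r)"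
    by simp
  also have "\<dots> = (Runit M (EHom \<A> (B, C)) \<cdot> (?t \<odot> Idn M (Idn1 M (ob B)))) \<cdot> ?r"
    by (simp add: enr_axioms)
  also have "\<dots> = (?t \<cdot> Runit M (tens C gs)) \<cdot> ?r"
    using Runit_naturality[of ?t "ob B"] by simp
  also have "\<dots> = ?t" by simp
  finally show ?case by simp
next
  case (Cons f fs)
  obtain A' where f: "f = (A, A')" "chain X A' fs B" "A \<in> X" "A' \<in> X" using Cons.prems by (cases f) auto
  have fg: "chain X A' (fs @ gs) C" using f assms by (auto simp: chain_append)
  note [simp] = f(3,4) tens_simps[OF assms(2)] collapse_simps[OF assms(2)] tens_simps[OF f(2)]
    collapse_simps[OF f(2)] tens_simps[OF fg] collapse_simps[OF fg] tens_split_simps[OF f(2) assms(2)]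
  let ?t = "collapse C gs" and ?s = "collapse B fs" and ?\<sigma> = "tens_split C gs B fs"
    and ?T = "tens C gs" and ?S = "tens B fs" and ?a = "EHom \<A> (A, A')"
  have "collapse C ((f # fs) @ gs) = EComp \<A> (A, A', C) \<cdot>
      ((EComp \<A> (A', B, C) \<cdot> ((?t \<odot> ?s) \<cdot> ?\<sigma>)) \<odot> Idn M ?a)"
    using Cons.IH[OF f(2)] f by simp
  also have "\<dots> = (EComp \<A> (A, A', C) \<cdot> (EComp \<A> (A', B, C) \<odot> Idn M ?a)) \<cdot>
      (((?t \<odot> ?s) \<odot> Idn M ?a) \<cdot> (?\<sigma> \<odot> Idn M ?a))"
    by (simp add: HComp2_Comp HComp2_Comp_Comp)
  also have "\<dots> = (EComp \<A> (A, B, C) \<cdot> ((Idn M (EHom \<A> (B, C)) \<odot> EComp \<A> (A, A', B)) \<cdot>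
      Assoc M (EHom \<A> (B, C)) (EHom \<A> (A', B)) ?a)) \<cdot> (((?t \<odot> ?s) \<odot> Idn M ?a) \<cdot> (?\<sigma> \<odot> Idn M ?a))"
    by (subst enr_axioms) simp_all
  also have "\<dots> = EComp \<A> (A, B, C) \<cdot> ((Idn M (EHom \<A> (B, C)) \<odot> EComp \<A> (A, A', B)) \<cdot>
      ((Assoc M (EHom \<A> (B, C)) (EHom \<A> (A', B)) ?a \<cdot> ((?t \<odot> ?s) \<odot> Idn M ?a)) \<cdot> (?\<sigma> \<odot> Idn M ?a)))"
    by simp
  also have "\<dots> = EComp \<A> (A, B, C) \<cdot> ((Idn M (EHom \<A> (B, C)) \<odot> EComp \<A> (A, A', B)) \<cdot>
      (((?t \<odot> (?s \<odot> Idn M ?a)) \<cdot> Assoc M ?T ?S ?a) \<cdot> (?\<sigma> \<odot> Idn M ?a)))"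
    using Assoc_naturality[of "Idn M ?a" ?s ?t] by simp
  also have "\<dots> = EComp \<A> (A, B, C) \<cdot> ((?t \<odot> collapse B (f # fs)) \<cdot> tens_split C gs B (f # fs))"
    using f by (simp add: HComp2_Comp_Comp)
  finally show ?case .
qed

text \<open>Associativity coherence of the comparison cells. The base case is
  \<open>Runit_HComp1\<close>; the step peels off the first arrow with the pentagon and two
  naturality squares of \<open>Assoc\<close>.\<close>

lemma tens_split_assoc:
  assumes "chain X A fs B" "chain X B gs C" "chain X C hs D"
  shows "Assoc M (tens D hs) (tens C gs) (tens B fs) \<cdot>
      ((tens_split D hs C gs \<odot> Idn M (tens B fs)) \<cdot> tens_split D (gs @ hs) B fs)
    = (Idn M (tens D hs) \<odot> tens_split C gs B fs) \<cdot> tens_split D hs C (fs @ gs)"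
  using assms(1)
proof (induction fs arbitrary: A)
  case Nil
  then have [simp]: "A = B" by simp
  have gh: "chain X B (gs @ hs) D" using assms by (auto simp: chain_append)
  let ?R = "tens D hs" and ?T = "tens C gs" and ?Q = "tens D (gs @ hs)" and ?\<rho> = "tens_split D hs C gs"
    and ?I = "Idn1 M (ob B)"
  note [simp] = tens_simps[OF assms(2)] tens_simps[OF assms(3)] tens_simps[OF gh] tens_split_simps[OF assms(2,3)]
  \<comment> \<open>Composing with this invertible cell brings \<open>Runit_HComp1\<close> into
    play; it is cancelled at the end.\<close>
  have "(Idn M ?R \<odot> Runit M ?T) \<cdot> (Assoc M ?R ?T ?I \<cdot> ((?\<rho> \<odot> Idn M ?I) \<cdot> inv_of (Runit M ?Q)))
    = ((Idn M ?R \<odot> Runit M ?T) \<cdot> Assoc M ?R ?T ?I) \<cdot> ((?\<rho> \<odot> Idn M ?I) \<cdot> inv_of (Runit M ?Q))"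
    by simp
  also have "\<dots> = (Runit M (?R \<otimes> ?T) \<cdot> (?\<rho> \<odot> Idn M ?I)) \<cdot> inv_of (Runit M ?Q)"
    by (simp add: Runit_HComp1)
  also have "\<dots> = (?\<rho> \<cdot> Runit M ?Q) \<cdot> inv_of (Runit M ?Q)"
    using Runit_naturality[of ?\<rho> "ob B"] by simp
  also have "\<dots> = (Idn M ?R \<odot> Runit M ?T) \<cdot> ((Idn M ?R \<odot> inv_of (Runit M ?T)) \<cdot> ?\<rho>)"
    by (simp add: HComp2_Comp_Comp)
  finally have "Assoc M ?R ?T ?I \<cdot> ((?\<rho> \<odot> Idn M ?I) \<cdot> inv_of (Runit M ?Q))
    = (Idn M ?R \<odot> inv_of (Runit M ?T)) \<cdot> ?\<rho>"
    by (rule isos_cancel_left) auto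
  then show ?case by simp
next
  case (Cons f fs)
  obtain A' where f: "f = (A, A')" "chain X A' fs B" "A \<in> X" "A' \<in> X" using Cons.prems by (cases f) auto
  have gh: "chain X B (gs @ hs) D" using assms by (auto simp: chain_append)
  have fg: "chain X A' (fs @ gs) C" using f assms by (auto simp: chain_append)
  have fgh: "chain X A' (fs @ gs @ hs) D" using f assms by (auto simp: chain_append)
  let ?R = "tens D hs" and ?T = "tens C gs" and ?Q = "tens D (gs @ hs)" and ?\<rho> = "tens_split D hs C gs"
    and ?S = "tens B fs" and ?a = "EHom \<A> (A, A')" and ?\<sigma> = "tens_split D (gs @ hs) B fs" and ?\<tau> = "tens_split C gs B fs"
    and ?\<upsilon> = "tens_split D hs C (fs @ gs)" and ?Y = "tens C (fs @ gs)"
  note [simp] = f(3,4) tens_simps[OF assms(2)] tens_simps[OF assms(3)] tens_simps[OF gh] tens_split_simps[OF assms(2,3)]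
    tens_simps[OF f(2)] tens_simps[OF fg] tens_simps[OF fgh] tens_split_simps[OF f(2) gh] tens_split_simps[OF f(2) assms(2)]
    tens_split_simps[OF fg assms(3), unfolded append_assoc]
  have "Assoc M ?R ?T (?S \<otimes> ?a) \<cdot> ((?\<rho> \<odot> Idn M (?S \<otimes> ?a)) \<cdot> (Assoc M ?Q ?S ?a \<cdot> (?\<sigma> \<odot> Idn M ?a)))
    = Assoc M ?R ?T (?S \<otimes> ?a) \<cdot> (((?\<rho> \<odot> Idn M (?S \<otimes> ?a)) \<cdot> Assoc M ?Q ?S ?a) \<cdot> (?\<sigma> \<odot> Idn M ?a))"
    by simp
  also have "\<dots> = Assoc M ?R ?T (?S \<otimes> ?a) \<cdot>
      ((Assoc M (?R \<otimes> ?T) ?S ?a \<cdot> ((?\<rho> \<odot> Idn M ?S) \<odot> Idn M ?a)) \<cdot> (?\<sigma> \<odot> Idn M ?a))"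
    using Assoc_naturality[of "Idn M ?a" "Idn M ?S" ?\<rho>] by simp
  also have "\<dots> = (Assoc M ?R ?T (?S \<otimes> ?a) \<cdot> Assoc M (?R \<otimes> ?T) ?S ?a) \<cdot>
      (((?\<rho> \<odot> Idn M ?S) \<cdot> ?\<sigma>) \<odot> Idn M ?a)"
    by (simp add: HComp2_Comp)
  also have "\<dots> = ((Idn M ?R \<odot> Assoc M ?T ?S ?a) \<cdot> (Assoc M ?R (?T \<otimes> ?S) ?a \<cdot> (Assoc M ?R ?T ?S \<odot> Idn M ?a))) \<cdot>
      (((?\<rho> \<odot> Idn M ?S) \<cdot> ?\<sigma>) \<odot> Idn M ?a)"
    by (subst Pentagon) simp_all
  also have "\<dots> = (Idn M ?R \<odot> Assoc M ?T ?S ?a) \<cdot> (Assoc M ?R (?T \<otimes> ?S) ?a \<cdot>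
      ((Assoc M ?R ?T ?S \<cdot> ((?\<rho> \<odot> Idn M ?S) \<cdot> ?\<sigma>)) \<odot> Idn M ?a))"
    by (simp add: HComp2_Comp)
  also have "\<dots> = (Idn M ?R \<odot> Assoc M ?T ?S ?a) \<cdot> (Assoc M ?R (?T \<otimes> ?S) ?a \<cdot>
      (((Idn M ?R \<odot> ?\<tau>) \<cdot> ?\<upsilon>) \<odot> Idn M ?a))"
    by (simp only: Cons.IH[OF f(2)])
  also have "\<dots> = (Idn M ?R \<odot> Assoc M ?T ?S ?a) \<cdot> ((Assoc M ?R (?T \<otimes> ?S) ?a \<cdot>
      ((Idn M ?R \<odot> ?\<tau>) \<odot> Idn M ?a)) \<cdot> (?\<upsilon> \<odot> Idn M ?a))"
    by (simp add: HComp2_Comp)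
  also have "\<dots> = (Idn M ?R \<odot> Assoc M ?T ?S ?a) \<cdot> (((Idn M ?R \<odot> (?\<tau> \<odot> Idn M ?a)) \<cdot>
      Assoc M ?R ?Y ?a) \<cdot> (?\<upsilon> \<odot> Idn M ?a))"
    using Assoc_naturality[of "Idn M ?a" ?\<tau> "Idn M ?R"] by simp
  also have "\<dots> = (Idn M ?R \<odot> (Assoc M ?T ?S ?a \<cdot> (?\<tau> \<odot> Idn M ?a))) \<cdot>
      (Assoc M ?R ?Y ?a \<cdot> (?\<upsilon> \<odot> Idn M ?a))"
    by (simp add: HComp2_Comp_Comp)
  finally show ?case using f by simp
qed

text \<open>Only the blocks of \<open>u\<close> need an induction. In the step
  \<open>tens_split_assoc\<close>, applied to the first block, the rest of \<open>fs\<close> and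
  \<open>gs\<close>, exchanges the order in which the pieces are split off.\<close>

lemma tens_split_natural:
  assumes "cut X B A fs u fs'" "cut X C B gs v gs'"
  shows "tens_split C gs' B fs' \<cdot> tens_map C (fs @ gs) (u @ map (\<lambda>j. length fs' + j) v) (fs' @ gs')
    = (tens_map C gs v gs' \<odot> tens_map B fs u fs') \<cdot> tens_split C gs B fs"
  using assms(1)
proof (induction rule: cut.induct)
  case Nil
  have c: "chain X B gs C" "chain X B gs' C" using cut_chain[OF assms(2)] by auto
  note [simp] = tens_simps[OF c(1)] tens_simps[OF c(2)] tens_map_simps[OF assms(2)]
  let ?v = "tens_map C gs v gs'" and ?I = "Idn1 M (ob B)"
  have "Runit M (tens C gs') \<cdot> ((?v \<odot> Idn M ?I) \<cdot> inv_of (Runit M (tens C gs)))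
    = (Runit M (tens C gs') \<cdot> (?v \<odot> Idn M ?I)) \<cdot> inv_of (Runit M (tens C gs))" by simp
  also have "\<dots> = ?v \<cdot> Runit M (tens C gs) \<cdot> inv_of (Runit M (tens C gs))"
    using Runit_naturality[of ?v "ob B"] by simp
  also have "\<dots> = Runit M (tens C gs') \<cdot> (inv_of (Runit M (tens C gs')) \<cdot> ?v)" by simp
  finally have "(?v \<odot> Idn M ?I) \<cdot> inv_of (Runit M (tens C gs)) = inv_of (Runit M (tens C gs')) \<cdot> ?v"
    by (rule isos_cancel_left) auto
  then show ?case by simp
next
  case (Cons A fs0 A' fs u fs')
  have c: "chain X B gs C" "chain X B gs' C" "chain X A' fs B" "chain X A' fs' B"
    using cut_chain[OF assms(2)] cut_chain[OF Cons(2)] by auto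
  have d: "chain X A (fs0 @ fs) B" "chain X A' (fs @ gs) C" "chain X A' (fs' @ gs') C" "chain X A (fs0 @ fs @ gs) C"
    using c Cons(1) by (auto simp: chain_append)
  note k = cut_append[OF Cons(2) assms(2)]
  let ?a = "EHom \<A> (A, A')" and ?v = "tens_map C gs v gs'" and ?u = "tens_map B fs u fs'" and ?m = "collapse A' fs0"
    and ?w = "tens_map C (fs @ gs) (u @ map (\<lambda>j. length fs' + j) v) (fs' @ gs')"
  note [simp] = tens_simps[OF c(1)] tens_simps[OF c(2)] tens_simps[OF c(3)] tens_simps[OF c(4)]
    tens_simps[OF d(1)] tens_simps[OF d(2)] tens_simps[OF d(3)] tens_simps[OF d(4)]
    tens_map_simps[OF assms(2)] tens_map_simps[OF Cons(2)] tens_map_simps[OF k] tens_split_simps[OF c(4,2)] tens_split_simps[OF c(3,1)]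
    tens_split_simps[OF Cons(1) c(3)] tens_split_simps[OF Cons(1) d(2)] collapse_simps[OF Cons(1)] tens_simps[OF Cons(1)]
    tens_split_simps[OF d(1) c(1), unfolded append_assoc]
  \<comment> \<open>Up to associativity of lists, the ordinal sum begins with the same block
    \<open>fs0\<close> as its first summand.\<close>
  have "tens_map C ((fs0 @ fs) @ gs) ((replicate (length fs0) 0 @ map Suc u) @ map (\<lambda>j. length ((A, A') # fs') + j) v)
      (((A, A') # fs') @ gs') = (?w \<odot> ?m) \<cdot> tens_split C (fs @ gs) A' fs0"
    using tens_map_Cons[of C fs0 "fs @ gs" "u @ map (\<lambda>j. length fs' + j) v" A A' "fs' @ gs'"]
    by (simp add: comp_def)
  then have "tens_split C gs' B ((A, A') # fs') \<cdot> tens_map C ((fs0 @ fs) @ gs)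
      ((replicate (length fs0) 0 @ map Suc u) @ map (\<lambda>j. length ((A, A') # fs') + j) v) (((A, A') # fs') @ gs')
    = Assoc M (tens C gs') (tens B fs') ?a \<cdot> (((tens_split C gs' B fs' \<cdot> ?w) \<odot> ?m) \<cdot> tens_split C (fs @ gs) A' fs0)"
    by (simp add: HComp2_Comp_Comp)
  also have "\<dots> = Assoc M (tens C gs') (tens B fs') ?a \<cdot>
      ((((?v \<odot> ?u) \<cdot> tens_split C gs B fs) \<odot> ?m) \<cdot> tens_split C (fs @ gs) A' fs0)"
    by (simp only: Cons.IH)
  also have "\<dots> = (Assoc M (tens C gs') (tens B fs') ?a \<cdot> ((?v \<odot> ?u) \<odot> ?m)) \<cdot>
      ((tens_split C gs B fs \<odot> Idn M (tens A' fs0)) \<cdot> tens_split C (fs @ gs) A' fs0)"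
    by (simp add: HComp2_Comp_Comp)
  also have "\<dots> = ((?v \<odot> (?u \<odot> ?m)) \<cdot> Assoc M (tens C gs) (tens B fs) (tens A' fs0)) \<cdot>
      ((tens_split C gs B fs \<odot> Idn M (tens A' fs0)) \<cdot> tens_split C (fs @ gs) A' fs0)"
    using Assoc_naturality[of ?m ?u ?v] by simp
  also have "\<dots> = (?v \<odot> (?u \<odot> ?m)) \<cdot> (Assoc M (tens C gs) (tens B fs) (tens A' fs0) \<cdot>
      ((tens_split C gs B fs \<odot> Idn M (tens A' fs0)) \<cdot> tens_split C (fs @ gs) A' fs0))"
    by simp
  also have "\<dots> = (?v \<odot> (?u \<odot> ?m)) \<cdot> ((Idn M (tens C gs) \<odot> tens_split B fs A' fs0) \<cdot> tens_split C gs B (fs0 @ fs))"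
    by (simp only: tens_split_assoc[OF Cons(1) c(3,1)])
  also have "\<dots> = (?v \<odot> tens_map B (fs0 @ fs) (replicate (length fs0) 0 @ map Suc u) ((A, A') # fs')) \<cdot>
      tens_split C gs B (fs0 @ fs)"
    by (simp add: tens_map_Cons HComp2_Comp_Comp)
  finally show ?case .
qed

text \<open>Composing within blocks and then composing the results is composing everything at once;
  each block is one use of \<open>collapse_append\<close>.\<close>

lemma collapse_tens_map:
  "cut X B A fs u gs \<Longrightarrow> collapse B gs \<cdot> tens_map B fs u gs = collapse B fs"
proof (induction rule: cut.induct)
  case (Cons A fs A' fs' u gs)
  have c: "chain X A' fs' B" "chain X A' gs B" using cut_chain[OF Cons(2)] by auto
  have d: "chain X A (fs @ fs') B" using c Cons(1) by (auto simp: chain_append)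
  note [simp] = tens_simps[OF c(1)] tens_simps[OF c(2)] collapse_simps[OF c(1)] collapse_simps[OF c(2)]
    tens_map_simps[OF Cons(2)] collapse_simps[OF Cons(1)] tens_simps[OF Cons(1)] tens_split_simps[OF Cons(1) c(1)]
  have "collapse B ((A, A') # gs) \<cdot> tens_map B (fs @ fs') (replicate (length fs) 0 @ map Suc u) ((A, A') # gs)
    = EComp \<A> (A, A', B) \<cdot> (((collapse B gs \<cdot> tens_map B fs' u gs) \<odot> collapse A' fs) \<cdot> tens_split B fs' A' fs)"
    by (simp add: tens_map_Cons HComp2_Comp_Comp)
  then show ?case using Cons.IH collapse_append[OF Cons(1) c(1)] by simp
qed simp

text \<open>Induction on the blocks of \<open>v\<close>, with \<open>u\<close> cut accordingly. Over
  each block, \<open>tens_split_natural\<close> moves the splitting past \<open>u\<close>, and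
  \<open>collapse_tens_map\<close> merges the two collapses.\<close>

lemma tens_map_comp:
  "cut X B A gs v hs \<Longrightarrow> cut X B A fs u gs
    \<Longrightarrow> tens_map B fs (map ((!) v) u) hs = tens_map B gs v hs \<cdot> tens_map B fs u gs"
proof (induction arbitrary: fs u rule: cut.induct)
  case Nil
  then show ?case using cut_chain[OF Nil(2)] tens_map_simps[OF Nil(2)] cut_length[OF Nil(2)] by simp
next
  case (Cons A gs A' gs' v hs)
  from cut_split[OF Cons.prems Cons.hyps(1)] obtain fs1 fs2 u1 u2 where
    h: "fs = fs1 @ fs2" "u = u1 @ map (\<lambda>j. length gs + j) u2" "cut X A' A fs1 u1 gs" "cut X B A' fs2 u2 gs'"
    by blast
  \<comment> \<open>The part \<open>u1\<close> lands in \<open>gs\<close>, which is the block of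
    \<open>v\<close> over its first target arrow, so it is sent to zero.\<close>
  have u: "map ((!) (replicate (length gs) 0 @ map Suc v)) u
      = replicate (length fs1) 0 @ map Suc (map ((!) v) u2)"
    unfolding h using cut_length[OF h(3)] cut_length[OF h(4)] cut_length[OF Cons.hyps(2)]
    by (subst vcomp_block) auto
  have c: "chain X A fs1 A'" "chain X A gs A'" "chain X A' fs2 B" "chain X A' gs' B" "chain X A' hs B"
    using cut_chain[OF h(3)] cut_chain[OF h(4)] cut_chain[OF Cons.hyps(2)] by auto
  note [simp] = tens_map_simps[OF h(3)] tens_map_simps[OF h(4)] tens_map_simps[OF Cons.hyps(2)]
    tens_simps[OF c(1)] tens_simps[OF c(2)] tens_simps[OF c(3)] tens_simps[OF c(4)] tens_simps[OF c(5)]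
    collapse_simps[OF c(1)] collapse_simps[OF c(2)] tens_split_simps[OF c(1,3)] tens_split_simps[OF c(2,4)]
    tens_map_simps[OF cut_append[OF h(3,4)]]
  have "tens_map B fs (map ((!) (replicate (length gs) 0 @ map Suc v)) u) ((A, A') # hs)
    = ((tens_map B gs' v hs \<cdot> tens_map B fs2 u2 gs') \<odot> (collapse A' gs \<cdot> tens_map A' fs1 u1 gs)) \<cdot> tens_split B fs2 A' fs1"
    unfolding u h(1) tens_map_Cons Cons.IH[OF h(4)] collapse_tens_map[OF h(3)] ..
  also have "\<dots> = (tens_map B gs' v hs \<odot> collapse A' gs) \<cdot> ((tens_map B fs2 u2 gs' \<odot> tens_map A' fs1 u1 gs) \<cdot> tens_split B fs2 A' fs1)"
    by (simp add: HComp2_Comp_Comp)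
  also have "\<dots> = (tens_map B gs' v hs \<odot> collapse A' gs) \<cdot>
      (tens_split B gs' A' gs \<cdot> tens_map B (fs1 @ fs2) (u1 @ map (\<lambda>j. length gs + j) u2) (gs @ gs'))"
    by (simp only: tens_split_natural[OF h(3,4)])
  finally show ?case unfolding tens_map_Cons h by simp
qed

text \<open>All blocks have length one. The collapse of a single arrow is a left unit constraint, by
  the left identity axiom, and the triangle turns it into the right unit constraint inverted in
  \<open>tens_split\<close>.\<close>

lemma tens_map_id: "chain X A fs B \<Longrightarrow> tens_map B fs [0..<length fs] fs = Idn M (tens B fs)"
proof (induction fs arbitrary: A)
  case (Cons f fs)
  obtain A' where f: "f = (A, A')" "chain X A' fs B" "A \<in> X" "A' \<in> X" using Cons.prems by (cases f) auto
  let ?T = "tens B fs" and ?a = "EHom \<A> (A, A')" and ?I = "Idn1 M (ob A')"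
  note [simp] = f(3,4) tens_simps[OF f(2)]
  have "tens_map B (f # fs) [0..<length (f # fs)] (f # fs) = (Idn M ?T \<odot> collapse A' [f]) \<cdot> tens_split B fs A' [f]"
    using tens_map_Cons[of B "[f]" fs "[0..<length fs]" A A' fs] f Cons.IH[OF f(2)]
    by (simp add: map_Suc_upt upt_conv_Cons del: upt_Suc)
  also have "\<dots> = (Idn M ?T \<odot> Lunit M ?a) \<cdot> (Assoc M ?T ?I ?a \<cdot> (inv_of (Runit M ?T) \<odot> Idn M ?a))"
    using f by (simp add: enr_axioms)
  also have "\<dots> = ((Idn M ?T \<odot> Lunit M ?a) \<cdot> Assoc M ?T ?I ?a) \<cdot> (inv_of (Runit M ?T) \<odot> Idn M ?a)"
    by simp
  also have "\<dots> = (Runit M ?T \<odot> Idn M ?a) \<cdot> (inv_of (Runit M ?T) \<odot> Idn M ?a)"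
    by (subst Triangle) simp_all
  also have "\<dots> = Idn M (?T \<otimes> ?a)" by (simp add: HComp2_Comp)
  finally show ?case using f by simp
qed simp

text \<open>Splitting off the empty path at the far end inserts an identity by reassociation only;
  \<open>Lunit_HComp1\<close> carries its removal through the induction, and
  \<open>Lunit_Idn1\<close> settles the empty path.\<close>

lemma Lunit_tens_split:
  "chain X A fs B \<Longrightarrow> Lunit M (tens B fs) \<cdot> tens_split B [] B fs = Idn M (tens B fs)"
proof (induction fs arbitrary: A)
  case (Cons f fs)
  obtain A' where f: "f = (A, A')" "chain X A' fs B" "A \<in> X" "A' \<in> X" using Cons.prems by (cases f) auto
  have e: "chain X B [] B" using chain_in[OF f(2)] by simp
  let ?T = "tens B fs" and ?a = "EHom \<A> (A, A')" and ?I = "Idn1 M (ob B)"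
  note [simp] = f(3,4) tens_simps[OF f(2)] tens_split_simps[OF f(2) e, simplified]
  have "Lunit M (?T \<otimes> ?a) \<cdot> (Assoc M ?I ?T ?a \<cdot> (tens_split B [] B fs \<odot> Idn M ?a))
    = (Lunit M (?T \<otimes> ?a) \<cdot> Assoc M ?I ?T ?a) \<cdot> (tens_split B [] B fs \<odot> Idn M ?a)" by simp
  also have "\<dots> = (Lunit M ?T \<odot> Idn M ?a) \<cdot> (tens_split B [] B fs \<odot> Idn M ?a)"
    by (simp add: Lunit_HComp1)
  also have "\<dots> = Idn M (?T \<otimes> ?a)" using Cons.IH[OF f(2)] by (simp add: HComp2_Comp)
  finally show ?case using f by simp
qed (simp add: Lunit_Idn1)

text \<open>The unit cells can be identities because \<open>tens\<close> sends the empty path to an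
  identity 1-cell.\<close>

definition pnt :: "('x, ('x, 'x \<times> 'x) path, ('x, 'x \<times> 'x) path_cell, 'o, 'a, 'c) colax" where
  "pnt = \<lparr>Map0 = restrict ob X,
    Map1 = restrict (\<lambda>(A, fs, B). tens B fs) (Obj (path_bicat (coarse X))),
    Map2 = restrict (\<lambda>((A, fs, B), u, (A', gs, B')). tens_map B fs u gs) (Arr (path_bicat (coarse X))),
    Cmp = restrict (\<lambda>((B, gs, C), (A, fs, B')). tens_split C gs B fs)
      {(t, s). t \<in> Obj (path_bicat (coarse X)) \<and> s \<in> Obj (path_bicat (coarse X)) \<and>
        Trg (path_bicat (coarse X)) s = Src (path_bicat (coarse X)) t},
    Unt = restrict (\<lambda>A. Idn M (Idn1 M (ob A))) X\<rparr>"

lemma pnt_simps: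
  "A \<in> X \<Longrightarrow> Map0 pnt A = ob A"
  "chain X A fs B \<Longrightarrow> Map1 pnt (A, fs, B) = tens B fs"
  "cut X B A fs u gs \<Longrightarrow> Map2 pnt ((A, fs, B), u, (A, gs, B)) = tens_map B fs u gs"
  "chain X A fs B \<Longrightarrow> chain X B gs C \<Longrightarrow> Cmp pnt ((B, gs, C), (A, fs, B)) = tens_split C gs B fs"
  "A \<in> X \<Longrightarrow> Unt pnt A = Idn M (Idn1 M (ob A))"
  by (auto simp: pnt_def Obj_path_bicat Arr_path_bicat path_bicat_simps)

lemma is_point_pnt: "is_point (coarse X) M (isos M) pnt"
proof -
  let ?P = "path_bicat (coarse X)"
  have F: "is_functor ?P M (Map1 pnt) (Map2 pnt)"
    unfolding is_functor_def
    by (auto simp: Obj_path_bicat Arr_path_bicat path_bicat_simps pnt_simps tens_simps hom_def tens_map_simps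
        tens_map_id cut_refl cut_comp tens_map_comp dest: cut_chain)
  have "colax_morphism ?P M pnt"
  proof (unfold_locales, goal_cases)
    case 1
    then show ?case by (auto simp: pnt_def path_bicat_simps)
  next
    case (2 f U V)
    then obtain fs where "f = (U, fs, V)" "chain X U fs V" by (auto simp: hom1_path_bicat)
    then show ?case by (simp add: pnt_simps hom1_def tens_simps)
  next
    case 3
    then show ?case by (auto simp: pnt_def)
  next
    case 4
    then show ?case by (rule F)
  next
    case 5
    then show ?case by (auto simp: pnt_def)
  next
    case (6 s U V t W)
    then obtain fs gs where h: "s = (U, fs, V)" "t = (V, gs, W)" "chain X U fs V" "chain X V gs W"
      by (auto simp: hom1_path_bicat)
    have "chain X U (fs @ gs) W" using h by (auto simp: chain_append)
    then show ?case using h tens_split_simps[OF h(3,4)] by (simp add: pnt_simps path_bicat_simps hom_def)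
  next
    case 7
    then show ?case by (auto simp: pnt_def)
  next
    case (8 s U V t W \<alpha> s' \<beta> t')
    then obtain fs gs u v fs' gs' where h: "s = (U, fs, V)" "t = (V, gs, W)" "s' = (U, fs', V)" "t' = (V, gs', W)"
      "\<alpha> = (s, u, s')" "\<beta> = (t, v, t')" "cut X V U fs u fs'" "cut X W V gs v gs'"
      by (auto simp: hom1_path_bicat hom_path_bicat)
    then show ?case using cut_chain[OF h(7)] cut_chain[OF h(8)] cut_append[OF h(7,8)] tens_split_natural[OF h(7,8)]
      by (simp add: pnt_simps path_bicat_simps)
  next
    case (9 U)
    then show ?case by (auto simp: path_bicat_simps pnt_simps hom_def)
  next
    case 10
    then show ?case by (auto simp: pnt_def path_bicat_simps)
  next
    case (11 s U V t W r Z)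
    then obtain fs gs hs where h: "s = (U, fs, V)" "t = (V, gs, W)" "r = (W, hs, Z)"
      "chain X U fs V" "chain X V gs W" "chain X W hs Z" by (auto simp: hom1_path_bicat)
    have d: "chain X U (fs @ gs) W" "chain X V (gs @ hs) Z" "chain X U (fs @ gs @ hs) Z"
      using h by (auto simp: chain_append)
    \<comment> \<open>The associator of the path 2-category is an identity 2-cell, so its image is
      an identity as well.\<close>
    note m = tens_map_id[OF d(3), unfolded length_append] cut_refl[OF d(3), unfolded length_append]
    show ?case
      using tens_split_assoc[OF h(4-6)] h d tens_split_simps[OF d(1) h(6)] tens_simps[OF d(3)]
      by (simp add: pnt_simps path_bicat_simps m)
  next
    case (12 s U V)
    then obtain fs where h: "s = (U, fs, V)" "chain X U fs V" by (auto simp: hom1_path_bicat)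
    have v: "chain X V [] V" using chain_in[OF h(2)] by simp
    show ?case
      using h v Lunit_tens_split[OF h(2)] tens_simps[OF h(2)] tens_split_simps[OF h(2) v]
      by (simp add: pnt_simps path_bicat_simps tens_map_id cut_refl)
  next
    case (13 s U V)
    then obtain fs where h: "s = (U, fs, V)" "chain X U fs V" by (auto simp: hom1_path_bicat)
    have v: "chain X U [] U" using chain_in[OF h(2)] by simp
    show ?case
      using h v tens_simps[OF h(2)]
      by (simp add: pnt_simps path_bicat_simps tens_map_id cut_refl)
  qed
  then show ?thesis
    unfolding is_point_def
    by (auto simp: is_weak_class_isos paths_def path_bicat_simps pnt_simps tens_split_simps)
qed

end

section \<open>The enriched category of a point\<close>

locale point = bicategory M
  for M :: "('o, 'a, 'c, 'z) bicat_scheme" (structure) +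
  fixes X :: "'x set" and F :: "('x, 'x \<times> 'x, 'o, 'a, 'c) point"
  assumes point: "is_point (coarse X) M (isos M) F"
begin

sublocale colax: colax_morphism "path_bicat (coarse X)" M F
  using point by (simp add: is_point_def)

lemma point_simps [simp]:
  "A \<in> X \<Longrightarrow> Map0 F A \<in> Obj0 M"
  "chain X A fs B \<Longrightarrow> Map1 F (A, fs, B) \<in> Obj M"
  "chain X A fs B \<Longrightarrow> Src M (Map1 F (A, fs, B)) = Map0 F A"
  "chain X A fs B \<Longrightarrow> Trg M (Map1 F (A, fs, B)) = Map0 F B"
  "cut X B A fs u gs \<Longrightarrow> Map2 F ((A, fs, B), u, (A, gs, B)) \<in> Arr M"
  "cut X B A fs u gs \<Longrightarrow> Dom M (Map2 F ((A, fs, B), u, (A, gs, B))) = Map1 F (A, fs, B)"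
  "cut X B A fs u gs \<Longrightarrow> Cod M (Map2 F ((A, fs, B), u, (A, gs, B))) = Map1 F (A, gs, B)"
  "A \<in> X \<Longrightarrow> Unt F A \<in> Arr M"
  "A \<in> X \<Longrightarrow> Unt F A \<in> isos M"
  "A \<in> X \<Longrightarrow> Dom M (Unt F A) = Map1 F (A, [], A)"
  "A \<in> X \<Longrightarrow> Cod M (Unt F A) = Idn1 M (Map0 F A)"
  using colax.Map0_in colax.Map1_in[of "(A, fs, B)" A B] colax.Map_functor colax.Unt_in[of A] point
  by (auto simp: hom1_path_bicat hom1_def[of M] hom_def is_functor_def Arr_path_bicat path_bicat_simps
      is_point_def PiE_def Pi_def)

lemma Cmp_simps [simp]:
  assumes "chain X A fs B" "chain X B gs C"
  shows "Cmp F ((B, gs, C), (A, fs, B)) \<in> Arr M" "Cmp F ((B, gs, C), (A, fs, B)) \<in> isos M"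
    "Dom M (Cmp F ((B, gs, C), (A, fs, B))) = Map1 F (A, fs @ gs, C)"
    "Cod M (Cmp F ((B, gs, C), (A, fs, B))) = Map1 F (B, gs, C) \<otimes> Map1 F (A, fs, B)"
  using colax.Cmp_in[of "(A, fs, B)" A B "(B, gs, C)" C] point assms
  by (auto simp: hom1_path_bicat hom_def path_bicat_simps is_point_def paths_def)

lemma Map2_id:
  "chain X A fs B \<Longrightarrow> Map2 F ((A, fs, B), [0..<length fs], (A, fs, B)) = Idn M (Map1 F (A, fs, B))"
  using colax.Map_functor by (auto simp: is_functor_def path_bicat_simps Obj_path_bicat)

lemma Map2_comp:
  assumes "cut X B A gs v hs" "cut X B A fs u gs"
  shows "Map2 F ((A, gs, B), v, (A, hs, B)) \<cdot> Map2 F ((A, fs, B), u, (A, gs, B))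
    = Map2 F ((A, fs, B), map ((!) v) u, (A, hs, B))"
proof -
  have "\<forall>f \<in> Arr (path_bicat (coarse X)). \<forall>g \<in> Arr (path_bicat (coarse X)). snd (snd f) = fst g \<longrightarrow>
      Map2 F (path_vcomp g f) = Map2 F g \<cdot> Map2 F f"
    using colax.Map_functor by (simp add: is_functor_def path_bicat_simps)
  from this[rule_format, of "((A, fs, B), u, (A, gs, B))" "((A, gs, B), v, (A, hs, B))"]
  show ?thesis using assms by (simp add: Arr_path_bicat)
qed

lemma Cmp_naturality:
  assumes "cut X B A fs u fs'" "cut X C B gs v gs'"
  shows "Cmp F ((B, gs', C), (A, fs', B)) \<cdot>
      Map2 F ((A, fs @ gs, C), u @ map (\<lambda>j. length fs' + j) v, (A, fs' @ gs', C))
    = (Map2 F ((B, gs, C), v, (B, gs', C)) \<odot> Map2 F ((A, fs, B), u, (A, fs', B))) \<cdot>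
      Cmp F ((B, gs, C), (A, fs, B))"
  using colax.Cmp_natural[of "(A, fs, B)" A B "(B, gs, C)" C "((A, fs, B), u, (A, fs', B))" "(A, fs', B)"
      "((B, gs, C), v, (B, gs', C))" "(B, gs', C)"] assms cut_chain[OF assms(1)] cut_chain[OF assms(2)]
  by (simp add: hom1_path_bicat hom_path_bicat path_bicat_simps)

text \<open>The path 2-category is strict: the image of its associator is an identity and drops out
  of the coherence axiom. The two unit laws below simplify in the same way.\<close>

lemma Cmp_associative:
  assumes "chain X A fs B" "chain X B gs C" "chain X C hs D"
  shows "Assoc M (Map1 F (C, hs, D)) (Map1 F (B, gs, C)) (Map1 F (A, fs, B)) \<cdot>
      ((Cmp F ((C, hs, D), (B, gs, C)) \<odot> Idn M (Map1 F (A, fs, B))) \<cdot> Cmp F ((B, gs @ hs, D), (A, fs, B)))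
    = (Idn M (Map1 F (C, hs, D)) \<odot> Cmp F ((B, gs, C), (A, fs, B))) \<cdot> Cmp F ((C, hs, D), (A, fs @ gs, C))"
proof -
  have d: "chain X A (fs @ gs) C" "chain X A (fs @ gs @ hs) D"
    using assms by (auto simp: chain_append)
  show ?thesis
    using colax.Cmp_assoc[of "(A, fs, B)" A B "(B, gs, C)" C "(C, hs, D)" D] assms d
      Map2_id[OF d(2), unfolded length_append]
    by (simp add: hom1_path_bicat path_bicat_simps)
qed

lemma Cmp_left_unit:
  assumes "chain X A fs B"
  shows "Lunit M (Map1 F (A, fs, B)) \<cdot>
      ((Unt F B \<odot> Idn M (Map1 F (A, fs, B))) \<cdot> Cmp F ((B, [], B), (A, fs, B))) = Idn M (Map1 F (A, fs, B))"
  using colax.Cmp_Lunit[of "(A, fs, B)" A B] assms Map2_id[OF assms]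
  by (simp add: hom1_path_bicat path_bicat_simps)

lemma Cmp_right_unit:
  assumes "chain X A fs B"
  shows "Runit M (Map1 F (A, fs, B)) \<cdot>
      ((Idn M (Map1 F (A, fs, B)) \<odot> Unt F A) \<cdot> Cmp F ((A, fs, B), (A, [], A))) = Idn M (Map1 F (A, fs, B))"
  using colax.Cmp_Runit[of "(A, fs, B)" A B] assms Map2_id[OF assms]
  by (simp add: hom1_path_bicat path_bicat_simps)

definition enr :: "('x, 'o, 'a, 'c) enriched" where
  "enr = \<lparr>Over = \<lambda>U. {A \<in> X. Map0 F A = U},
    EHom = restrict (\<lambda>(A, B). Map1 F (A, [(A, B)], B)) (X \<times> X),
    EId = restrict (\<lambda>A. Map2 F ((A, [], A), [], (A, [(A, A)], A)) \<cdot> inv_of (Unt F A)) X,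
    EComp = restrict (\<lambda>(A, B, C). Map2 F ((A, [(A, B), (B, C)], C), [0, 0], (A, [(A, C)], C)) \<cdot>
      inv_of (Cmp F ((B, [(B, C)], C), (A, [(A, B)], B)))) (X \<times> X \<times> X)\<rparr>"

lemma cuts [simp]:
  "A \<in> X \<Longrightarrow> cut X A A [] [] [(A, A)]"
  "A \<in> X \<Longrightarrow> B \<in> X \<Longrightarrow> cut X B A [(A, B)] [0] [(A, B)]"
  "A \<in> X \<Longrightarrow> B \<in> X \<Longrightarrow> C \<in> X \<Longrightarrow> cut X C A [(A, B), (B, C)] [0, 0] [(A, C)]"
  using cut_collapse[of X A "[]" A] cut_collapse[of X A "[(A, B)]" B] cut_collapse[of X A "[(A, B), (B, C)]" C]
  by auto

lemma Map2_id1 [simp]: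
  "A \<in> X \<Longrightarrow> B \<in> X \<Longrightarrow> Map2 F ((A, [(A, B)], B), [0], (A, [(A, B)], B)) = Idn M (Map1 F (A, [(A, B)], B))"
  using Map2_id[of A "[(A, B)]" B] by simp

lemma enr_EObj: "EObj M enr = X"
  by (auto simp: EObj_def enr_def)

lemma enr_sel [simp]:
  "A \<in> X \<Longrightarrow> B \<in> X \<Longrightarrow> EHom enr (A, B) = Map1 F (A, [(A, B)], B)"
  "A \<in> X \<Longrightarrow> EId enr A \<in> Arr M"
  "A \<in> X \<Longrightarrow> Dom M (EId enr A) = Idn1 M (Map0 F A)"
  "A \<in> X \<Longrightarrow> Cod M (EId enr A) = Map1 F (A, [(A, A)], A)"
  "A \<in> X \<Longrightarrow> B \<in> X \<Longrightarrow> C \<in> X \<Longrightarrow> EComp enr (A, B, C) \<in> Arr M"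
  "A \<in> X \<Longrightarrow> B \<in> X \<Longrightarrow> C \<in> X \<Longrightarrow>
    Dom M (EComp enr (A, B, C)) = Map1 F (B, [(B, C)], C) \<otimes> Map1 F (A, [(A, B)], B)"
  "A \<in> X \<Longrightarrow> B \<in> X \<Longrightarrow> C \<in> X \<Longrightarrow> Cod M (EComp enr (A, B, C)) = Map1 F (A, [(A, C)], C)"
  by (simp_all add: enr_def)

text \<open>Apart from their sources and targets, the unit and composition cells of
  \<open>enr\<close> enter the later equations only through this rule and the next, which hide the
  inverses.\<close>

lemma EId_Unt:
  "A \<in> X \<Longrightarrow> EId enr A \<cdot> Unt F A = Map2 F ((A, [], A), [], (A, [(A, A)], A))"
  by (simp add: enr_def)

lemma EComp_Cmp:
  "A \<in> X \<Longrightarrow> B \<in> X \<Longrightarrow> C \<in> X \<Longrightarrow> EComp enr (A, B, C) \<cdot> Cmp F ((B, [(B, C)], C), (A, [(A, B)], B))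
    = Map2 F ((A, [(A, B), (B, C)], C), [0, 0], (A, [(A, C)], C))"
  by (simp add: enr_def)

text \<open>The identity of 1 factors as \<open>1 \<rightarrow> 2 \<rightarrow> 1\<close>, with the
  second element of 2 missed. Composing with the invertible unit and comparison cells reduces the
  axiom to this factorization and the left unit law of \<open>F\<close>.\<close>

lemma enr_left:
  assumes [simp]: "A \<in> X" "B \<in> X"
  shows "EComp enr (A, B, B) \<cdot> (EId enr B \<odot> Idn M (Map1 F (A, [(A, B)], B))) = Lunit M (Map1 F (A, [(A, B)], B))"
proof -
  let ?a = "Map1 F (A, [(A, B)], B)" and ?\<phi> = "Cmp F ((B, [], B), (A, [(A, B)], B))"
  \<comment> \<open>The ordinal sum of \<open>1 \<rightarrow> 1\<close> and
    \<open>0 \<rightarrow> 1\<close>, with an empty block over the second arrow.\<close>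
  have k: "cut X B A [(A, B)] [0] [(A, B), (B, B)]" using cut_append[OF cuts(2)[of A B] cuts(1)[of B]] by simp
  note [simp] = point_simps(5-7)[OF k]
  have "(EComp enr (A, B, B) \<cdot> (EId enr B \<odot> Idn M ?a)) \<cdot> ((Unt F B \<odot> Idn M ?a) \<cdot> ?\<phi>)
    = EComp enr (A, B, B) \<cdot> (((EId enr B \<cdot> Unt F B) \<odot> Idn M ?a) \<cdot> ?\<phi>)"
    by (simp add: HComp2_Comp_Comp)
  also have "\<dots> = EComp enr (A, B, B) \<cdot> (Cmp F ((B, [(B, B)], B), (A, [(A, B)], B)) \<cdot>
      Map2 F ((A, [(A, B)], B), [0], (A, [(A, B), (B, B)], B)))"
    using Cmp_naturality[OF cuts(2)[of A B] cuts(1)[of B]] by (simp add: EId_Unt)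
  also have "\<dots> = (EComp enr (A, B, B) \<cdot> Cmp F ((B, [(B, B)], B), (A, [(A, B)], B))) \<cdot>
      Map2 F ((A, [(A, B)], B), [0], (A, [(A, B), (B, B)], B))" by simp
  also have "\<dots> = Lunit M ?a \<cdot> ((Unt F B \<odot> Idn M ?a) \<cdot> ?\<phi>)"
    by (subst EComp_Cmp) (simp_all add: Map2_comp[OF cuts(3) k] Cmp_left_unit)
  finally show ?thesis
    by (rule isos_cancel_right) (auto intro!: isos_Comp)
qed

lemma enr_right:
  assumes [simp]: "A \<in> X" "B \<in> X"
  shows "EComp enr (A, A, B) \<cdot> (Idn M (Map1 F (A, [(A, B)], B)) \<odot> EId enr A) = Runit M (Map1 F (A, [(A, B)], B))"
proof -
  let ?a = "Map1 F (A, [(A, B)], B)" and ?\<phi> = "Cmp F ((A, [(A, B)], B), (A, [], A))"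
  \<comment> \<open>Here the empty block comes first, so the only value is 1.\<close>
  have k: "cut X B A [(A, B)] [1] [(A, A), (A, B)]" using cut_append[OF cuts(1)[of A] cuts(2)[of A B]] by simp
  note [simp] = point_simps(5-7)[OF k, simplified]
  have "(EComp enr (A, A, B) \<cdot> (Idn M ?a \<odot> EId enr A)) \<cdot> ((Idn M ?a \<odot> Unt F A) \<cdot> ?\<phi>)
    = EComp enr (A, A, B) \<cdot> ((Idn M ?a \<odot> (EId enr A \<cdot> Unt F A)) \<cdot> ?\<phi>)"
    by (simp add: HComp2_Comp_Comp)
  also have "\<dots> = EComp enr (A, A, B) \<cdot> (Cmp F ((A, [(A, B)], B), (A, [(A, A)], A)) \<cdot>
      Map2 F ((A, [(A, B)], B), [1], (A, [(A, A), (A, B)], B)))"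
    using Cmp_naturality[OF cuts(1)[of A] cuts(2)[of A B]] by (simp add: EId_Unt)
  also have "\<dots> = (EComp enr (A, A, B) \<cdot> Cmp F ((A, [(A, B)], B), (A, [(A, A)], A))) \<cdot>
      Map2 F ((A, [(A, B)], B), [1], (A, [(A, A), (A, B)], B))" by simp
  also have "\<dots> = Runit M ?a \<cdot> ((Idn M ?a \<odot> Unt F A) \<cdot> ?\<phi>)"
    using Map2_comp[OF cuts(3)[of A A B] k] by (subst EComp_Cmp) (simp_all add: Cmp_right_unit)
  finally show ?thesis
    by (rule isos_cancel_right) (auto intro!: isos_Comp)
qed

text \<open>The map \<open>3 \<rightarrow> 1\<close> factors through
  \<open>2 \<rightarrow> 1\<close> in two ways, after \<open>1 + 2 \<rightarrow> 1 + 1\<close> and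
  after \<open>2 + 1 \<rightarrow> 1 + 1\<close>. Composed with \<open>?p\<close>, both sides become
  its image; the associator comes from \<open>Cmp_associative\<close>.\<close>

lemma enr_assoc:
  assumes [simp]: "A \<in> X" "B \<in> X" "C \<in> X" "D \<in> X"
  shows "EComp enr (A, B, D) \<cdot> (EComp enr (B, C, D) \<odot> Idn M (Map1 F (A, [(A, B)], B)))
    = EComp enr (A, C, D) \<cdot> ((Idn M (Map1 F (C, [(C, D)], D)) \<odot> EComp enr (A, B, C)) \<cdot>
      Assoc M (Map1 F (C, [(C, D)], D)) (Map1 F (B, [(B, C)], C)) (Map1 F (A, [(A, B)], B)))"
proof -
  let ?a = "Map1 F (A, [(A, B)], B)" and ?b = "Map1 F (B, [(B, C)], C)" and ?c = "Map1 F (C, [(C, D)], D)"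
  let ?p = "(Cmp F ((C, [(C, D)], D), (B, [(B, C)], C)) \<odot> Idn M ?a) \<cdot>
    Cmp F ((B, [(B, C), (C, D)], D), (A, [(A, B)], B))"
  let ?s = "(A, [(A, B), (B, C), (C, D)], D)"
  have k: "cut X D A [(A, B), (B, C), (C, D)] [0, 1, 1] [(A, B), (B, D)]"
    "cut X D A [(A, B), (B, C), (C, D)] [0, 0, 1] [(A, C), (C, D)]"
    using cut_append[OF cuts(2)[of A B] cuts(3)[of B C D]] cut_append[OF cuts(3)[of A B C] cuts(2)[of C D]]
    by simp_all
  note [simp] = point_simps(5-7)[OF k(1), simplified] point_simps(5-7)[OF k(2), simplified]
  have "(EComp enr (A, B, D) \<cdot> (EComp enr (B, C, D) \<odot> Idn M ?a)) \<cdot> ?p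
    = EComp enr (A, B, D) \<cdot> (((EComp enr (B, C, D) \<cdot> Cmp F ((C, [(C, D)], D), (B, [(B, C)], C))) \<odot> Idn M ?a) \<cdot>
      Cmp F ((B, [(B, C), (C, D)], D), (A, [(A, B)], B)))"
    by (simp add: HComp2_Comp_Comp)
  also have "\<dots> = EComp enr (A, B, D) \<cdot> (Cmp F ((B, [(B, D)], D), (A, [(A, B)], B)) \<cdot>
      Map2 F (?s, [0, 1, 1], (A, [(A, B), (B, D)], D)))"
    using Cmp_naturality[OF cuts(2)[of A B] cuts(3)[of B C D]] by (simp add: EComp_Cmp)
  also have "\<dots> = (EComp enr (A, B, D) \<cdot> Cmp F ((B, [(B, D)], D), (A, [(A, B)], B))) \<cdot>
      Map2 F (?s, [0, 1, 1], (A, [(A, B), (B, D)], D))" by simp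
  also have "\<dots> = Map2 F (?s, [0, 0, 0], (A, [(A, D)], D))"
    using Map2_comp[OF cuts(3)[of A B D] k(1)] by (subst EComp_Cmp) simp_all
  also have "\<dots> = (EComp enr (A, C, D) \<cdot> Cmp F ((C, [(C, D)], D), (A, [(A, C)], C))) \<cdot>
      Map2 F (?s, [0, 0, 1], (A, [(A, C), (C, D)], D))"
    using Map2_comp[OF cuts(3)[of A C D] k(2)] by (subst EComp_Cmp) simp_all
  also have "\<dots> = EComp enr (A, C, D) \<cdot> (Cmp F ((C, [(C, D)], D), (A, [(A, C)], C)) \<cdot>
      Map2 F (?s, [0, 0, 1], (A, [(A, C), (C, D)], D)))" by simp
  also have "\<dots> = EComp enr (A, C, D) \<cdot> ((Idn M ?c \<odot> (EComp enr (A, B, C) \<cdot> Cmp F ((B, [(B, C)], C), (A, [(A, B)], B)))) \<cdot>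
      Cmp F ((C, [(C, D)], D), (A, [(A, B), (B, C)], C)))"
    using Cmp_naturality[OF cuts(3)[of A B C] cuts(2)[of C D]] by (simp add: EComp_Cmp)
  also have "\<dots> = EComp enr (A, C, D) \<cdot> ((Idn M ?c \<odot> EComp enr (A, B, C)) \<cdot>
      ((Idn M ?c \<odot> Cmp F ((B, [(B, C)], C), (A, [(A, B)], B))) \<cdot> Cmp F ((C, [(C, D)], D), (A, [(A, B), (B, C)], C))))"
    by (simp add: HComp2_Comp_Comp)
  also have "\<dots> = EComp enr (A, C, D) \<cdot> ((Idn M ?c \<odot> EComp enr (A, B, C)) \<cdot> (Assoc M ?c ?b ?a \<cdot> ?p))"
    using Cmp_associative[of A "[(A, B)]" B "[(B, C)]" C "[(C, D)]" D] by simp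
  also have "\<dots> = (EComp enr (A, C, D) \<cdot> ((Idn M ?c \<odot> EComp enr (A, B, C)) \<cdot> Assoc M ?c ?b ?a)) \<cdot> ?p"
    by simp
  finally show ?thesis
    by (rule isos_cancel_right) (auto intro!: isos_Comp)
qed

lemma enriched_category_enr: "enriched_category M enr"
proof (unfold_locales, unfold enr_EObj, goal_cases)
  case 1
  then show ?case by (auto simp: disjoint_family_on_def enr_def)
next
  case (2 U)
  then show ?case by (auto simp: enr_def)
next
  case (3 U V A B)
  then have "A \<in> X" "B \<in> X" "Map0 F A = U" "Map0 F B = V" by (auto simp: enr_def)
  then show ?case by (simp add: hom1_def)
next
  case 4
  then show ?case by (simp add: enr_def)
next
  case (5 U A)
  then have "A \<in> X" "Map0 F A = U" by (auto simp: enr_def)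
  then show ?case by (simp add: hom_def)
next
  case 6
  then show ?case by (simp add: enr_def)
next
  case (7 A B C)
  then show ?case by (simp add: hom_def)
next
  case 8
  then show ?case by (simp add: enr_def)
qed (simp_all add: enr_left enr_right enr_assoc)

end

section \<open>Morphisms of points\<close>

context bicategory
begin

lemma is_point_mor_iff:
  "is_point_mor (coarse X) M F G \<sigma> \<longleftrightarrow>
    (\<forall>A \<in> X. Map0 F A = Map0 G A) \<and> \<sigma> \<in> extensional (paths (coarse X)) \<and>
    (\<forall>A fs B. chain X A fs B \<longrightarrow> \<sigma> (A, fs, B) \<in> hom M (Map1 F (A, fs, B)) (Map1 G (A, fs, B))) \<and>
    (\<forall>A B fs u gs. cut X B A fs u gs \<longrightarrow>
      Map2 G ((A, fs, B), u, (A, gs, B)) \<cdot> \<sigma> (A, fs, B) = \<sigma> (A, gs, B) \<cdot> Map2 F ((A, fs, B), u, (A, gs, B))) \<and>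
    (\<forall>A B C fs gs. chain X A fs B \<longrightarrow> chain X B gs C \<longrightarrow>
      Cmp G ((B, gs, C), (A, fs, B)) \<cdot> \<sigma> (A, fs @ gs, C)
        = (\<sigma> (B, gs, C) \<odot> \<sigma> (A, fs, B)) \<cdot> Cmp F ((B, gs, C), (A, fs, B))) \<and>
    (\<forall>A \<in> X. Unt G A \<cdot> \<sigma> (A, [], A) = Unt F A)"
proof -
  have "is_nat_trans (path_bicat (coarse X)) M (Map1 F) (Map2 F) (Map1 G) (Map2 G) \<sigma> \<longleftrightarrow>
    (\<forall>A fs B. chain X A fs B \<longrightarrow> \<sigma> (A, fs, B) \<in> hom M (Map1 F (A, fs, B)) (Map1 G (A, fs, B))) \<and>
    (\<forall>A B fs u gs. cut X B A fs u gs \<longrightarrow>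
      Map2 G ((A, fs, B), u, (A, gs, B)) \<cdot> \<sigma> (A, fs, B) = \<sigma> (A, gs, B) \<cdot> Map2 F ((A, fs, B), u, (A, gs, B)))"
    unfolding is_nat_trans_def by (force simp: Obj_path_bicat Arr_path_bicat path_bicat_simps)
  moreover have "(\<forall>s \<in> paths (coarse X). \<forall>t \<in> paths (coarse X).
      Trg (path_bicat (coarse X)) s = Src (path_bicat (coarse X)) t \<longrightarrow>
        Cmp G (t, s) \<cdot> \<sigma> (path_append t s) = (\<sigma> t \<odot> \<sigma> s) \<cdot> Cmp F (t, s)) \<longleftrightarrow>
    (\<forall>A B C fs gs. chain X A fs B \<longrightarrow> chain X B gs C \<longrightarrow>
      Cmp G ((B, gs, C), (A, fs, B)) \<cdot> \<sigma> (A, fs @ gs, C)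
        = (\<sigma> (B, gs, C) \<odot> \<sigma> (A, fs, B)) \<cdot> Cmp F ((B, gs, C), (A, fs, B)))"
    by (force simp: paths_def path_bicat_simps)
  ultimately show ?thesis unfolding is_point_mor_def by simp
qed

section \<open>Identities and composites of morphisms of points\<close>

lemma is_point_mor_Idn:
  assumes "is_point (coarse X) M (isos M) F"
  shows "is_point_mor (coarse X) M F F (restrict (\<lambda>s. Idn M (Map1 F s)) (paths (coarse X)))"
proof -
  interpret point M X F by unfold_locales fact
  show ?thesis
    unfolding is_point_mor_iff
  proof (intro conjI allI impI ballI)
    fix A B C fs gs assume h: "chain X A fs B" "chain X B gs C"
    then have "chain X A (fs @ gs) C" by (auto simp: chain_append)
    with h show "Cmp F ((B, gs, C), (A, fs, B)) \<cdot> restrict (\<lambda>s. Idn M (Map1 F s)) (paths (coarse X)) (A, fs @ gs, C)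
      = (restrict (\<lambda>s. Idn M (Map1 F s)) (paths (coarse X)) (B, gs, C) \<odot>
          restrict (\<lambda>s. Idn M (Map1 F s)) (paths (coarse X)) (A, fs, B)) \<cdot> Cmp F ((B, gs, C), (A, fs, B))"
      by (simp add: paths_def)
  qed (auto simp: paths_def hom_def dest: cut_chain)
qed

lemma is_point_mor_Comp:
  assumes "is_point (coarse X) M (isos M) F" "is_point (coarse X) M (isos M) G" "is_point (coarse X) M (isos M) H"
    and s: "is_point_mor (coarse X) M F G \<sigma>" and t: "is_point_mor (coarse X) M G H \<tau>"
  shows "is_point_mor (coarse X) M F H (restrict (\<lambda>s. \<tau> s \<cdot> \<sigma> s) (paths (coarse X)))"
proof -
  interpret F: point M X F by unfold_locales fact
  interpret G: point M X G by unfold_locales fact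
  interpret H: point M X H by unfold_locales fact
  note s = s[unfolded is_point_mor_iff] and t = t[unfolded is_point_mor_iff]
  have [simp]: "\<sigma> (A, fs, B) \<in> Arr M" "Dom M (\<sigma> (A, fs, B)) = Map1 F (A, fs, B)"
    "Cod M (\<sigma> (A, fs, B)) = Map1 G (A, fs, B)" "\<tau> (A, fs, B) \<in> Arr M"
    "Dom M (\<tau> (A, fs, B)) = Map1 G (A, fs, B)" "Cod M (\<tau> (A, fs, B)) = Map1 H (A, fs, B)"
    if "chain X A fs B" for A fs B
    using s t that by (auto simp: hom_def)
  define \<rho> where "\<rho> = restrict (\<lambda>s. \<tau> s \<cdot> \<sigma> s) (paths (coarse X))"
  have r: "\<rho> (A, fs, B) = \<tau> (A, fs, B) \<cdot> \<sigma> (A, fs, B)" if "chain X A fs B" for A fs B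
    using that by (simp add: \<rho>_def paths_def)
  show ?thesis
    unfolding is_point_mor_iff \<rho>_def[symmetric]
  proof (intro conjI allI impI ballI)
    show "Map0 F A = Map0 H A" if "A \<in> X" for A using s t that by simp
    show "\<rho> \<in> extensional (paths (coarse X))" by (simp add: \<rho>_def)
    show "\<rho> (A, fs, B) \<in> hom M (Map1 F (A, fs, B)) (Map1 H (A, fs, B))" if "chain X A fs B" for A fs B
      using that by (simp add: r hom_def)
  next
    fix A B fs u gs assume h: "cut X B A fs u gs"
    note [simp] = cut_chain[OF h]
    have "Map2 H ((A, fs, B), u, (A, gs, B)) \<cdot> \<rho> (A, fs, B)
      = (Map2 H ((A, fs, B), u, (A, gs, B)) \<cdot> \<tau> (A, fs, B)) \<cdot> \<sigma> (A, fs, B)"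
      using h by (simp add: r)
    also have "\<dots> = (\<tau> (A, gs, B) \<cdot> Map2 G ((A, fs, B), u, (A, gs, B))) \<cdot> \<sigma> (A, fs, B)"
      using h t by simp
    also have "\<dots> = \<tau> (A, gs, B) \<cdot> (Map2 G ((A, fs, B), u, (A, gs, B)) \<cdot> \<sigma> (A, fs, B))"
      using h by simp
    also have "\<dots> = \<tau> (A, gs, B) \<cdot> (\<sigma> (A, gs, B) \<cdot> Map2 F ((A, fs, B), u, (A, gs, B)))"
      using h s by simp
    finally show "Map2 H ((A, fs, B), u, (A, gs, B)) \<cdot> \<rho> (A, fs, B) = \<rho> (A, gs, B) \<cdot> Map2 F ((A, fs, B), u, (A, gs, B))"
      using h by (simp add: r)
  next
    fix A B C fs gs assume h [simp]: "chain X A fs B" "chain X B gs C"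
    have d [simp]: "chain X A (fs @ gs) C" unfolding chain_append using h by blast
    let ?s = "(A, fs, B)" and ?t = "(B, gs, C)" and ?st = "(A, fs @ gs, C)"
    have [simp]: "Map0 F A = Map0 G A" "Map0 F B = Map0 G B" "Map0 F C = Map0 G C"
      using s chain_in[OF h(1)] chain_in[OF h(2)] by auto
    have "Cmp H (?t, ?s) \<cdot> \<rho> ?st = (Cmp H (?t, ?s) \<cdot> \<tau> ?st) \<cdot> \<sigma> ?st"
      by (simp add: r)
    also have "\<dots> = ((\<tau> ?t \<odot> \<tau> ?s) \<cdot> Cmp G (?t, ?s)) \<cdot> \<sigma> ?st"
      using t h by simp
    also have "\<dots> = (\<tau> ?t \<odot> \<tau> ?s) \<cdot> (Cmp G (?t, ?s) \<cdot> \<sigma> ?st)"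
      by simp
    also have "\<dots> = (\<tau> ?t \<odot> \<tau> ?s) \<cdot> ((\<sigma> ?t \<odot> \<sigma> ?s) \<cdot> Cmp F (?t, ?s))"
      using s h by simp
    finally show "Cmp H (?t, ?s) \<cdot> \<rho> ?st = (\<rho> ?t \<odot> \<rho> ?s) \<cdot> Cmp F (?t, ?s)"
      by (simp add: r HComp2_Comp_Comp)
  next
    fix A assume A: "A \<in> X"
    then have "Unt H A \<cdot> \<rho> (A, [], A) = (Unt H A \<cdot> \<tau> (A, [], A)) \<cdot> \<sigma> (A, [], A)"
      by (simp add: r)
    also have "\<dots> = Unt F A" using s t A by simp
    finally show "Unt H A \<cdot> \<rho> (A, [], A) = Unt F A" .
  qed
qed

lemma category_point_cat: "category (point_cat (coarse X) M (isos M))"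
proof
  let ?P = "point_cat (coarse X) M (isos M)"
  have comp: "Comp ?P (G, \<tau>, H) (F, \<sigma>, G) = (F, restrict (\<lambda>s. \<tau> s \<cdot> \<sigma> s) (paths (coarse X)), H)" for F G H \<sigma> \<tau>
    by (simp add: point_cat_def)
  have arr: "f \<in> Arr ?P \<longleftrightarrow> (\<exists>F \<sigma> G. f = (F, \<sigma>, G) \<and> is_point (coarse X) M (isos M) F \<and>
    is_point (coarse X) M (isos M) G \<and> is_point_mor (coarse X) M F G \<sigma>)" for f
    by (auto simp: point_cat_def)
  have hom: "f \<in> hom ?P F G \<longleftrightarrow> (\<exists>\<sigma>. f = (F, \<sigma>, G) \<and> is_point (coarse X) M (isos M) F \<and>
    is_point (coarse X) M (isos M) G \<and> is_point_mor (coarse X) M F G \<sigma>)" for f F G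
    by (auto simp: point_cat_def hom_def)
  have mor: "\<sigma> \<in> extensional (paths (coarse X))" "chain X A fs B \<Longrightarrow> \<sigma> (A, fs, B) \<in> Arr M"
    "chain X A fs B \<Longrightarrow> Dom M (\<sigma> (A, fs, B)) = Map1 F (A, fs, B)"
    "chain X A fs B \<Longrightarrow> Cod M (\<sigma> (A, fs, B)) = Map1 G (A, fs, B)"
    if "is_point_mor (coarse X) M F G \<sigma>" for F G \<sigma> A fs B
    using that unfolding is_point_mor_iff by (auto simp: hom_def)
  show "Dom ?P f \<in> Obj ?P" "Cod ?P f \<in> Obj ?P" if "f \<in> Arr ?P" for f
    using that by (auto simp: point_cat_def)
  show "Idn ?P a \<in> hom ?P a a" if "a \<in> Obj ?P" for a
    using that is_point_mor_Idn by (auto simp: point_cat_def hom_def)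
  show "Comp ?P g f \<in> hom ?P a c" if "f \<in> hom ?P a b" "g \<in> hom ?P b c" for f g a b c
    using that unfolding hom by (auto simp: comp intro: is_point_mor_Comp)
  show "Comp ?P (Idn ?P (Cod ?P f)) f = f" "Comp ?P f (Idn ?P (Dom ?P f)) = f" if "f \<in> Arr ?P" for f
  proof -
    from that obtain F \<sigma> G where f: "f = (F, \<sigma>, G)" "is_point_mor (coarse X) M F G \<sigma>" unfolding arr by blast
    have "restrict (\<lambda>s. restrict (\<lambda>s. Idn M (Map1 G s)) (paths (coarse X)) s \<cdot> \<sigma> s) (paths (coarse X)) = \<sigma>"
      "restrict (\<lambda>s. \<sigma> s \<cdot> restrict (\<lambda>s. Idn M (Map1 F s)) (paths (coarse X)) s) (paths (coarse X)) = \<sigma>"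
      using mor[OF f(2)] by (auto intro!: extensionalityI[of _ "paths (coarse X)"] simp: paths_def)
    then show "Comp ?P (Idn ?P (Cod ?P f)) f = f" "Comp ?P f (Idn ?P (Dom ?P f)) = f"
      using f by (simp_all add: point_cat_def)
  qed
  show "Comp ?P (Comp ?P h g) f = Comp ?P h (Comp ?P g f)"
    if "f \<in> hom ?P a b" "g \<in> hom ?P b c" "h \<in> hom ?P c d" for f g h a b c d
  proof -
    from that obtain \<rho> \<sigma> \<tau> where f: "f = (a, \<rho>, b)" "g = (b, \<sigma>, c)" "h = (c, \<tau>, d)" "is_point_mor (coarse X) M a b \<rho>"
      "is_point_mor (coarse X) M b c \<sigma>" "is_point_mor (coarse X) M c d \<tau>"
      unfolding hom by blast
    show ?thesis unfolding f comp
      using mor(2-)[OF f(4)] mor(2-)[OF f(5)] mor(2-)[OF f(6)] by (auto simp: paths_def intro!: restrict_ext)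
  qed
qed

section \<open>Identities, composites and isomorphisms of enriched categories over
  \<open>X\<close>\<close>

lemma enr_mor_simps:
  assumes "enriched_category M \<A>" "EObj M \<A> = X" "enriched_category M \<B>" "EObj M \<B> = X"
    "is_enriched_mor M X \<A> \<B> T" "A \<in> X" "B \<in> X"
  shows "T (A, B) \<in> Arr M" "Dom M (T (A, B)) = EHom \<A> (A, B)" "Cod M (T (A, B)) = EHom \<B> (A, B)"
  using assms unfolding is_enriched_mor_def hom_def by auto

lemma enriched_overI: "enriched_category M \<A> \<Longrightarrow> EObj M \<A> = X \<Longrightarrow> enriched_over M \<A> X"
  by (intro enriched_over.intro bicategory_axioms) (auto simp: enriched_over_axioms_def)

text \<open>Makes horizontal composites of cells from different enriched categories composable: a
  morphism preserves the fibres, so both choices of base object are made from the same set.\<close>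

lemma ob_cong:
  assumes "\<forall>U \<in> Obj0 M. Over \<A> U = Over \<B> U" "enriched_over M \<A> X" "enriched_over M \<B> X"
  shows "enriched_over.ob M \<A> A = enriched_over.ob M \<B> A"
  using assms(1) unfolding enriched_over.ob_def[OF assms(2)] enriched_over.ob_def[OF assms(3)]
  by (metis (no_types, lifting))

lemma is_enriched_mor_Idn:
  assumes "enriched_category M \<A>" "EObj M \<A> = X"
  shows "is_enriched_mor M X \<A> \<A> (restrict (\<lambda>p. Idn M (EHom \<A> p)) (X \<times> X))"
proof -
  interpret enriched_over M \<A> X by (rule enriched_overI[OF assms])
  show ?thesis unfolding is_enriched_mor_def by (auto simp: hom_def)
qed

lemma is_enriched_mor_Comp:
  assumes "enriched_category M \<A>" "EObj M \<A> = X" "enriched_category M \<B>" "EObj M \<B> = X"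
    "enriched_category M \<C>" "EObj M \<C> = X"
    and S: "is_enriched_mor M X \<A> \<B> S" and T: "is_enriched_mor M X \<B> \<C> T"
  shows "is_enriched_mor M X \<A> \<C> (restrict (\<lambda>p. T p \<cdot> S p) (X \<times> X))"
proof -
  interpret A: enriched_over M \<A> X by (rule enriched_overI) fact+
  interpret B: enriched_over M \<B> X by (rule enriched_overI) fact+
  interpret C: enriched_over M \<C> X by (rule enriched_overI) fact+
  have ob: "A.ob A = B.ob A" for A
    using S by (intro ob_cong[where X = X and \<A> = \<A> and \<B> = \<B>] A.enriched_over_axioms B.enriched_over_axioms) (simp add: is_enriched_mor_def)
  note [simp] = enr_mor_simps[OF assms(1-4) S] enr_mor_simps[OF assms(3-6) T]
  show ?thesis
    unfolding is_enriched_mor_def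
  proof (intro conjI ballI)
    show "Over \<A> U = Over \<C> U" if "U \<in> Obj0 M" for U using that S T by (simp add: is_enriched_mor_def)
    show "restrict (\<lambda>p. T p \<cdot> S p) (X \<times> X) \<in> extensional (X \<times> X)" by simp
    show "restrict (\<lambda>p. T p \<cdot> S p) (X \<times> X) (A, B) \<in> hom M (EHom \<A> (A, B)) (EHom \<C> (A, B))"
      if "A \<in> X" "B \<in> X" for A B using that by (simp add: hom_def)
    show "restrict (\<lambda>p. T p \<cdot> S p) (X \<times> X) (A, A) \<cdot> EId \<A> A = EId \<C> A" if "A \<in> X" for A
      using that S T by (simp add: is_enriched_mor_def)
  next
    fix A B C assume [simp]: "A \<in> X" "B \<in> X" "C \<in> X"
    have "(T (A, C) \<cdot> S (A, C)) \<cdot> EComp \<A> (A, B, C) = T (A, C) \<cdot> (S (A, C) \<cdot> EComp \<A> (A, B, C))"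
      by simp
    also have "\<dots> = T (A, C) \<cdot> (EComp \<B> (A, B, C) \<cdot> (S (B, C) \<odot> S (A, B)))"
      using S by (simp add: is_enriched_mor_def)
    also have "\<dots> = (T (A, C) \<cdot> EComp \<B> (A, B, C)) \<cdot> (S (B, C) \<odot> S (A, B))"
      by (simp add: ob)
    also have "\<dots> = (EComp \<C> (A, B, C) \<cdot> (T (B, C) \<odot> T (A, B))) \<cdot> (S (B, C) \<odot> S (A, B))"
      using T by (simp add: is_enriched_mor_def)
    finally show "restrict (\<lambda>p. T p \<cdot> S p) (X \<times> X) (A, C) \<cdot> EComp \<A> (A, B, C)
      = EComp \<C> (A, B, C) \<cdot> (restrict (\<lambda>p. T p \<cdot> S p) (X \<times> X) (B, C) \<odot> restrict (\<lambda>p. T p \<cdot> S p) (X \<times> X) (A, B))"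
      by (simp add: HComp2_Comp ob)
  qed
qed

lemma category_enriched_cat: "category (enriched_cat M X)"
proof
  let ?P = "enriched_cat M X"
  have comp: "Comp ?P (\<B>, T, \<C>) (\<A>, S, \<B>) = (\<A>, restrict (\<lambda>p. T p \<cdot> S p) (X \<times> X), \<C>)" for \<A> \<B> \<C> S T
    by (simp add: enriched_cat_def)
  have hom: "f \<in> hom ?P \<A> \<B> \<longleftrightarrow> (\<exists>T. f = (\<A>, T, \<B>) \<and> enriched_category M \<A> \<and> EObj M \<A> = X \<and>
    enriched_category M \<B> \<and> EObj M \<B> = X \<and> is_enriched_mor M X \<A> \<B> T)" for f \<A> \<B>
    by (auto simp: enriched_cat_def hom_def)
  show "Dom ?P f \<in> Obj ?P" "Cod ?P f \<in> Obj ?P" if "f \<in> Arr ?P" for f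
    using that by (cases f; simp add: enriched_cat_def)+
  show "Idn ?P a \<in> hom ?P a a" if "a \<in> Obj ?P" for a
    using that is_enriched_mor_Idn[of a X] by (simp add: enriched_cat_def hom_def)
  show "Comp ?P g f \<in> hom ?P a c" if "f \<in> hom ?P a b" "g \<in> hom ?P b c" for f g a b c
  proof -
    from that obtain S T where f: "f = (a, S, b)" "g = (b, T, c)" "enriched_category M a" "EObj M a = X"
      "enriched_category M b" "EObj M b = X" "enriched_category M c" "EObj M c = X"
      "is_enriched_mor M X a b S" "is_enriched_mor M X b c T"
      unfolding hom by blast
    then show ?thesis
      unfolding f(1,2) comp hom using is_enriched_mor_Comp[OF f(3-)] by blast
  qed
  show "Comp ?P (Idn ?P (Cod ?P f)) f = f" "Comp ?P f (Idn ?P (Dom ?P f)) = f" if "f \<in> Arr ?P" for f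
  proof -
    from that obtain \<A> T \<B> where f: "f = (\<A>, T, \<B>)" "enriched_category M \<A>" "EObj M \<A> = X"
      "enriched_category M \<B>" "EObj M \<B> = X" "is_enriched_mor M X \<A> \<B> T"
      by (cases f) (simp add: enriched_cat_def)
    have "T \<in> extensional (X \<times> X)" using f by (simp add: is_enriched_mor_def)
    then have "restrict (\<lambda>p. restrict (\<lambda>p. Idn M (EHom \<B> p)) (X \<times> X) p \<cdot> T p) (X \<times> X) = T"
      "restrict (\<lambda>p. T p \<cdot> restrict (\<lambda>p. Idn M (EHom \<A> p)) (X \<times> X) p) (X \<times> X) = T"
      using enr_mor_simps[OF f(2-)] by (auto intro!: extensionalityI[of _ "X \<times> X"])
    then show "Comp ?P (Idn ?P (Cod ?P f)) f = f" "Comp ?P f (Idn ?P (Dom ?P f)) = f"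
      unfolding f(1) by (simp_all add: enriched_cat_def)
  qed
  show "Comp ?P (Comp ?P h g) f = Comp ?P h (Comp ?P g f)"
    if "f \<in> hom ?P a b" "g \<in> hom ?P b c" "h \<in> hom ?P c d" for f g h a b c d
  proof -
    from that obtain \<rho> \<sigma> \<tau> where f: "f = (a, \<rho>, b)" "g = (b, \<sigma>, c)" "h = (c, \<tau>, d)" "is_enriched_mor M X a b \<rho>"
      "is_enriched_mor M X b c \<sigma>" "is_enriched_mor M X c d \<tau>" "enriched_category M a" "EObj M a = X"
      "enriched_category M b" "EObj M b = X" "enriched_category M c" "EObj M c = X"
      "enriched_category M d" "EObj M d = X"
      unfolding hom by blast
    show ?thesis unfolding f(1-3) comp
      using enr_mor_simps[OF f(7-10,4)] enr_mor_simps[OF f(9-12,5)] enr_mor_simps[OF f(11-14,6)]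
      by (auto intro!: restrict_ext)
  qed
qed

text \<open>Cancelling the components of \<open>T\<close> shows that their inverses respect units
  and compositions, so invertibility can be tested on components.\<close>

lemma enriched_mor_isos:
  assumes A: "enriched_category M \<A>" "EObj M \<A> = X" and B: "enriched_category M \<B>" "EObj M \<B> = X"
    and T: "is_enriched_mor M X \<A> \<B> T" and iso: "\<And>A B. A \<in> X \<Longrightarrow> B \<in> X \<Longrightarrow> T (A, B) \<in> isos M"
  shows "(\<A>, T, \<B>) \<in> isos (enriched_cat M X)"
proof -
  interpret A: enriched_over M \<A> X by (rule enriched_overI) fact+
  interpret B: enriched_over M \<B> X by (rule enriched_overI) fact+
  have ob: "A.ob A = B.ob A" for A
    using T by (intro ob_cong[where X = X and \<A> = \<A> and \<B> = \<B>] A.enriched_over_axioms B.enriched_over_axioms) (simp add: is_enriched_mor_def)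
  note [simp] = enr_mor_simps[OF A B T] iso
  let ?S = "restrict (\<lambda>p. inv_of (T p)) (X \<times> X)"
  have S: "is_enriched_mor M X \<B> \<A> ?S"
    unfolding is_enriched_mor_def
  proof (intro conjI ballI)
    show "Over \<B> U = Over \<A> U" if "U \<in> Obj0 M" for U using that T by (simp add: is_enriched_mor_def)
    show "?S (A, A) \<cdot> EId \<B> A = EId \<A> A" if "A \<in> X" for A
    proof (rule isos_cancel_left[of "T (A, A)"])
      show "T (A, A) \<cdot> (?S (A, A) \<cdot> EId \<B> A) = T (A, A) \<cdot> EId \<A> A"
        using that T by (simp add: is_enriched_mor_def)
    qed (use that ob in auto)
    show "?S (A, C) \<cdot> EComp \<B> (A, B, C) = EComp \<A> (A, B, C) \<cdot> (?S (B, C) \<odot> ?S (A, B))"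
      if [simp]: "A \<in> X" "B \<in> X" "C \<in> X" for A B C
    proof (rule isos_cancel_left[of "T (A, C)"])
      have "T (A, C) \<cdot> (EComp \<A> (A, B, C) \<cdot> (?S (B, C) \<odot> ?S (A, B)))
        = (T (A, C) \<cdot> EComp \<A> (A, B, C)) \<cdot> (?S (B, C) \<odot> ?S (A, B))" by (simp add: ob)
      also have "\<dots> = (EComp \<B> (A, B, C) \<cdot> (T (B, C) \<odot> T (A, B))) \<cdot> (?S (B, C) \<odot> ?S (A, B))"
        using T by (simp add: is_enriched_mor_def)
      also have "\<dots> = EComp \<B> (A, B, C)" by (simp add: HComp2_Comp ob)
      finally show "T (A, C) \<cdot> (?S (A, C) \<cdot> EComp \<B> (A, B, C))
        = T (A, C) \<cdot> (EComp \<A> (A, B, C) \<cdot> (?S (B, C) \<odot> ?S (A, B)))" by simp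
    qed (simp_all add: ob)
  qed (auto simp: hom_def)
  have "T \<in> extensional (X \<times> X)" using T by (simp add: is_enriched_mor_def)
  have "restrict (\<lambda>p. ?S p \<cdot> T p) (X \<times> X) = restrict (\<lambda>p. Idn M (EHom \<A> p)) (X \<times> X)"
    "restrict (\<lambda>p. T p \<cdot> ?S p) (X \<times> X) = restrict (\<lambda>p. Idn M (EHom \<B> p)) (X \<times> X)"
    by (auto intro!: restrict_ext)
  then show ?thesis
    using S T A B
    by (intro category.isosI[OF category_enriched_cat, where g = "(\<B>, ?S, \<A>)"])
      (simp_all add: enriched_cat_def)
qed

end

section \<open>Comparison of morphisms\<close>

locale point_pair = F: point M X F + G: point M X G
  for M :: "('o, 'a, 'c, 'z) bicat_scheme" (structure)
    and X :: "'x set" and F G :: "('x, 'x \<times> 'x, 'o, 'a, 'c) point"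
begin

section \<open>Restriction of a morphism to paths of length one\<close>

definition arrow_part :: "(('x, 'x \<times> 'x) path \<Rightarrow> 'c) \<Rightarrow> 'x \<times> 'x \<Rightarrow> 'c" where
  "arrow_part \<sigma> = restrict (\<lambda>(A, B). \<sigma> (A, [(A, B)], B)) (X \<times> X)"

context
  fixes \<sigma>
  assumes \<sigma>: "is_point_mor (coarse X) M F G \<sigma>"
begin

lemma mor_Map0: "A \<in> X \<Longrightarrow> Map0 F A = Map0 G A"
  using \<sigma> by (simp add: F.is_point_mor_iff)

lemma mor_simps [simp]:
  "chain X A fs B \<Longrightarrow> \<sigma> (A, fs, B) \<in> Arr M"
  "chain X A fs B \<Longrightarrow> Dom M (\<sigma> (A, fs, B)) = Map1 F (A, fs, B)"
  "chain X A fs B \<Longrightarrow> Cod M (\<sigma> (A, fs, B)) = Map1 G (A, fs, B)"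
  using \<sigma> by (auto simp: F.is_point_mor_iff hom_def)

lemma mor_nat:
  "cut X B A fs u gs \<Longrightarrow>
    Map2 G ((A, fs, B), u, (A, gs, B)) \<cdot> \<sigma> (A, fs, B) = \<sigma> (A, gs, B) \<cdot> Map2 F ((A, fs, B), u, (A, gs, B))"
  using \<sigma> by (simp add: F.is_point_mor_iff)

lemma mor_Cmp:
  "chain X A fs B \<Longrightarrow> chain X B gs C \<Longrightarrow>
    Cmp G ((B, gs, C), (A, fs, B)) \<cdot> \<sigma> (A, fs @ gs, C)
      = (\<sigma> (B, gs, C) \<odot> \<sigma> (A, fs, B)) \<cdot> Cmp F ((B, gs, C), (A, fs, B))"
  using \<sigma> by (simp add: F.is_point_mor_iff)

lemma mor_Unt: "A \<in> X \<Longrightarrow> Unt G A \<cdot> \<sigma> (A, [], A) = Unt F A"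
  using \<sigma> by (simp add: F.is_point_mor_iff)

text \<open>Compatibility with units is naturality at \<open>0 \<rightarrow> 1\<close>, and
  compatibility with composition is naturality at \<open>2 \<rightarrow> 1\<close>, once the cells
  \<open>Unt F A\<close> and \<open>?\<phi>\<close> are cancelled.\<close>

lemma is_enriched_mor_arrow_part: "is_enriched_mor M X F.enr G.enr (arrow_part \<sigma>)"
  unfolding is_enriched_mor_def
proof (intro conjI ballI)
  show "Over F.enr U = Over G.enr U" for U
    by (auto simp: F.enr_def G.enr_def mor_Map0)
  show "arrow_part \<sigma> \<in> extensional (X \<times> X)" by (simp add: arrow_part_def)
  show "arrow_part \<sigma> (A, B) \<in> hom M (EHom F.enr (A, B)) (EHom G.enr (A, B))" if "A \<in> X" "B \<in> X" for A B
    using that by (simp add: arrow_part_def hom_def)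
  show "arrow_part \<sigma> (A, A) \<cdot> EId F.enr A = EId G.enr A" if [simp]: "A \<in> X" for A
  proof (rule F.isos_cancel_right)
    have "EId G.enr A \<cdot> (Unt G A \<cdot> \<sigma> (A, [], A)) = (EId G.enr A \<cdot> Unt G A) \<cdot> \<sigma> (A, [], A)"
      by simp
    also have "\<dots> = (\<sigma> (A, [(A, A)], A) \<cdot> EId F.enr A) \<cdot> Unt F A"
      using mor_nat[OF F.cuts(1)[of A]] by (subst G.EId_Unt) (simp_all add: F.EId_Unt)
    finally show "(arrow_part \<sigma> (A, A) \<cdot> EId F.enr A) \<cdot> Unt F A = EId G.enr A \<cdot> Unt F A"
      by (simp add: arrow_part_def mor_Unt)
  qed (simp_all add: arrow_part_def mor_Map0)
  show "arrow_part \<sigma> (A, C) \<cdot> EComp F.enr (A, B, C)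
      = EComp G.enr (A, B, C) \<cdot> (arrow_part \<sigma> (B, C) \<odot> arrow_part \<sigma> (A, B))"
    if [simp]: "A \<in> X" "B \<in> X" "C \<in> X" for A B C
  proof (rule F.isos_cancel_right)
    let ?\<phi> = "Cmp F ((B, [(B, C)], C), (A, [(A, B)], B))" and ?\<psi> = "Cmp G ((B, [(B, C)], C), (A, [(A, B)], B))"
      and ?s = "(A, [(A, B), (B, C)], C)"
    have "(EComp G.enr (A, B, C) \<cdot> (\<sigma> (B, [(B, C)], C) \<odot> \<sigma> (A, [(A, B)], B))) \<cdot> ?\<phi>
      = EComp G.enr (A, B, C) \<cdot> ((\<sigma> (B, [(B, C)], C) \<odot> \<sigma> (A, [(A, B)], B)) \<cdot> ?\<phi>)"
      by (simp add: mor_Map0)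
    also have "\<dots> = EComp G.enr (A, B, C) \<cdot> (?\<psi> \<cdot> \<sigma> ?s)"
      using mor_Cmp[of A "[(A, B)]" B "[(B, C)]" C] by simp
    also have "\<dots> = (EComp G.enr (A, B, C) \<cdot> ?\<psi>) \<cdot> \<sigma> ?s" by simp
    also have "\<dots> = (\<sigma> (A, [(A, C)], C) \<cdot> EComp F.enr (A, B, C)) \<cdot> ?\<phi>"
      using mor_nat[OF F.cuts(3)[of A B C]] by (subst G.EComp_Cmp) (simp_all add: F.EComp_Cmp)
    finally show "(arrow_part \<sigma> (A, C) \<cdot> EComp F.enr (A, B, C)) \<cdot> ?\<phi>
      = (EComp G.enr (A, B, C) \<cdot> (arrow_part \<sigma> (B, C) \<odot> arrow_part \<sigma> (A, B))) \<cdot> ?\<phi>"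
      by (simp add: arrow_part_def)
  qed (simp_all add: arrow_part_def mor_Map0)
qed

end

text \<open>Induction on the path: the unit cell of \<open>G\<close> determines the component at the
  empty path, and the comparison cell that splits off the first arrow determines the others.\<close>

lemma arrow_part_inj:
  assumes s: "is_point_mor (coarse X) M F G \<sigma>" and t: "is_point_mor (coarse X) M F G \<tau>"
    and eq: "arrow_part \<sigma> = arrow_part \<tau>"
  shows "\<sigma> = \<tau>"
proof (rule extensionalityI)
  show "\<sigma> \<in> extensional (paths (coarse X))" "\<tau> \<in> extensional (paths (coarse X))"
    using s t by (auto simp: F.is_point_mor_iff)
  note [simp] = mor_simps[OF s] mor_simps[OF t]
  have eq1: "\<sigma> (A, [(A, B)], B) = \<tau> (A, [(A, B)], B)" if "A \<in> X" "B \<in> X" for A B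
    using fun_cong[OF eq, of "(A, B)"] that by (simp add: arrow_part_def)
  have "chain X A fs B \<Longrightarrow> \<sigma> (A, fs, B) = \<tau> (A, fs, B)" for A fs B
  proof (induction fs arbitrary: A)
    case Nil
    then have [simp]: "A = B" "B \<in> X" by auto
    have "Unt G B \<cdot> \<sigma> (B, [], B) = Unt G B \<cdot> \<tau> (B, [], B)"
      using mor_Unt[OF s] mor_Unt[OF t] by simp
    then have "\<sigma> (B, [], B) = \<tau> (B, [], B)"
      by (rule F.isos_cancel_left) auto
    then show ?case by simp
  next
    case (Cons f fs)
    obtain A' where f [simp]: "f = (A, A')" "chain X A' fs B" "A \<in> X" "A' \<in> X"
      using Cons.prems by (cases f) auto
    have "Cmp G ((A', fs, B), (A, [(A, A')], A')) \<cdot> \<sigma> (A, [(A, A')] @ fs, B)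
      = Cmp G ((A', fs, B), (A, [(A, A')], A')) \<cdot> \<tau> (A, [(A, A')] @ fs, B)"
      using Cons.IH[OF f(2)] eq1[OF f(3,4)]
      by (simp only: mor_Cmp[OF s] mor_Cmp[OF t] f chain_Cons chain_Nil fst_conv snd_conv simp_thms)
    then have "\<sigma> (A, [(A, A')] @ fs, B) = \<tau> (A, [(A, A')] @ fs, B)"
      by (rule F.isos_cancel_left) auto
    then show ?case by simp
  qed
  then show "\<sigma> s = \<tau> s" if "s \<in> paths (coarse X)" for s
    using that by (auto simp: paths_def)
qed

section \<open>Extension of components on arrows to all paths\<close>

context
  fixes T
  assumes T: "is_enriched_mor M X F.enr G.enr T"
begin

lemma T_Map0 [simp]: "A \<in> X \<Longrightarrow> Map0 F A = Map0 G A"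
proof -
  assume A: "A \<in> X"
  have "A \<in> Over F.enr (Map0 F A)" using A by (simp add: F.enr_def)
  then have "A \<in> Over G.enr (Map0 F A)" using T A F.point_simps(1)[OF A] by (simp add: is_enriched_mor_def)
  then show "Map0 F A = Map0 G A" by (simp add: G.enr_def)
qed

lemma T_simps [simp]:
  assumes "A \<in> X" "B \<in> X"
  shows "T (A, B) \<in> Arr M" "Dom M (T (A, B)) = Map1 F (A, [(A, B)], B)"
    "Cod M (T (A, B)) = Map1 G (A, [(A, B)], B)"
  using F.enr_mor_simps[OF F.enriched_category_enr F.enr_EObj G.enriched_category_enr G.enr_EObj T assms] assms
  by auto

text \<open>Forced by compatibility with the unit cells and with the comparison cells that split off
  the first arrow.\<close>

primrec lift :: "'x \<Rightarrow> ('x \<times> 'x) list \<Rightarrow> 'c" where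
  "lift B [] = F.inv_of (Unt G B) \<cdot> Unt F B"
| "lift B (f # fs) = F.inv_of (Cmp G ((snd f, fs, B), (fst f, [f], snd f))) \<cdot>
    ((lift B fs \<odot> T f) \<cdot> Cmp F ((snd f, fs, B), (fst f, [f], snd f)))"

lemma lift_simps:
  assumes "chain X A fs B"
  shows "lift B fs \<in> Arr M" "Dom M (lift B fs) = Map1 F (A, fs, B)" "Cod M (lift B fs) = Map1 G (A, fs, B)"
proof -
  have "lift B fs \<in> Arr M \<and> Dom M (lift B fs) = Map1 F (A, fs, B) \<and> Cod M (lift B fs) = Map1 G (A, fs, B)"
    using assms
  proof (induction fs arbitrary: A)
    case (Cons f fs)
    obtain A' where f: "f = (A, A')" "chain X A' fs B" "A \<in> X" "A' \<in> X" using Cons.prems by (cases f) auto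
    then show ?case using Cons.IH[OF f(2)] by simp
  qed auto
  then show "lift B fs \<in> Arr M" "Dom M (lift B fs) = Map1 F (A, fs, B)" "Cod M (lift B fs) = Map1 G (A, fs, B)"
    by auto
qed

lemma Unt_lift: "B \<in> X \<Longrightarrow> Unt G B \<cdot> lift B [] = Unt F B"
  by simp

lemma Cmp_lift1:
  assumes "A \<in> X" "A' \<in> X" "chain X A' fs B"
  shows "Cmp G ((A', fs, B), (A, [(A, A')], A')) \<cdot> lift B ((A, A') # fs)
    = (lift B fs \<odot> T (A, A')) \<cdot> Cmp F ((A', fs, B), (A, [(A, A')], A'))"
  using assms lift_simps[OF assms(3)] by simp

declare lift.simps [simp del]

text \<open>By recursion, a single arrow is still split into itself and an empty path. The left unit
  laws of \<open>G\<close> and \<open>F\<close>, linked by naturality of \<open>Lunit\<close>,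
  remove the empty part.\<close>

lemma lift_arrow:
  assumes [simp]: "A \<in> X" "B \<in> X"
  shows "lift B [(A, B)] = T (A, B)"
proof -
  let ?a = "Map1 F (A, [(A, B)], B)" and ?b = "Map1 G (A, [(A, B)], B)"
    and ?\<phi> = "Cmp F ((B, [], B), (A, [(A, B)], B))" and ?\<psi> = "Cmp G ((B, [], B), (A, [(A, B)], B))"
    and ?I = "Idn1 M (Map0 G B)"
  have c [simp]: "chain X B [] B" "chain X A [(A, B)] B" by simp_all
  note [simp] = lift_simps[OF c(1)] lift_simps[OF c(2)]
  have "lift B [(A, B)] = (Lunit M ?b \<cdot> ((Unt G B \<odot> Idn M ?b) \<cdot> ?\<psi>)) \<cdot> lift B [(A, B)]"
    using G.Cmp_left_unit[OF c(2)] by simp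
  also have "\<dots> = Lunit M ?b \<cdot> ((Unt G B \<odot> Idn M ?b) \<cdot> (?\<psi> \<cdot> lift B [(A, B)]))" by simp
  also have "\<dots> = Lunit M ?b \<cdot> ((Unt G B \<odot> Idn M ?b) \<cdot> ((lift B [] \<odot> T (A, B)) \<cdot> ?\<phi>))"
    using Cmp_lift1[of A B "[]" B] by simp
  also have "\<dots> = Lunit M ?b \<cdot> (((Unt G B \<cdot> lift B []) \<odot> T (A, B)) \<cdot> ?\<phi>)"
    by (simp add: F.HComp2_Comp_Comp)
  also have "\<dots> = (Lunit M ?b \<cdot> (Idn M ?I \<odot> T (A, B))) \<cdot> ((Unt F B \<odot> Idn M ?a) \<cdot> ?\<phi>)"
    by (simp add: F.HComp2_Comp_Comp Unt_lift)
  also have "\<dots> = (T (A, B) \<cdot> Lunit M ?a) \<cdot> ((Unt F B \<odot> Idn M ?a) \<cdot> ?\<phi>)"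
    using F.Lunit_naturality[of "T (A, B)" "Map0 G B"] by simp
  also have "\<dots> = T (A, B)" using F.Cmp_left_unit[OF c(2)] by simp
  finally show ?thesis .
qed

text \<open>The recursion ensures compatibility only for splitting off one arrow. Arbitrary
  splittings follow by induction from \<open>Cmp_associative\<close> for \<open>F\<close> and
  \<open>G\<close>, starting from the right unit laws.\<close>

lemma Cmp_lift:
  assumes "chain X A fs B" "chain X B gs C"
  shows "Cmp G ((B, gs, C), (A, fs, B)) \<cdot> lift C (fs @ gs)
    = (lift C gs \<odot> lift B fs) \<cdot> Cmp F ((B, gs, C), (A, fs, B))"
  using assms(1)
proof (induction fs arbitrary: A)
  case Nil
  then have [simp]: "A = B" "B \<in> X" by auto
  have e: "chain X B [] B" by simp
  note [simp] = assms(2) lift_simps[OF assms(2)] lift_simps[OF e]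
  let ?a = "Map1 F (B, gs, C)" and ?b = "Map1 G (B, gs, C)"
    and ?\<phi> = "Cmp F ((B, gs, C), (B, [], B))" and ?\<psi> = "Cmp G ((B, gs, C), (B, [], B))"
    and ?I = "Idn1 M (Map0 G B)"
  \<comment> \<open>The invertible cell in front allows the right unit laws of both points to be
    used; it is cancelled afterwards.\<close>
  have "(Runit M ?b \<cdot> (Idn M ?b \<odot> Unt G B)) \<cdot> (?\<psi> \<cdot> lift C gs)
      = (Runit M ?b \<cdot> ((Idn M ?b \<odot> Unt G B) \<cdot> ?\<psi>)) \<cdot> lift C gs"
    using chain_in[OF assms(2)] by simp
  also have "\<dots> = lift C gs \<cdot> (Runit M ?a \<cdot> ((Idn M ?a \<odot> Unt F B) \<cdot> ?\<phi>))"
    unfolding F.Cmp_right_unit[OF assms(2)] G.Cmp_right_unit[OF assms(2)] by simp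
  also have "\<dots> = (lift C gs \<cdot> Runit M ?a) \<cdot> ((Idn M ?a \<odot> Unt F B) \<cdot> ?\<phi>)"
    using chain_in[OF assms(2)] by simp
  also have "\<dots> = (Runit M ?b \<cdot> (lift C gs \<odot> Idn M ?I)) \<cdot> ((Idn M ?a \<odot> Unt F B) \<cdot> ?\<phi>)"
    using F.Runit_naturality[of "lift C gs" "Map0 G B"] by simp
  also have "\<dots> = (Runit M ?b \<cdot> (Idn M ?b \<odot> Unt G B)) \<cdot> ((lift C gs \<odot> lift B []) \<cdot> ?\<phi>)"
    by (simp add: F.HComp2_Comp_Comp Unt_lift)
  finally have "?\<psi> \<cdot> lift C gs = (lift C gs \<odot> lift B []) \<cdot> ?\<phi>"
    by (rule F.isos_cancel_left) (auto intro!: F.isos_Comp)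
  then show ?case by simp
next
  case (Cons f fs)
  obtain A' where f [simp]: "f = (A, A')" and c [simp]: "chain X A' fs B" "A \<in> X" "A' \<in> X"
    using Cons.prems by (cases f) auto
  have g [simp]: "chain X A [(A, A')] A'" by simp
  have d [simp]: "chain X A' (fs @ gs) C" "chain X A ((A, A') # fs) B" "chain X A ((A, A') # fs @ gs) C"
    using assms c(1) by (auto simp: chain_append simp del: c(1))
  have [simp]: "B \<in> X" "C \<in> X" using chain_in[OF assms(2)] by auto
  note [simp] = assms(2) lift_simps[OF assms(2)] lift_simps[OF c(1)] lift_simps[OF d(1)] lift_simps[OF d(2)]
    lift_simps[OF d(3)]
  let ?t = "(B, gs, C)" and ?s = "(A', fs, B)" and ?f = "(A, [(A, A')], A')" and ?st = "(A', fs @ gs, C)"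
    and ?fs = "(A, (A, A') # fs, B)" and ?T = "T (A, A')"
  let ?w = "lift C ((A, A') # fs @ gs)"
  have GC: "Assoc M (Map1 G ?t) (Map1 G ?s) (Map1 G ?f) \<cdot>
      ((Cmp G (?t, ?s) \<odot> Idn M (Map1 G ?f)) \<cdot> Cmp G (?st, ?f)) = (Idn M (Map1 G ?t) \<odot> Cmp G (?s, ?f)) \<cdot> Cmp G (?t, ?fs)"
    using G.Cmp_associative[OF g c(1) assms(2)] by simp
  have FC: "Assoc M (Map1 F ?t) (Map1 F ?s) (Map1 F ?f) \<cdot>
      ((Cmp F (?t, ?s) \<odot> Idn M (Map1 F ?f)) \<cdot> Cmp F (?st, ?f)) = (Idn M (Map1 F ?t) \<odot> Cmp F (?s, ?f)) \<cdot> Cmp F (?t, ?fs)"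
    using F.Cmp_associative[OF g c(1) assms(2)] by simp
  have [simp]: "Dom M (Cmp F (?st, ?f)) = Map1 F (A, (A, A') # fs @ gs, C)"
    "Dom M (Cmp G (?st, ?f)) = Map1 G (A, (A, A') # fs @ gs, C)"
    "Dom M (Cmp F (?s, ?f)) = Map1 F ?fs" "Dom M (Cmp G (?s, ?f)) = Map1 G ?fs"
    using F.Cmp_simps(3)[OF g d(1)] G.Cmp_simps(3)[OF g d(1)] F.Cmp_simps(3)[OF g c(1)] G.Cmp_simps(3)[OF g c(1)]
    by simp_all
  \<comment> \<open>The path is cut into its first arrow, the rest of \<open>fs\<close>, and
    \<open>gs\<close>: \<open>GC\<close> changes the bracketing for \<open>G\<close>,
    \<open>FC\<close> changes it back for \<open>F\<close>.\<close>
  have "(Idn M (Map1 G ?t) \<odot> Cmp G (?s, ?f)) \<cdot> (Cmp G (?t, ?fs) \<cdot> ?w)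
    = ((Idn M (Map1 G ?t) \<odot> Cmp G (?s, ?f)) \<cdot> Cmp G (?t, ?fs)) \<cdot> ?w"
    by simp
  also have "\<dots> = (Assoc M (Map1 G ?t) (Map1 G ?s) (Map1 G ?f) \<cdot>
      ((Cmp G (?t, ?s) \<odot> Idn M (Map1 G ?f)) \<cdot> Cmp G (?st, ?f))) \<cdot> ?w"
    by (simp only: GC)
  also have "\<dots> = Assoc M (Map1 G ?t) (Map1 G ?s) (Map1 G ?f) \<cdot>
      ((Cmp G (?t, ?s) \<odot> Idn M (Map1 G ?f)) \<cdot> (Cmp G (?st, ?f) \<cdot> ?w))"
    by simp
  also have "\<dots> = Assoc M (Map1 G ?t) (Map1 G ?s) (Map1 G ?f) \<cdot>
      (((Cmp G (?t, ?s) \<cdot> lift C (fs @ gs)) \<odot> ?T) \<cdot> Cmp F (?st, ?f))"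
    using Cmp_lift1[OF c(2,3) d(1)] by (simp add: F.HComp2_Comp_Comp)
  also have "\<dots> = (Assoc M (Map1 G ?t) (Map1 G ?s) (Map1 G ?f) \<cdot> ((lift C gs \<odot> lift B fs) \<odot> ?T)) \<cdot>
      ((Cmp F (?t, ?s) \<odot> Idn M (Map1 F ?f)) \<cdot> Cmp F (?st, ?f))"
    unfolding Cons.IH[OF c(1)] by (simp add: F.HComp2_Comp_Comp)
  also have "\<dots> = ((lift C gs \<odot> (lift B fs \<odot> ?T)) \<cdot> Assoc M (Map1 F ?t) (Map1 F ?s) (Map1 F ?f)) \<cdot>
      ((Cmp F (?t, ?s) \<odot> Idn M (Map1 F ?f)) \<cdot> Cmp F (?st, ?f))"
    using F.Assoc_naturality[of ?T "lift B fs" "lift C gs"] by simp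
  also have "\<dots> = (lift C gs \<odot> (lift B fs \<odot> ?T)) \<cdot> (Assoc M (Map1 F ?t) (Map1 F ?s) (Map1 F ?f) \<cdot>
      ((Cmp F (?t, ?s) \<odot> Idn M (Map1 F ?f)) \<cdot> Cmp F (?st, ?f)))"
    by simp
  also have "\<dots> = (lift C gs \<odot> ((lift B fs \<odot> ?T) \<cdot> Cmp F (?s, ?f))) \<cdot> Cmp F (?t, ?fs)"
    unfolding FC by (simp add: F.HComp2_Comp_Comp)
  also have "\<dots> = (Idn M (Map1 G ?t) \<odot> Cmp G (?s, ?f)) \<cdot> ((lift C gs \<odot> lift B ((A, A') # fs)) \<cdot> Cmp F (?t, ?fs))"
    using Cmp_lift1[OF c(2,3,1)] by (simp add: F.HComp2_Comp_Comp)
  finally have "Cmp G (?t, ?fs) \<cdot> ?w = (lift C gs \<odot> lift B ((A, A') # fs)) \<cdot> Cmp F (?t, ?fs)"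
    by (rule F.isos_cancel_left) auto
  then show ?case by simp
qed

text \<open>Bundles well-typedness with the naturality square, so that closure under composition and
  ordinal sum can be stated for both at once.\<close>

definition nat_at :: "'x \<Rightarrow> 'x \<Rightarrow> ('x \<times> 'x) list \<Rightarrow> nat list \<Rightarrow> ('x \<times> 'x) list \<Rightarrow> bool" where
  "nat_at B A fs u gs \<longleftrightarrow> cut X B A fs u gs \<and>
    Map2 G ((A, fs, B), u, (A, gs, B)) \<cdot> lift B fs = lift B gs \<cdot> Map2 F ((A, fs, B), u, (A, gs, B))"

lemma nat_at_id: "chain X A fs B \<Longrightarrow> nat_at B A fs [0..<length fs] fs"
  unfolding nat_at_def using lift_simps[of A fs B] by (simp add: cut_refl F.Map2_id G.Map2_id)

lemma nat_at_comp:
  assumes v: "nat_at B A gs v hs" and u: "nat_at B A fs u gs"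
  shows "nat_at B A fs (map ((!) v) u) hs"
proof -
  note c [simp] = v[unfolded nat_at_def, THEN conjunct1] u[unfolded nat_at_def, THEN conjunct1]
  note l = cut_chain[OF c(1)] cut_chain[OF c(2)]
  note [simp] = lift_simps[OF l(1)[THEN conjunct1]] lift_simps[OF l(1)[THEN conjunct2]]
    lift_simps[OF l(2)[THEN conjunct1]]
  let ?s = "(A, fs, B)" and ?t = "(A, gs, B)" and ?r = "(A, hs, B)"
  have "(Map2 G (?t, v, ?r) \<cdot> Map2 G (?s, u, ?t)) \<cdot> lift B fs = Map2 G (?t, v, ?r) \<cdot> (Map2 G (?s, u, ?t) \<cdot> lift B fs)"
    by simp
  also have "\<dots> = (Map2 G (?t, v, ?r) \<cdot> lift B gs) \<cdot> Map2 F (?s, u, ?t)"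
    using u by (simp add: nat_at_def)
  also have "\<dots> = (lift B hs \<cdot> Map2 F (?t, v, ?r)) \<cdot> Map2 F (?s, u, ?t)"
    using v by (simp add: nat_at_def)
  also have "\<dots> = lift B hs \<cdot> (Map2 F (?t, v, ?r) \<cdot> Map2 F (?s, u, ?t))" by simp
  finally show ?thesis
    unfolding nat_at_def F.Map2_comp[OF c] G.Map2_comp[OF c] using cut_comp[OF c] by blast
qed

text \<open>Naturality of the comparison cells and \<open>Cmp_lift\<close> reduce the square of a
  sum to the two given squares; the comparison cell of \<open>G\<close> is then cancelled.\<close>

lemma nat_at_append:
  assumes u: "nat_at B A fs u fs'" and v: "nat_at C B gs v gs'"
  shows "nat_at C A (fs @ gs) (u @ map (\<lambda>j. length fs' + j) v) (fs' @ gs')"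
proof -
  note cu [simp] = u[unfolded nat_at_def, THEN conjunct1] and cv [simp] = v[unfolded nat_at_def, THEN conjunct1]
  have c [simp]: "chain X A fs B" "chain X A fs' B" "chain X B gs C" "chain X B gs' C"
    using cut_chain[OF cu] cut_chain[OF cv] by auto
  note k [simp] = cut_append[OF cu cv]
  have d [simp]: "chain X A (fs @ gs) C" "chain X A (fs' @ gs') C" using cut_chain[OF k] by auto
  have [simp]: "A \<in> X" "B \<in> X" "C \<in> X" using chain_in[OF c(1)] chain_in[OF c(3)] by auto
  note [simp] = lift_simps[OF c(1)] lift_simps[OF c(2)] lift_simps[OF c(3)] lift_simps[OF c(4)]
    lift_simps[OF d(1)] lift_simps[OF d(2)]
  let ?uv = "u @ map (\<lambda>j. length fs' + j) v" and ?s = "(A, fs, B)" and ?s' = "(A, fs', B)"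
    and ?t = "(B, gs, C)" and ?t' = "(B, gs', C)" and ?st = "(A, fs @ gs, C)" and ?st' = "(A, fs' @ gs', C)"
  have "Cmp G (?t', ?s') \<cdot> (Map2 G (?st, ?uv, ?st') \<cdot> lift C (fs @ gs))
    = (Cmp G (?t', ?s') \<cdot> Map2 G (?st, ?uv, ?st')) \<cdot> lift C (fs @ gs)" by simp
  also have "\<dots> = ((Map2 G (?t, v, ?t') \<odot> Map2 G (?s, u, ?s')) \<cdot> Cmp G (?t, ?s)) \<cdot> lift C (fs @ gs)"
    by (simp only: G.Cmp_naturality[OF cu cv])
  also have "\<dots> = (Map2 G (?t, v, ?t') \<odot> Map2 G (?s, u, ?s')) \<cdot> (Cmp G (?t, ?s) \<cdot> lift C (fs @ gs))" by simp
  also have "\<dots> = (Map2 G (?t, v, ?t') \<odot> Map2 G (?s, u, ?s')) \<cdot> ((lift C gs \<odot> lift B fs) \<cdot> Cmp F (?t, ?s))"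
    by (simp only: Cmp_lift[OF c(1,3)])
  also have "\<dots> = ((Map2 G (?t, v, ?t') \<cdot> lift C gs) \<odot> (Map2 G (?s, u, ?s') \<cdot> lift B fs)) \<cdot> Cmp F (?t, ?s)"
    by (simp add: F.HComp2_Comp_Comp)
  also have "\<dots> = ((lift C gs' \<cdot> Map2 F (?t, v, ?t')) \<odot> (lift B fs' \<cdot> Map2 F (?s, u, ?s'))) \<cdot> Cmp F (?t, ?s)"
    using u v by (simp add: nat_at_def)
  also have "\<dots> = (lift C gs' \<odot> lift B fs') \<cdot> ((Map2 F (?t, v, ?t') \<odot> Map2 F (?s, u, ?s')) \<cdot> Cmp F (?t, ?s))"
    by (simp add: F.HComp2_Comp_Comp)
  also have "\<dots> = (lift C gs' \<odot> lift B fs') \<cdot> (Cmp F (?t', ?s') \<cdot> Map2 F (?st, ?uv, ?st'))"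
    by (simp only: F.Cmp_naturality[OF cu cv])
  also have "\<dots> = ((lift C gs' \<odot> lift B fs') \<cdot> Cmp F (?t', ?s')) \<cdot> Map2 F (?st, ?uv, ?st')"
    by simp
  also have "\<dots> = (Cmp G (?t', ?s') \<cdot> lift C (fs' @ gs')) \<cdot> Map2 F (?st, ?uv, ?st')"
    by (simp only: Cmp_lift[OF c(2,4)])
  also have "\<dots> = Cmp G (?t', ?s') \<cdot> (lift C (fs' @ gs') \<cdot> Map2 F (?st, ?uv, ?st'))" by simp
  finally have "Map2 G (?st, ?uv, ?st') \<cdot> lift C (fs @ gs) = lift C (fs' @ gs') \<cdot> Map2 F (?st, ?uv, ?st')"
    by (rule F.isos_cancel_left) auto
  then show ?thesis using k by (simp add: nat_at_def)
qed

text \<open>First generator: since \<open>lift\<close> agrees with \<open>T\<close> on arrows, the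
  square is the compatibility of \<open>T\<close> with units.\<close>

lemma nat_at_unit:
  assumes [simp]: "A \<in> X" shows "nat_at A A [] [] [(A, A)]"
proof -
  have e: "chain X A [] A" by simp
  note [simp] = lift_simps[OF e]
  have "Map2 G ((A, [], A), [], (A, [(A, A)], A)) \<cdot> lift A [] = EId G.enr A \<cdot> (Unt G A \<cdot> lift A [])"
    using F.Comp_Comp[of "lift A []" "Unt G A" "EId G.enr A"] by (simp add: G.EId_Unt)
  also have "\<dots> = (T (A, A) \<cdot> EId F.enr A) \<cdot> Unt F A"
    using T by (simp add: Unt_lift is_enriched_mor_def)
  also have "\<dots> = lift A [(A, A)] \<cdot> Map2 F ((A, [], A), [], (A, [(A, A)], A))"
    by (simp add: lift_arrow F.EId_Unt)
  finally show ?thesis by (simp add: nat_at_def)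
qed

text \<open>Second generator: the square is the compatibility of \<open>T\<close> with
  composition.\<close>

lemma nat_at_mult:
  assumes [simp]: "A \<in> X" "B \<in> X" "C \<in> X"
  shows "nat_at C A [(A, B), (B, C)] [0, 0] [(A, C)]"
proof -
  let ?s = "(A, [(A, B), (B, C)], C)" and ?r = "(A, [(A, C)], C)"
    and ?\<phi> = "Cmp F ((B, [(B, C)], C), (A, [(A, B)], B))" and ?\<psi> = "Cmp G ((B, [(B, C)], C), (A, [(A, B)], B))"
  have c: "chain X A [(A, B), (B, C)] C" by simp
  note [simp] = lift_simps[OF c]
  have "Map2 G (?s, [0, 0], ?r) \<cdot> lift C [(A, B), (B, C)]
      = (EComp G.enr (A, B, C) \<cdot> ?\<psi>) \<cdot> lift C [(A, B), (B, C)]"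
    by (simp only: G.EComp_Cmp assms)
  also have "\<dots> = EComp G.enr (A, B, C) \<cdot> (?\<psi> \<cdot> lift C [(A, B), (B, C)])" by simp
  also have "\<dots> = EComp G.enr (A, B, C) \<cdot> ((T (B, C) \<odot> T (A, B)) \<cdot> ?\<phi>)"
    using Cmp_lift1[of A B "[(B, C)]" C] by (simp add: lift_arrow)
  also have "\<dots> = (EComp G.enr (A, B, C) \<cdot> (T (B, C) \<odot> T (A, B))) \<cdot> ?\<phi>" by simp
  also have "\<dots> = (T (A, C) \<cdot> EComp F.enr (A, B, C)) \<cdot> ?\<phi>"
    using T by (simp add: is_enriched_mor_def)
  also have "\<dots> = lift C [(A, C)] \<cdot> Map2 F (?s, [0, 0], ?r)"
    by (simp add: lift_arrow F.EComp_Cmp)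
  finally show ?thesis by (simp add: nat_at_def)
qed

text \<open>The map \<open>n + 1 \<rightarrow> 1\<close> is the ordinal sum of
  \<open>1 \<rightarrow> 1\<close> and \<open>n \<rightarrow> 1\<close>, followed by
  \<open>2 \<rightarrow> 1\<close>.\<close>

lemma nat_at_collapse: "chain X A fs B \<Longrightarrow> nat_at B A fs (replicate (length fs) 0) [(A, B)]"
proof (induction fs arbitrary: A)
  case Nil
  then show ?case using nat_at_unit[of B] by auto
next
  case (Cons f fs)
  obtain A' where f: "f = (A, A')" "chain X A' fs B" "A \<in> X" "A' \<in> X" using Cons.prems by (cases f) auto
  have B: "B \<in> X" using chain_in[OF f(2)] by simp
  have "nat_at A' A [(A, A')] [0] [(A, A')]" using nat_at_id[of A "[(A, A')]" A'] f by simp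
  from nat_at_comp[OF nat_at_mult[OF f(3,4) B] nat_at_append[OF this Cons.IH[OF f(2)], simplified]]
  show ?case using f by (simp add: map_replicate)
qed

lemma nat_at_cut: "cut X B A fs u gs \<Longrightarrow> nat_at B A fs u gs"
proof (induction rule: cut.induct)
  case Nil
  then show ?case using nat_at_id[of B "[]" B] by simp
next
  case (Cons A fs A' fs' u gs)
  from nat_at_append[OF nat_at_collapse[OF Cons(1)] Cons.IH] show ?case by simp
qed

lemma arrow_part_surj: "\<exists>\<sigma>. is_point_mor (coarse X) M F G \<sigma> \<and> arrow_part \<sigma> = T"
proof -
  define \<sigma> where "\<sigma> = restrict (\<lambda>(A, fs, B). lift B fs) (paths (coarse X))"
  have s: "\<sigma> (A, fs, B) = lift B fs" if "chain X A fs B" for A fs B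
    using that by (simp add: \<sigma>_def paths_def)
  have "is_point_mor (coarse X) M F G \<sigma>"
    unfolding F.is_point_mor_iff
  proof (intro conjI allI impI ballI)
    show "\<sigma> \<in> extensional (paths (coarse X))" by (simp add: \<sigma>_def)
    show "\<sigma> (A, fs, B) \<in> hom M (Map1 F (A, fs, B)) (Map1 G (A, fs, B))" if "chain X A fs B" for A fs B
      using lift_simps[OF that] that by (simp add: s hom_def)
    show "Map2 G ((A, fs, B), u, A, gs, B) \<cdot> \<sigma> (A, fs, B) = \<sigma> (A, gs, B) \<cdot> Map2 F ((A, fs, B), u, A, gs, B)"
      if "cut X B A fs u gs" for A B fs u gs
      using nat_at_cut[OF that] cut_chain[OF that] by (simp add: nat_at_def s)
    show "Cmp G ((B, gs, C), A, fs, B) \<cdot> \<sigma> (A, fs @ gs, C)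
      = (\<sigma> (B, gs, C) \<odot> \<sigma> (A, fs, B)) \<cdot> Cmp F ((B, gs, C), A, fs, B)"
      if "chain X A fs B" "chain X B gs C" for A B C fs gs
    proof -
      have "chain X A (fs @ gs) C" unfolding chain_append using that by blast
      then show ?thesis using Cmp_lift[OF that] that by (simp add: s)
    qed
    show "Unt G A \<cdot> \<sigma> (A, [], A) = Unt F A" if "A \<in> X" for A
      using Unt_lift[OF that] that by (simp add: s)
  qed simp
  moreover have "arrow_part \<sigma> = T"
  proof (rule extensionalityI)
    show "arrow_part \<sigma> \<in> extensional (X \<times> X)" by (simp add: arrow_part_def)
    show "T \<in> extensional (X \<times> X)" using T by (simp add: is_enriched_mor_def)
    show "arrow_part \<sigma> p = T p" if "p \<in> X \<times> X" for p
      using that by (auto simp: arrow_part_def s lift_arrow)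
  qed
  ultimately show ?thesis by blast
qed

end

end

section \<open>The equivalence\<close>

context enriched_over
begin

sublocale pnt: point M X pnt
  by unfold_locales (rule is_point_pnt)

text \<open>The image of \<open>n \<rightarrow> 1\<close> ends in a product with an identity 1-cell.
  Naturality moves \<open>Lunit\<close> to the source, where it cancels the splitting off of an
  empty path.\<close>

lemma Lunit_tens_map_arrow:
  assumes c: "chain X A fs B" and A: "A \<in> X" "B \<in> X"
  shows "Lunit M (EHom \<A> (A, B)) \<cdot> tens_map B fs (replicate (length fs) 0) [(A, B)] = collapse B fs"
proof -
  let ?I = "Idn1 M (ob B)"
  have e: "chain X B [] B" using A by simp
  note [simp] = A tens_simps[OF c] collapse_simps[OF c] tens_split_simps[OF c e, simplified]
  have "Lunit M (EHom \<A> (A, B)) \<cdot> tens_map B fs (replicate (length fs) 0) [(A, B)]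
      = (Lunit M (EHom \<A> (A, B)) \<cdot> (Idn M ?I \<odot> collapse B fs)) \<cdot> tens_split B [] B fs"
    using tens_map_Cons[of B fs "[]" "[]" A B "[]"] by simp
  also have "\<dots> = (collapse B fs \<cdot> Lunit M (tens B fs)) \<cdot> tens_split B [] B fs"
    using Lunit_naturality[of "collapse B fs" "ob B"] by simp
  also have "\<dots> = collapse B fs" using Lunit_tens_split[OF c] by simp
  finally show ?thesis .
qed

text \<open>After \<open>Lunit\<close>, the structure cells of the reconstructed enriched category
  become instances of \<open>collapse\<close>, which by definition is built from the original
  ones.\<close>

lemma is_enriched_mor_counit:
  "is_enriched_mor M X pnt.enr \<A> (restrict (\<lambda>p. Lunit M (EHom \<A> p)) (X \<times> X))"
  unfolding is_enriched_mor_def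
proof (intro conjI ballI)
  let ?T = "restrict (\<lambda>p. Lunit M (EHom \<A> p)) (X \<times> X)"
  show "Over pnt.enr U = Over \<A> U" if "U \<in> Obj0 M" for U
  proof -
    have "{A \<in> X. ob A = U} = Over \<A> U"
      using that ob_eq[OF that] ob(2) EObj by (auto simp: EObj_def)
    moreover have "Over pnt.enr U = {A \<in> X. ob A = U}"
      by (auto simp: pnt.enr_def pnt_simps)
    ultimately show ?thesis by simp
  qed
  show "?T \<in> extensional (X \<times> X)" by simp
  have m1: "Map1 pnt (A, [(A, B)], B) = Idn1 M (ob B) \<otimes> EHom \<A> (A, B)" if "A \<in> X" "B \<in> X" for A B
    using that pnt_simps(2)[of A "[(A, B)]" B] by simp
  show "?T (A, B) \<in> hom M (EHom pnt.enr (A, B)) (EHom \<A> (A, B))" if "A \<in> X" "B \<in> X" for A B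
    using that by (simp add: hom_def m1)
  show "?T (A, A) \<cdot> EId pnt.enr A = EId \<A> A" if A [simp]: "A \<in> X" for A
  proof -
    have "Map2 pnt ((A, [], A), [], (A, [(A, A)], A)) = tens_map A [] [] [(A, A)]"
      by (rule pnt_simps) (rule pnt.cuts[OF A])
    then have "EId pnt.enr A = tens_map A [] [] [(A, A)]"
      using tens_map_simps[OF pnt.cuts(1)[OF A]] pnt.EId_Unt[OF A] by (simp add: pnt_simps m1)
    then show ?thesis using Lunit_tens_map_arrow[of A "[]" A] by simp
  qed
  show "?T (A, C) \<cdot> EComp pnt.enr (A, B, C) = EComp \<A> (A, B, C) \<cdot> (?T (B, C) \<odot> ?T (A, B))"
    if [simp]: "A \<in> X" "B \<in> X" "C \<in> X" for A B C
  proof (rule isos_cancel_right)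
    let ?\<phi> = "tens_split C [(B, C)] B [(A, B)]"
    have c: "chain X A [(A, B)] B" "chain X B [(B, C)] C" "chain X A [(A, B), (B, C)] C" by simp_all
    note [simp] = tens_split_simps[OF c(1,2), simplified]
    \<comment> \<open>By the left identity axiom, the two constraints on the right-hand side are
      collapses of single arrows.\<close>
    have col: "collapse C [(B, C)] = Lunit M (EHom \<A> (B, C))" "collapse B [(A, B)] = Lunit M (EHom \<A> (A, B))"
      by (simp_all add: enr_axioms)
    have "EComp pnt.enr (A, B, C) \<cdot> ?\<phi> = tens_map C [(A, B), (B, C)] [0, 0] [(A, C)]"
      using pnt.EComp_Cmp[of A B C] pnt_simps(4)[OF c(1,2)] pnt_simps(3)[OF pnt.cuts(3)[of A B C]] by simp
    \<comment> \<open>The left side has become the collapse of a path of length two, which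
      \<open>collapse_append\<close> splits at \<open>B\<close>.\<close>
    then have "(?T (A, C) \<cdot> EComp pnt.enr (A, B, C)) \<cdot> ?\<phi> = collapse C ([(A, B)] @ [(B, C)])"
      using Lunit_tens_map_arrow[OF c(3)] by (simp add: m1)
    also have "\<dots> = EComp \<A> (A, B, C) \<cdot> ((collapse C [(B, C)] \<odot> collapse B [(A, B)]) \<cdot> ?\<phi>)"
      by (rule collapse_append[OF c(1,2)])
    also have "\<dots> = (EComp \<A> (A, B, C) \<cdot> (?T (B, C) \<odot> ?T (A, B))) \<cdot> ?\<phi>"
      unfolding col by simp
    finally show "(?T (A, C) \<cdot> EComp pnt.enr (A, B, C)) \<cdot> ?\<phi> = (EComp \<A> (A, B, C) \<cdot> (?T (B, C) \<odot> ?T (A, B))) \<cdot> ?\<phi>" .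
  qed (use tens_split_simps[of A "[(A, B)]" B "[(B, C)]" C] in \<open>simp_all add: m1\<close>)
qed

end

theorem proposition12:
  fixes M :: "('o, 'a, 'c) bicat"
    and X :: "'x set"
  assumes "bicategory M"
    and "X \<noteq> {}"
  shows "equivalent_categories (point_cat (coarse X) M (isos M)) (enriched_cat M X)"
proof -
  interpret bicategory M by fact
  let ?P = "point_cat (coarse X) M (isos M)" and ?E = "enriched_cat M X"
  let ?Fo = "point.enr M X" and ?Fa = "\<lambda>(F, \<sigma>, G). (point.enr M X F, point_pair.arrow_part X \<sigma>, point.enr M X G)"
  have pnt: "point M X F" if "is_point (coarse X) M (isos M) F" for F
    using that by unfold_locales
  have pair: "point_pair M X F G" if "is_point (coarse X) M (isos M) F" "is_point (coarse X) M (isos M) G" for F G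
    using that by (intro point_pair.intro pnt)
  have arr: "f \<in> Arr ?P \<longleftrightarrow> (\<exists>F \<sigma> G. f = (F, \<sigma>, G) \<and> is_point (coarse X) M (isos M) F \<and>
      is_point (coarse X) M (isos M) G \<and> is_point_mor (coarse X) M F G \<sigma>)" for f
    by (auto simp: point_cat_def)
  note pt = point.enriched_category_enr[OF pnt] point.enr_EObj[OF pnt]
  \<comment> \<open>\<open>arrow_part\<close> depends on \<open>X\<close> and the family only, so
    any pair of points may serve to unfold it, as is done below for composites.\<close>
  note part = point_pair.arrow_part_def[OF pair]
  show ?thesis
  proof (rule equivalent_categoriesI[OF category_point_cat category_enriched_cat, where Fo = ?Fo and Fa = ?Fa])
    show "is_functor ?P ?E ?Fo ?Fa"
      unfolding is_functor_def
    proof (intro conjI ballI impI)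
      fix F assume "F \<in> Obj ?P"
      then have F: "is_point (coarse X) M (isos M) F" by (simp add: point_cat_def)
      then show "?Fo F \<in> Obj ?E" by (simp add: enriched_cat_def pt)
      interpret F: point M X F by (rule pnt[OF F])
      show "?Fa (Idn ?P F) = Idn ?E (?Fo F)"
        by (auto simp: point_cat_def enriched_cat_def part[OF F F] paths_def intro!: restrict_ext)
    next
      fix f assume "f \<in> Arr ?P"
      then obtain F \<sigma> G where f: "f = (F, \<sigma>, G)" "is_point (coarse X) M (isos M) F"
        "is_point (coarse X) M (isos M) G" "is_point_mor (coarse X) M F G \<sigma>" unfolding arr by blast
      show "?Fa f \<in> hom ?E (?Fo (Dom ?P f)) (?Fo (Cod ?P f))"
        using point_pair.is_enriched_mor_arrow_part[OF pair[OF f(2,3)] f(4)] f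
        by (simp add: point_cat_def enriched_cat_def hom_def pt)
      fix g assume g: "g \<in> Arr ?P" and fg: "Cod ?P f = Dom ?P g"
      from g obtain G' \<tau> H where "g = (G', \<tau>, H)" "is_point (coarse X) M (isos M) G'"
        "is_point (coarse X) M (isos M) H" "is_point_mor (coarse X) M G' H \<tau>" unfolding arr by blast
      with fg f(1) have g: "g = (G, \<tau>, H)" "is_point (coarse X) M (isos M) H" "is_point_mor (coarse X) M G H \<tau>"
        by (auto simp: point_cat_def)
      show "?Fa (Comp ?P g f) = Comp ?E (?Fa g) (?Fa f)"
        by (auto simp: f(1) g(1) point_cat_def enriched_cat_def part[OF f(2,2)] paths_def intro!: restrict_ext)
    qed
  next
    fix f g assume fg: "f \<in> Arr ?P" "g \<in> Arr ?P" "Dom ?P f = Dom ?P g" "Cod ?P f = Cod ?P g" "?Fa f = ?Fa g"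
    from fg(1) obtain F \<sigma> G where f: "f = (F, \<sigma>, G)" "is_point (coarse X) M (isos M) F"
      "is_point (coarse X) M (isos M) G" "is_point_mor (coarse X) M F G \<sigma>" unfolding arr by blast
    from fg(2) obtain F' \<tau> G' where g: "g = (F', \<tau>, G')" "is_point_mor (coarse X) M F' G' \<tau>" unfolding arr by blast
    have FG: "F' = F" "G' = G" using fg(3,4) f(1) g(1) by (simp_all add: point_cat_def)
    have "\<sigma> = \<tau>"
      using point_pair.arrow_part_inj[OF pair[OF f(2,3)] f(4) g(2)[unfolded FG]] fg(5) f(1) g(1) by simp
    then show "f = g" using f(1) g(1) FG by simp
  next
    fix F G h assume "F \<in> Obj ?P" "G \<in> Obj ?P" and h: "h \<in> hom ?E (?Fo F) (?Fo G)"
    then have FG: "is_point (coarse X) M (isos M) F" "is_point (coarse X) M (isos M) G"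
      by (simp_all add: point_cat_def)
    from h obtain T where T: "h = (?Fo F, T, ?Fo G)" "is_enriched_mor M X (?Fo F) (?Fo G) T"
      by (cases h) (simp add: enriched_cat_def hom_def)
    from point_pair.arrow_part_surj[OF pair[OF FG] T(2)] obtain \<sigma> where
      "is_point_mor (coarse X) M F G \<sigma>" "point_pair.arrow_part X \<sigma> = T" by blast
    then have "(F, \<sigma>, G) \<in> hom ?P F G" "?Fa (F, \<sigma>, G) = h"
      using FG T(1) by (simp_all add: point_cat_def hom_def)
    then show "\<exists>f \<in> hom ?P F G. ?Fa f = h" by blast
  next
    fix \<A> assume "\<A> \<in> Obj ?E"
    then have A: "enriched_category M \<A>" "EObj M \<A> = X" by (simp_all add: enriched_cat_def)
    interpret enriched_over M \<A> X by (rule enriched_overI[OF A])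
    let ?e = "(pnt.enr, restrict (\<lambda>p. Lunit M (EHom \<A> p)) (X \<times> X), \<A>)"
    have "?e \<in> isos ?E"
      by (rule enriched_mor_isos[OF pt[OF is_point_pnt] A is_enriched_mor_counit]) simp
    moreover have "pnt \<in> Obj ?P" using is_point_pnt by (simp add: point_cat_def)
    moreover have "Dom ?E ?e = ?Fo pnt" "Cod ?E ?e = \<A>" by (simp_all add: enriched_cat_def)
    ultimately show "\<exists>F \<in> Obj ?P. \<exists>e \<in> isos ?E. Dom ?E e = ?Fo F \<and> Cod ?E e = \<A>" by blast
  qed
qed

end
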